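(* Let $d\ge1$, $H>0$, let $\{X(t):t\ge0\}$ be a non-deterministic $H$-selfsimilar additive process on $\mathbb{R}^d$, and let $g\in\mathcal{G}_1$. Let $F$ be any one of the three functions $G_1$, $K$, $L$ on $(0,\infty)$, and suppose that $F\in OR$. Then $$\limsup_{t\to\infty}\frac{|X(t)|}{t^Hg(\log t)}=C\quad\text{a.s.}$$ holds with $C=0$ if $\int_0^\infty F(g(x))\,dx<\infty$, and with $C=\infty$ if $\int_0^\infty F(g(x))\,dx=\infty$.
   Context: $|x|$ is the Euclidean norm; "increasing" and "decreasing" are in the wide sense. An $\mathbb{R}^d$-valued process $\{X(t):t\ge0\}$ is an $H$-selfsimilar additive process ($H>0$) if: (1) $\{X(ct)\}\stackrel{d}{=}\{c^HX(t)\}$ (equality of finite-dimensional distributions) for every $c>0$; (2) it has independent increments (stationarity not assumed); (3) almost surely its paths are right-continuous with left limits. It is non-deterministic if it is not of the form $X(t)=t^Hc$ with $c\in\mathbb{R}^d$. $\mathcal{G}_1$ is the set of positive increasing functions $g$ on $[0,\infty)$ with $\lim_{x\to\infty}g(x)=\infty$. Functions on $(0,\infty)$: $G_1(r):=P(|X(1)-X(e^{-1})|>r)$; $L(r):=P(r<|X(1)|\le e^{3H}r)$; and $K$ is defined as follows. The distribution $\mu$ of $X(1)$ is selfdecomposable, hence infinitely divisible; let $\nu$ be its Lévy measure. If $\nu\ne0$, then $\nu(B)=\int_{S^{d-1}}\sigma(d\xi)\int_0^\infty1_B(r\xi)k_\xi(r)r^{-1}dr$, where $\sigma$ is a finite non-zero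 measure on the unit sphere $S^{d-1}$ and $k_\xi(r)\ge0$ is measurable in $\xi$ and decreasing in $r>0$; put $K(r):=\int_{S^{d-1}}k_\xi(r)\sigma(d\xi)$. If $\nu=0$, $K\equiv0$. $f\asymp g$ means $0<\liminf_{x\to\infty}f(x)/g(x)\le\limsup_{x\to\infty}f(x)/g(x)<\infty$. A positive measurable function $h$ belongs to $OR$ if $h(cx)\asymp h(x)$ for every $c>0$. *)

theory Defs
  imports "HOL-Probability.Probability"
begin

text \<open>The values of \<open>X t\<close> for \<open>t < 0\<close> are irrelevant throughout. Independence of increments
  is stated for increments only: selfsimilarity forces \<open>X 0 = 0\<close> almost surely, so the initial
  value need not be listed as a further independent variable.\<close>

locale selfsimilar_additive_process = prob_space M for M :: "'w measure" +
  fixes H :: real and X :: "real \<Rightarrow> 'w \<Rightarrow> real ^ 'n"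
  assumes H_pos: "H > 0"
    and random_variable: "\<And>t. t \<ge> 0 \<Longrightarrow> X t \<in> borel_measurable M"
    and selfsimilar: "\<And>c I. \<lbrakk>c > 0; finite I; I \<subseteq> {0..}\<rbrakk> \<Longrightarrow>
      distr M (Pi\<^sub>M I (\<lambda>_. borel)) (\<lambda>\<omega>. \<lambda>t\<in>I. X (c * t) \<omega>) =
      distr M (Pi\<^sub>M I (\<lambda>_. borel)) (\<lambda>\<omega>. \<lambda>t\<in>I. (c powr H) *\<^sub>R X t \<omega>)"
    and independent_increments: "\<And>(t :: nat \<Rightarrow> real) n. \<lbrakk>0 \<le> t 0; strict_mono_on {..n} t\<rbrakk> \<Longrightarrow>
      indep_vars (\<lambda>_. borel) (\<lambda>i \<omega>. X (t (Suc i)) \<omega> - X (t i) \<omega>) {..<n}"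
    and cadlag_paths: "AE \<omega> in M.
      (\<forall>t\<ge>0. continuous (at_right t) (\<lambda>s. X s \<omega>)) \<and>
      (\<forall>t>0. \<exists>l. ((\<lambda>s. X s \<omega>) \<longlongrightarrow> l) (at_left t))"

definition deterministic_process ::
  "'w measure \<Rightarrow> real \<Rightarrow> (real \<Rightarrow> 'w \<Rightarrow> real ^ 'n) \<Rightarrow> bool" where
  "deterministic_process M H X \<longleftrightarrow> (\<exists>c. AE \<omega> in M. \<forall>t\<ge>0. X t \<omega> = (t powr H) *\<^sub>R c)"

definition class_G1 :: "(real \<Rightarrow> real) set" where
  "class_G1 = {g. (\<forall>x\<ge>0. g x > 0) \<and> mono_on {0..} g \<and> filterlim g at_top at_top}"

definition same_order :: "(real \<Rightarrow> real) \<Rightarrow> (real \<Rightarrow> real) \<Rightarrow> bool" (infix "\<asymp>" 50) where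
  "f \<asymp> g \<longleftrightarrow>
    0 < Liminf at_top (\<lambda>x. ereal (f x / g x)) \<and>
    Limsup at_top (\<lambda>x. ereal (f x / g x)) < \<infinity>"

text \<open>Functions on \<open>(0,\<infinity>)\<close> are represented by total functions whose values on
  \<open>(-\<infinity>,0]\<close> are ignored.\<close>

definition class_OR :: "(real \<Rightarrow> real) set" where
  "class_OR = {h. (\<forall>x>0. h x > 0) \<and> h \<in> borel_measurable (restrict_space borel {0<..}) \<and>
     (\<forall>c>0. (\<lambda>x. h (c * x)) \<asymp> h)}"

definition increment_tail :: "'w measure \<Rightarrow> (real \<Rightarrow> 'w \<Rightarrow> real ^ 'n) \<Rightarrow> real \<Rightarrow> real" where
  "increment_tail M X r = measure M {\<omega> \<in> space M. norm (X 1 \<omega> - X (exp (- 1)) \<omega>) > r}"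

definition shell_prob ::
  "'w measure \<Rightarrow> real \<Rightarrow> (real \<Rightarrow> 'w \<Rightarrow> real ^ 'n) \<Rightarrow> real \<Rightarrow> real" where
  "shell_prob M H X r =
    measure M {\<omega> \<in> space M. r < norm (X 1 \<omega>) \<and> norm (X 1 \<omega>) \<le> exp (3 * H) * r}"

text \<open>The Levy-Khintchine representation with truncation function \<open>1\<^bsub>|x| \<le> 1\<^esub>\<close>; the measure
  \<open>\<nu>\<close> in it is uniquely determined by \<open>\<mu>\<close>.\<close>

definition levy_measure_of :: "(real ^ 'n) measure \<Rightarrow> (real ^ 'n) measure \<Rightarrow> bool" where
  "levy_measure_of \<mu> \<nu> \<longleftrightarrow>
    sets \<nu> = sets borel \<and> emeasure \<nu> {0} = 0 \<and>
    (\<integral>\<^sup>+x. ennreal (min 1 ((norm x)\<^sup>2)) \<partial>\<nu>) < \<infinity> \<and>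
    (\<exists>(A :: real ^ 'n ^ 'n) (\<gamma> :: real ^ 'n).
      transpose A = A \<and> (\<forall>z. 0 \<le> z \<bullet> (A *v z)) \<and>
      (\<forall>z. (CLINT x|\<mu>. iexp (z \<bullet> x)) =
        exp (- complex_of_real (z \<bullet> (A *v z)) / 2 + \<i> * complex_of_real (\<gamma> \<bullet> z) +
          (CLINT x|\<nu>. iexp (z \<bullet> x) - 1
             - \<i> * complex_of_real ((z \<bullet> x) * indicator (cball 0 1) x)))))"

definition polar_decomposition ::
  "(real ^ 'n) measure \<Rightarrow> (real ^ 'n) measure \<Rightarrow> (real ^ 'n \<Rightarrow> real \<Rightarrow> real) \<Rightarrow> bool" where
  "polar_decomposition \<nu> \<sigma> k \<longleftrightarrow>
    sets \<sigma> = sets (restrict_space borel (sphere 0 1)) \<and>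
    finite_measure \<sigma> \<and> emeasure \<sigma> (space \<sigma>) \<noteq> 0 \<and>
    (\<forall>\<xi>\<in>sphere 0 1. \<forall>r>0. k \<xi> r \<ge> 0) \<and>
    (\<forall>\<xi>\<in>sphere 0 1. antimono_on {0<..} (k \<xi>)) \<and>
    (\<forall>r>0. (\<lambda>\<xi>. k \<xi> r) \<in> borel_measurable \<sigma>) \<and>
    (\<forall>B\<in>sets borel. emeasure \<nu> B =
      (\<integral>\<^sup>+\<xi>. (\<integral>\<^sup>+r\<in>{0<..}. indicator B (r *\<^sub>R \<xi>) * ennreal (k \<xi> r / r) \<partial>lborel) \<partial>\<sigma>))"

text \<open>The pair \<open>(\<sigma>, k)\<close> is not unique, so \<open>K\<close> is characterised by a relation to the law
  \<open>\<mu>\<close> of \<open>X 1\<close>; any two choices give functions \<open>K\<close> that agree up to countably many points.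
  The Bochner integral below is of an integrable function whenever \<open>\<nu>\<close> is a Levy measure,
  because \<open>k \<xi>\<close> is decreasing.\<close>

definition K_function_of :: "(real ^ 'n) measure \<Rightarrow> (real \<Rightarrow> real) \<Rightarrow> bool" where
  "K_function_of \<mu> K \<longleftrightarrow>
    (\<exists>\<nu>. levy_measure_of \<mu> \<nu> \<and>
      (if \<nu> = null_measure borel then \<forall>r>0. K r = 0
       else \<exists>\<sigma> k. polar_decomposition \<nu> \<sigma> k \<and> (\<forall>r>0. K r = (LINT \<xi>|\<sigma>. k \<xi> r))))"

end

theory Submission
  imports Defs "HOL-Real_Asymp.Real_Asymp"
begin

text \<open>Put \<open>a = b powr (- H)\<close> for some \<open>b > 1\<close>. The normalised values
  \<open>Y n = X (b ^ n) / (b ^ n) powr H\<close> satisfy \<open>Y (Suc n) = a Y n + Z n\<close>, where the \<open>Z n\<close> are independent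
  copies of \<open>X 1 - X (1 / b)\<close>. By Borel--Cantelli and Ottaviani's maximal inequality, the upper limit is
  therefore decided by the convergence of the series of \<open>G (c g (n ln b))\<close>, \<open>c > 0\<close>, where \<open>G\<close> is the tail
  of \<open>\<bar>X 1 - X (1 / b)\<bar>\<close>. Whenever \<open>F\<close> is in \<open>OR\<close> and \<open>G\<close> and \<open>F\<close> dominate each other up to
  constants, also inside the arguments, this is the integral test for \<open>F\<close>.

  For \<open>L\<close> and \<open>K\<close>, \<open>F\<close> is easily bounded by \<open>G\<close>. Conversely one finds
  \<open>G s \<le> C F (c s) + \<eta> s G (s / l)\<close> with \<open>\<eta> s \<longrightarrow> 0\<close>, and such an inequality iterates to
  \<open>G s \<le> C' F (c s)\<close> because \<open>F\<close> grows at most by a constant factor from \<open>c s\<close> to \<open>c s / l\<close>.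
  For \<open>L\<close> it comes from the independence of \<open>X (1 / b)\<close> and \<open>X 1 - X (1 / b)\<close>; for \<open>K\<close> it is the
  Hoffmann-Jorgensen inequality for a fine partition of \<open>[1 / b, 1]\<close>, as the expected number of large
  increments in the partition tends to the mass of large jumps in the Levy measure of
  \<open>X 1 - X (1 / b)\<close>, which is comparable to \<open>K\<close>. That limit is computed with characteristic functions
  of the symmetrised coordinates.\<close>

section \<open>A cutoff function with integrable Fourier transform\<close>

text \<open>The dichotomy between 0 and infinity comes from \<open>class_OR\<close>: convergence at
  one scale c implies it at all scales, so the constants lost in the maximal inequalities are
  harmless. As the criterion holds for every b > 1, b is adapted to F: exp 1 is built into the first
  function, the shells call for exp 4, and K for b powr H = 10. In the last case X (1 / b) has the
  law of X 1 / 10, so the Levy mass of X 1 - X (1 / b) is a difference of masses of \<nu> at two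
  scales of ratio 10.

  The obstacle for K is that a Levy-Khintchine formula is given for X 1 only. Moduli of
  characteristic functions reach the increments by division and remove the drift; integration
  against a kernel with vanishing second moment removes the Gaussian part. The resulting limit is
  not uniform in the level, but the inequalities on the partitions hold for every number of pieces,
  so a partition may be chosen for each level separately.\<close>

lemma has_bochner_integral_one_minus_cos:
  "has_bochner_integral lborel (\<lambda>t::real. (1 - cos t) / t\<^sup>2) pi"
proof -
  \<comment> \<open>Integration by parts; the limit pi / 2 of \<open>Si\<close> at infinity is the
    Dirichlet integral.\<close>
  define F :: "real \<Rightarrow> real" where "F = (\<lambda>t. Si t - (1 - cos t) / t)"
  have D: "(F has_real_derivative (1 - cos x) / x\<^sup>2) (at x)" if "x > 0" for x
    unfolding F_def using that
    by (auto intro!: derivative_eq_intros DERIV_Si simp: power2_eq_square field_simps)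
  have lim0: "(F \<longlongrightarrow> 0) (at_right 0)"
  proof -
    have "((\<lambda>t. Si t) \<longlongrightarrow> Si 0) (at_right 0)"
      using isCont_Si[of 0] unfolding isCont_def by (rule tendsto_mono[rotated]) (auto intro: at_le)
    moreover have "Si 0 = 0" by (simp add: Si_def zero_ereal_def[symmetric])
    moreover have "((\<lambda>t::real. (1 - cos t) / t) \<longlongrightarrow> 0) (at_right 0)" by real_asymp
    ultimately show ?thesis unfolding F_def using tendsto_diff by fastforce
  qed
  have limi: "(F \<longlongrightarrow> pi / 2) at_top"
  proof -
    have "((\<lambda>t::real. (1 - cos t) / t) \<longlongrightarrow> 0) at_top" by real_asymp
    from tendsto_diff[OF Si_at_top this] show ?thesis unfolding F_def by simp
  qed
  have "set_integrable lborel (einterval 0 \<infinity>) (\<lambda>t::real. (1 - cos t) / t\<^sup>2)"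
    "(LBINT t=0..\<infinity>. (1 - cos t) / t\<^sup>2) = pi / 2 - 0"
    using interval_integral_FTC_nonneg[of 0 \<infinity> F "\<lambda>t. (1 - cos t) / t\<^sup>2" 0 "pi / 2"] D lim0 limi
    by (auto simp: zero_ereal_def ereal_tendsto_simps intro!: continuous_intros)
  moreover have "einterval 0 \<infinity> = {0<..}" by (auto simp: einterval_def)
  ultimately have "has_bochner_integral lborel (\<lambda>t::real. indicator {0<..} t *\<^sub>R ((1 - cos t) / t\<^sup>2)) (pi / 2)"
    by (auto simp: has_bochner_integral_iff set_integrable_def interval_lebesgue_integral_def
        set_lebesgue_integral_def)
  moreover have "(\<lambda>t::real. indicator {0<..} t *\<^sub>R ((1 - cos t) / t\<^sup>2)) =
      (\<lambda>t::real. indicator {0..} t *\<^sub>R ((1 - cos t) / t\<^sup>2))"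
    by (auto simp: fun_eq_iff indicator_def)
  ultimately have "has_bochner_integral lborel (\<lambda>t::real. (1 - cos t) / t\<^sup>2) (2 *\<^sub>R (pi / 2))"
    by (intro has_bochner_integral_even_function) auto
  then show ?thesis by simp
qed

lemma has_bochner_integral_one_minus_cos_scale:
  fixes u :: real
  shows "has_bochner_integral lborel (\<lambda>t. (1 - cos (u * t)) / t\<^sup>2) (pi * \<bar>u\<bar>)"
proof (cases "u = 0")
  case False
  have "has_bochner_integral lborel (\<lambda>t. (1 - cos (0 + u * t)) / (0 + u * t)\<^sup>2) (pi /\<^sub>R \<bar>u\<bar>)"
    using lborel_has_bochner_integral_real_affine_iff[of u "\<lambda>t. (1 - cos t) / t\<^sup>2" pi 0]
      has_bochner_integral_one_minus_cos False by auto
  then have "has_bochner_integral lborel (\<lambda>t. u\<^sup>2 * ((1 - cos (0 + u * t)) / (0 + u * t)\<^sup>2)) (u\<^sup>2 * (pi /\<^sub>R \<bar>u\<bar>))"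
    by (intro has_bochner_integral_mult_right) auto
  moreover have "(\<lambda>t. u\<^sup>2 * ((1 - cos (0 + u * t)) / (0 + u * t)\<^sup>2)) = (\<lambda>t. (1 - cos (u * t)) / t\<^sup>2)"
    using False by (auto simp: power_mult_distrib fun_eq_iff)
  moreover have "u\<^sup>2 * (pi /\<^sub>R \<bar>u\<bar>) = pi * \<bar>u\<bar>"
    using False by (auto simp: power2_eq_square field_simps abs_if)
  ultimately show ?thesis by (simp only:)
qed (simp add: has_bochner_integral_zero)

text \<open>A plateau: 1 on [-2, 2], 0 outside (-4, 4), linear in between. Absolute values are used
  because pi * |u| is the integral of (1 - cos (u t)) / t^2; the coefficients sum to 0, so only
  cosines remain in the kernel.\<close>

definition trapezoid :: "real \<Rightarrow> real" where
  "trapezoid x = (\<bar>x + 4\<bar> + \<bar>x - 4\<bar> - \<bar>x + 2\<bar> - \<bar>x - 2\<bar>) / 4"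

definition trapezoid_kernel :: "real \<Rightarrow> real" where
  "trapezoid_kernel t = (cos (2 * t) - cos (4 * t)) / (2 * pi * t\<^sup>2)"

lemma trapezoid_kernel_measurable [measurable]: "trapezoid_kernel \<in> borel_measurable borel"
  unfolding trapezoid_kernel_def by measurable

lemma trapezoid_measurable [measurable]: "trapezoid \<in> borel_measurable borel"
  unfolding trapezoid_def by measurable

lemma trapezoid_bounds: "0 \<le> trapezoid x" "trapezoid x \<le> 1"
  "\<bar>x\<bar> \<le> 2 \<Longrightarrow> trapezoid x = 1" "\<bar>x\<bar> \<ge> 4 \<Longrightarrow> trapezoid x = 0"
  by (auto simp: trapezoid_def)

lemma has_bochner_integral_trapezoid:
  "has_bochner_integral lborel (\<lambda>t. cos (x * t) * trapezoid_kernel t) (trapezoid x)"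
proof -
  let ?h = "\<lambda>u t::real. (1 - cos (u * t)) / t\<^sup>2"
  have "has_bochner_integral lborel
      (\<lambda>t. (?h (x + 4) t + ?h (x - 4) t - ?h (x + 2) t - ?h (x - 2) t) / (4 * pi))
      ((pi * \<bar>x + 4\<bar> + pi * \<bar>x - 4\<bar> - pi * \<bar>x + 2\<bar> - pi * \<bar>x - 2\<bar>) / (4 * pi))"
    by (intro has_bochner_integral_divide_zero has_bochner_integral_diff has_bochner_integral_add
        has_bochner_integral_one_minus_cos_scale)
  moreover have "(?h (x + 4) t + ?h (x - 4) t - ?h (x + 2) t - ?h (x - 2) t) / (4 * pi) =
      cos (x * t) * trapezoid_kernel t" for t
  proof -
    have "cos ((x + 2) * t) + cos ((x - 2) * t) = 2 * cos (x * t) * cos (2 * t)"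
      "cos ((x + 4) * t) + cos ((x - 4) * t) = 2 * cos (x * t) * cos (4 * t)"
      by (simp_all add: ring_distribs cos_add cos_diff)
    then have "(1 - cos ((x + 4) * t)) + (1 - cos ((x - 4) * t)) - (1 - cos ((x + 2) * t)) -
        (1 - cos ((x - 2) * t)) = 2 * cos (x * t) * (cos (2 * t) - cos (4 * t))"
      by (simp add: algebra_simps)
    then show ?thesis
      unfolding trapezoid_kernel_def
      by (simp add: add_divide_distrib[symmetric] diff_divide_distrib[symmetric])
  qed
  moreover have "(pi * \<bar>x + 4\<bar> + pi * \<bar>x - 4\<bar> - pi * \<bar>x + 2\<bar> - pi * \<bar>x - 2\<bar>) / (4 * pi) =
      trapezoid x"
    unfolding trapezoid_def by (simp add: field_simps)
  ultimately show ?thesis by simp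
qed

lemma integrable_trapezoid_kernel: "integrable lborel trapezoid_kernel"
  using has_bochner_integral_trapezoid[of 0] by (simp add: has_bochner_integral_iff)

text \<open>The transform of the triangle density is the Fejer kernel. As a second factor it
  supplies the decay of \<open>cutoff_kernel\<close>; on the other side of the transform it averages
  the trapezoid over shifts in [-1, 1].\<close>

lemma has_bochner_integral_triangle:
  fixes t :: real
  assumes "t \<noteq> 0"
  shows "has_bochner_integral lborel (\<lambda>y. indicator {-1..1} y * (1 - \<bar>y\<bar>) * cos (t * y))
    (2 * (1 - cos t) / t\<^sup>2)"
proof -
  define F where "F y = (1 - y) * sin (t * y) / t - cos (t * y) / t\<^sup>2" for y :: real
  have "has_bochner_integral lborel (\<lambda>y. indicator {0..1} y *\<^sub>R ((1 - y) * cos (t * y))) (F 1 - F 0)"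
    by (rule has_bochner_integral_FTC_Icc)
      (use assms in \<open>auto simp: F_def power2_eq_square has_real_derivative_iff_has_vector_derivative[symmetric]
         field_simps intro!: derivative_eq_intros continuous_intros\<close>)
  moreover have "(\<lambda>y. indicator {0..1} y *\<^sub>R ((1 - y) * cos (t * y))) =
      (\<lambda>y. indicator {0..} y *\<^sub>R (indicator {-1..1} y * (1 - \<bar>y\<bar>) * cos (t * y)))"
    by (auto simp: fun_eq_iff indicator_def)
  ultimately have "has_bochner_integral lborel (\<lambda>y. indicator {-1..1} y * (1 - \<bar>y\<bar>) * cos (t * y))
      (2 *\<^sub>R (F 1 - F 0))"
    by (intro has_bochner_integral_even_function) (auto simp: indicator_def)
  moreover have "2 *\<^sub>R (F 1 - F 0) = 2 * (1 - cos t) / t\<^sup>2"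
    by (simp add: F_def diff_divide_distrib)
  ultimately show ?thesis by (simp only:)
qed

lemma has_bochner_integral_triangle_mass:
  "has_bochner_integral lborel (\<lambda>y::real. indicator {-1..1} y * (1 - \<bar>y\<bar>)) 1"
proof -
  define F where "F y = y - y\<^sup>2 / 2" for y :: real
  have "has_bochner_integral lborel (\<lambda>y. indicator {0..1} y *\<^sub>R (1 - y)) (F 1 - F 0)"
    by (rule has_bochner_integral_FTC_Icc)
      (auto simp: F_def has_real_derivative_iff_has_vector_derivative[symmetric]
         intro!: derivative_eq_intros continuous_intros)
  moreover have "(\<lambda>y::real. indicator {0..1} y *\<^sub>R (1 - y)) =
      (\<lambda>y. indicator {0..} y *\<^sub>R (indicator {-1..1} y * (1 - \<bar>y\<bar>)))"
    by (auto simp: fun_eq_iff indicator_def)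
  ultimately have "has_bochner_integral lborel (\<lambda>y::real. indicator {-1..1} y * (1 - \<bar>y\<bar>))
      (2 *\<^sub>R (F 1 - F 0))"
    by (intro has_bochner_integral_even_function) (auto simp: indicator_def)
  moreover have "2 *\<^sub>R (F 1 - F 0) = 1"
    by (simp add: F_def)
  ultimately show ?thesis by (simp only:)
qed

text \<open>The kernel decays like \<open>t\<^sup>-\<^sup>4\<close>, so that it can be integrated against the quadratic growth of a
  Levy-Khintchine exponent; its second moment vanishes because the transform is constant near \<open>0\<close>.\<close>

definition cutoff_kernel :: "real \<Rightarrow> real" where
  "cutoff_kernel t = trapezoid_kernel t * (2 * (1 - cos t) / t\<^sup>2)"

text \<open>This is 1 minus the trapezoid averaged against the triangle density, see
  \<open>cutoff_eq'\<close>. The form with 1 - cos matches the real part of a Levy-Khintchine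
  exponent.\<close>

definition cutoff :: "real \<Rightarrow> real" where
  "cutoff x = (\<integral>t. (1 - cos (x * t)) * cutoff_kernel t \<partial>lborel)"

lemma cutoff_kernel_measurable [measurable]: "cutoff_kernel \<in> borel_measurable borel"
  unfolding cutoff_kernel_def by measurable

lemma triangle_transform_bounds:
  fixes t :: real
  shows "0 \<le> 2 * (1 - cos t) / t\<^sup>2" "2 * (1 - cos t) / t\<^sup>2 \<le> 1"
proof -
  have "1 - cos t = 2 * (sin (t / 2))\<^sup>2"
    using cos_double_sin[of "t / 2"] by simp
  moreover have "(sin (t / 2))\<^sup>2 \<le> (t / 2)\<^sup>2"
    using abs_sin_x_le_abs_x[of "t / 2"] unfolding abs_le_square_iff[symmetric] .
  ultimately show "2 * (1 - cos t) / t\<^sup>2 \<le> 1"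
    by (auto simp: divide_le_eq power_divide)
qed simp

lemma integrable_cutoff_kernel: "integrable lborel cutoff_kernel"
proof (rule Bochner_Integration.integrable_bound[OF integrable_trapezoid_kernel])
  show "AE t in lborel. norm (cutoff_kernel t) \<le> norm (trapezoid_kernel t)"
    using triangle_transform_bounds
    by (intro AE_I2) (auto simp: cutoff_kernel_def abs_mult simp del: times_divide_eq_right
        intro!: mult_left_le)
qed simp

text \<open>The factor t^2 cancels the Fejer denominator and leaves the transforms of the trapezoid
  at 0 and 1, where its values agree. Hence a Gaussian term q t^2 / 2 integrates to 0 against the
  kernel.\<close>

lemma cutoff_kernel_second_moment:
  "has_bochner_integral lborel (\<lambda>t. t\<^sup>2 * cutoff_kernel t) 0"
proof -
  have "has_bochner_integral lborel
      (\<lambda>t. 2 * (cos (0 * t) * trapezoid_kernel t - cos (1 * t) * trapezoid_kernel t))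
      (2 * (trapezoid 0 - trapezoid 1))"
    by (intro has_bochner_integral_mult_right has_bochner_integral_diff has_bochner_integral_trapezoid)
  moreover have "2 * (trapezoid 0 - trapezoid 1) = 0"
    by (simp add: trapezoid_def)
  moreover have "2 * (cos (0 * t) * trapezoid_kernel t - cos (1 * t) * trapezoid_kernel t) =
      t\<^sup>2 * cutoff_kernel t" for t
    by (cases "t = 0") (auto simp: cutoff_kernel_def trapezoid_kernel_def field_simps)
  ultimately show ?thesis by simp
qed

text \<open>Insert the triangle integral for the Fejer factor and exchange the integrals; the
  product of the two cosines splits into the frequencies x + y and x - y, at which the kernel gives
  the trapezoid.\<close>

lemma cutoff_eq:
  "(\<integral>t. cos (x * t) * cutoff_kernel t \<partial>lborel) =
   (\<integral>y. indicator {-1..1} y * (1 - \<bar>y\<bar>) * ((trapezoid (x + y) + trapezoid (x - y)) / 2) \<partial>lborel)"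
proof -
  let ?w = "\<lambda>y::real. indicator {-1..1} y * (1 - \<bar>y\<bar>)"
  let ?g = "\<lambda>t y. cos (x * t) * trapezoid_kernel t * (?w y * cos (t * y))"
  have w: "integrable lborel ?w"
    using has_bochner_integral_triangle_mass by (simp add: has_bochner_integral_iff)
  have w0: "?w y \<ge> 0" for y by (auto simp: indicator_def)
  have int: "integrable (lborel \<Otimes>\<^sub>M lborel) (\<lambda>(t, y). ?g t y)"
  proof (rule lborel_pair.Fubini_integrable)
    have "integrable lborel (\<lambda>t. \<bar>cos (x * t) * trapezoid_kernel t\<bar> * (\<integral>y. ?w y * \<bar>cos (t * y)\<bar> \<partial>lborel))"
    proof (rule Bochner_Integration.integrable_bound[OF integrable_trapezoid_kernel])
      show "AE t in lborel. norm (\<bar>cos (x * t) * trapezoid_kernel t\<bar> *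
          (\<integral>y. ?w y * \<bar>cos (t * y)\<bar> \<partial>lborel)) \<le> norm (trapezoid_kernel t)"
      proof (rule AE_I2)
        fix t :: real
        have "(\<integral>y. ?w y * \<bar>cos (t * y)\<bar> \<partial>lborel) \<le> (\<integral>y. ?w y \<partial>lborel)"
          using w0 by (intro integral_mono_AE' w) (auto intro!: mult_left_le)
        then have "(\<integral>y. ?w y * \<bar>cos (t * y)\<bar> \<partial>lborel) \<le> 1"
          using has_bochner_integral_triangle_mass by (simp add: has_bochner_integral_iff)
        moreover have "(\<integral>y. ?w y * \<bar>cos (t * y)\<bar> \<partial>lborel) \<ge> 0"
          using w0 by (intro integral_nonneg_AE) auto
        moreover have "\<bar>cos (x * t)\<bar> * \<bar>trapezoid_kernel t\<bar> \<le> 1 * \<bar>trapezoid_kernel t\<bar>"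
          by (intro mult_right_mono) auto
        ultimately show "norm (\<bar>cos (x * t) * trapezoid_kernel t\<bar> *
            (\<integral>y. ?w y * \<bar>cos (t * y)\<bar> \<partial>lborel)) \<le> norm (trapezoid_kernel t)"
          using mult_mono[of "\<bar>cos (x * t)\<bar> * \<bar>trapezoid_kernel t\<bar>" "\<bar>trapezoid_kernel t\<bar>"
              "\<integral>y. ?w y * \<bar>cos (t * y)\<bar> \<partial>lborel" 1]
          by (simp add: abs_mult)
      qed
    qed measurable
    then show "integrable lborel (\<lambda>t. \<integral>y. norm (case (t, y) of (t, y) \<Rightarrow> ?g t y) \<partial>lborel)"
      using w0 by (simp only: prod.case real_norm_def abs_mult[of _ "_ * cos _"] abs_mult[of "_ * _" "cos _"] abs_of_nonneg) simp
    show "AE t in lborel. integrable lborel (\<lambda>y. case (t, y) of (t, y) \<Rightarrow> ?g t y)"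
    proof (rule AE_I2)
      fix t :: real
      have "integrable lborel (\<lambda>y. ?w y * cos (t * y))"
        by (rule Bochner_Integration.integrable_bound[OF w]) (auto simp: abs_mult intro!: mult_left_le)
      then show "integrable lborel (\<lambda>y. case (t, y) of (t, y) \<Rightarrow> ?g t y)" by simp
    qed
  qed measurable
  have "(\<integral>t. cos (x * t) * cutoff_kernel t \<partial>lborel) = (\<integral>t. (\<integral>y. ?g t y \<partial>lborel) \<partial>lborel)"
  proof (rule integral_cong_AE)
    have "AE t in lborel. t \<noteq> (0::real)" by (rule AE_lborel_singleton)
    then show "AE t in lborel. cos (x * t) * cutoff_kernel t = (\<integral>y. ?g t y \<partial>lborel)"
    proof eventually_elim
      case (elim t)
      from has_bochner_integral_integral_eq[OF has_bochner_integral_triangle[OF this]]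
      show ?case by (simp add: cutoff_kernel_def)
    qed
  qed measurable
  also have "\<dots> = (\<integral>y. (\<integral>t. ?g t y \<partial>lborel) \<partial>lborel)"
    by (rule lborel_pair.Fubini_integral[symmetric]) (use int in simp)
  also have "\<dots> = (\<integral>y. ?w y * ((trapezoid (x + y) + trapezoid (x - y)) / 2) \<partial>lborel)"
  proof (rule Bochner_Integration.integral_cong)
    fix y :: real
    have "has_bochner_integral lborel (\<lambda>t. ?w y * ((cos ((x + y) * t) * trapezoid_kernel t +
        cos ((x - y) * t) * trapezoid_kernel t) / 2)) (?w y * ((trapezoid (x + y) + trapezoid (x - y)) / 2))"
      by (intro has_bochner_integral_mult_right has_bochner_integral_divide_zero
          has_bochner_integral_add has_bochner_integral_trapezoid)
    moreover have "?w y * ((cos ((x + y) * t) * trapezoid_kernel t +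
        cos ((x - y) * t) * trapezoid_kernel t) / 2) = ?g t y" for t
    proof -
      have "cos ((x + y) * t) + cos ((x - y) * t) = 2 * cos (x * t) * cos (t * y)"
        by (simp add: ring_distribs cos_add cos_diff mult.commute)
      then have "cos ((x + y) * t) * trapezoid_kernel t + cos ((x - y) * t) * trapezoid_kernel t =
          2 * cos (x * t) * cos (t * y) * trapezoid_kernel t"
        by (metis ring_distribs(2))
      then show ?thesis by simp
    qed
    ultimately have "has_bochner_integral lborel (\<lambda>t. ?g t y) (?w y * ((trapezoid (x + y) + trapezoid (x - y)) / 2))"
      by (simp only:)
    then show "(\<integral>t. ?g t y \<partial>lborel) = ?w y * ((trapezoid (x + y) + trapezoid (x - y)) / 2)"
      by (rule has_bochner_integral_integral_eq)
  qed simp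
  finally show ?thesis .
qed

lemma integrable_cos_cutoff_kernel: "integrable lborel (\<lambda>t. cos (x * t) * cutoff_kernel t)"
  by (rule Bochner_Integration.integrable_bound[OF integrable_cutoff_kernel])
    (auto simp: abs_mult intro!: mult_left_le_one_le)

lemma cutoff_eq':
  "cutoff x = 1 - (\<integral>y. indicator {-1..1} y * (1 - \<bar>y\<bar>) * ((trapezoid (x + y) + trapezoid (x - y)) / 2) \<partial>lborel)"
proof -
  have "(\<integral>t. cutoff_kernel t \<partial>lborel) = (\<integral>t. cos (0 * t) * cutoff_kernel t \<partial>lborel)" by simp
  also have "\<dots> = (\<integral>y. indicator {-1..1::real} y * (1 - \<bar>y\<bar>) \<partial>lborel)"
    unfolding cutoff_eq
    by (intro Bochner_Integration.integral_cong) (auto simp: indicator_def trapezoid_bounds)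
  also have "\<dots> = 1"
    using has_bochner_integral_triangle_mass by (simp add: has_bochner_integral_iff)
  finally have "(\<integral>t. cutoff_kernel t \<partial>lborel) = 1" .
  moreover have "cutoff x = (\<integral>t. cutoff_kernel t \<partial>lborel) - (\<integral>t. cos (x * t) * cutoff_kernel t \<partial>lborel)"
    unfolding cutoff_def using integrable_cutoff_kernel integrable_cos_cutoff_kernel
    by (simp add: left_diff_distrib)
  ultimately show ?thesis by (simp add: cutoff_eq)
qed

text \<open>For |y| \<le> 1 the points x + y and x - y stay in [-2, 2] if |x| \<le> 1, and outside
  (-4, 4) if |x| \<ge> 5, so the averaged trapezoid is 1 or 0 there.\<close>

lemma cutoff_bounds:
  shows cutoff_nonneg: "0 \<le> cutoff x" and cutoff_le_1: "cutoff x \<le> 1"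
    and cutoff_eq_0: "\<bar>x\<bar> \<le> 1 \<Longrightarrow> cutoff x = 0" and cutoff_eq_1: "\<bar>x\<bar> \<ge> 5 \<Longrightarrow> cutoff x = 1"
proof -
  let ?w = "\<lambda>y::real. indicator {-1..1} y * (1 - \<bar>y\<bar>)"
  let ?I = "(\<integral>y. ?w y * ((trapezoid (x + y) + trapezoid (x - y)) / 2) \<partial>lborel)"
  have w: "integrable lborel ?w" "integral\<^sup>L lborel ?w = 1"
    using has_bochner_integral_triangle_mass by (simp_all add: has_bochner_integral_iff)
  have w0: "?w y \<ge> 0" for y by (auto simp: indicator_def)
  have b: "0 \<le> (trapezoid (x + y) + trapezoid (x - y)) / 2" "(trapezoid (x + y) + trapezoid (x - y)) / 2 \<le> 1" for y
    using trapezoid_bounds[of "x + y"] trapezoid_bounds[of "x - y"] by auto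
  have "?I \<le> integral\<^sup>L lborel ?w"
    using w0 mult_left_le[OF b(2) w0] by (intro integral_mono_AE' w) auto
  then show "0 \<le> cutoff x" by (simp add: cutoff_eq' w)
  have "?I \<ge> 0"
    using w0 b by (intro integral_nonneg_AE) (auto intro!: AE_I2 mult_nonneg_nonneg)
  then show "cutoff x \<le> 1" by (simp add: cutoff_eq')
  show "cutoff x = 0" if "\<bar>x\<bar> \<le> 1"
  proof -
    have "?I = integral\<^sup>L lborel ?w"
      using that by (intro Bochner_Integration.integral_cong) (auto simp: indicator_def trapezoid_bounds)
    then show ?thesis by (simp add: cutoff_eq' w)
  qed
  show "cutoff x = 1" if "\<bar>x\<bar> \<ge> 5"
  proof -
    have "?I = integral\<^sup>L lborel (\<lambda>_::real. 0)"
      using that by (intro Bochner_Integration.integral_cong) (auto simp: indicator_def trapezoid_bounds)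
    then show ?thesis by (simp add: cutoff_eq')
  qed
qed

lemma cutoff_measurable [measurable]: "cutoff \<in> borel_measurable borel"
  unfolding cutoff_def by measurable

section \<open>Maximal inequalities\<close>

context prob_space
begin

lemma prob_past_future:
  fixes k n :: nat
  assumes ind: "indep_vars (\<lambda>_. borel) V {..<n}" and "k \<le> n"
    and [measurable]: "Measurable.pred (PiM {..<k} (\<lambda>_. borel)) P"
      "Measurable.pred (PiM {k..<n} (\<lambda>_. borel)) Q"
  shows "\<P>(\<omega> in M. P (\<lambda>i\<in>{..<k}. V i \<omega>) \<and> Q (\<lambda>i\<in>{k..<n}. V i \<omega>)) =
    \<P>(\<omega> in M. P (\<lambda>i\<in>{..<k}. V i \<omega>)) * \<P>(\<omega> in M. Q (\<lambda>i\<in>{k..<n}. V i \<omega>))"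
proof -
  let ?A = "PiM {..<k} (\<lambda>_. borel)" and ?B = "PiM {k..<n} (\<lambda>_. borel)"
  have "indep_var ?A (\<lambda>\<omega>. \<lambda>i\<in>{..<k}. V i \<omega>) ?B (\<lambda>\<omega>. \<lambda>i\<in>{k..<n}. V i \<omega>)"
    using ind \<open>k \<le> n\<close> by (intro indep_var_restrict) auto
  from indep_varD[OF this, of "{x \<in> space ?A. P x}" "{x \<in> space ?B. Q x}"]
  have "prob ((\<lambda>\<omega>. (\<lambda>i\<in>{..<k}. V i \<omega>, \<lambda>i\<in>{k..<n}. V i \<omega>)) -`
      ({x \<in> space ?A. P x} \<times> {x \<in> space ?B. Q x}) \<inter> space M) =
    prob ((\<lambda>\<omega>. \<lambda>i\<in>{..<k}. V i \<omega>) -` {x \<in> space ?A. P x} \<inter> space M) *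
    prob ((\<lambda>\<omega>. \<lambda>i\<in>{k..<n}. V i \<omega>) -` {x \<in> space ?B. Q x} \<inter> space M)"
    by measurable
  moreover have "(\<lambda>\<omega>. (\<lambda>i\<in>{..<k}. V i \<omega>, \<lambda>i\<in>{k..<n}. V i \<omega>)) -`
      ({x \<in> space ?A. P x} \<times> {x \<in> space ?B. Q x}) \<inter> space M =
      {\<omega> \<in> space M. P (\<lambda>i\<in>{..<k}. V i \<omega>) \<and> Q (\<lambda>i\<in>{k..<n}. V i \<omega>)}"
    by (auto simp: space_PiM)
  moreover have "(\<lambda>\<omega>. \<lambda>i\<in>{..<k}. V i \<omega>) -` {x \<in> space ?A. P x} \<inter> space M =
      {\<omega> \<in> space M. P (\<lambda>i\<in>{..<k}. V i \<omega>)}"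
    "(\<lambda>\<omega>. \<lambda>i\<in>{k..<n}. V i \<omega>) -` {x \<in> space ?B. Q x} \<inter> space M =
      {\<omega> \<in> space M. Q (\<lambda>i\<in>{k..<n}. V i \<omega>)}"
    by (auto simp: space_PiM)
  ultimately show ?thesis by simp
qed

text \<open>The common core of the two maximal inequalities below. \<open>A\<close> is split by the
  first index k at which a partial sum exceeds l; that event depends on the past of k, so it is
  independent of the remaining sum, which is large with probability at most q. The first-passage
  events are disjoint and their probabilities add up to that of the passage.\<close>

lemma first_passage_bound:
  fixes V :: "nat \<Rightarrow> 'a \<Rightarrow> 'b::euclidean_space"
  assumes ind: "indep_vars (\<lambda>_. borel) V {..<n}"
    and q: "\<And>k. k \<le> n \<Longrightarrow> \<P>(\<omega> in M. norm (\<Sum>j\<in>{k..<n}. V j \<omega>) > s) \<le> q"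
    and C: "C \<in> events"
    and A: "\<And>\<omega>. \<omega> \<in> A \<Longrightarrow> \<omega> \<in> space M \<and> (\<exists>k\<le>n. norm (\<Sum>j<k. V j \<omega>) > l)"
    and split: "\<And>\<omega> k. \<omega> \<in> A \<Longrightarrow> k \<le> n \<Longrightarrow> norm (\<Sum>j<k. V j \<omega>) > l \<Longrightarrow>
      (\<And>i. i < k \<Longrightarrow> norm (\<Sum>j<i. V j \<omega>) \<le> l) \<Longrightarrow> \<omega> \<in> C \<or> norm (\<Sum>j\<in>{k..<n}. V j \<omega>) > s"
  shows "prob A \<le> prob C + q * \<P>(\<omega> in M. \<exists>k\<le>n. norm (\<Sum>j<k. V j \<omega>) > l)"
proof -
  have [measurable]: "V i \<in> borel_measurable M" if "i < n" for i
    using ind that by (auto simp: indep_vars_def)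
  have [measurable]: "(\<lambda>\<omega>. \<Sum>j<k. V j \<omega>) \<in> borel_measurable M" if "k \<le> n" for k
    using that by (intro borel_measurable_sum) auto
  have [measurable]: "(\<lambda>\<omega>. \<Sum>j\<in>{k..<n}. V j \<omega>) \<in> borel_measurable M" for k
    by (intro borel_measurable_sum) auto
  define E where "E k = {\<omega> \<in> space M. norm (\<Sum>j<k. V j \<omega>) > l \<and> (\<forall>i\<in>{..<k}. norm (\<Sum>j<i. V j \<omega>) \<le> l)}" for k
  define B where "B k = {\<omega> \<in> space M. norm (\<Sum>j\<in>{k..<n}. V j \<omega>) > s}" for k
  have [measurable]: "E k \<in> events" if "k \<le> n" for k
  proof -
    have "{\<omega> \<in> space M. norm (\<Sum>j<i. V j \<omega>) \<le> l} \<in> events" if "i < k" for i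
    proof -
      have [measurable]: "(\<lambda>\<omega>. \<Sum>j<i. V j \<omega>) \<in> borel_measurable M"
        using that \<open>k \<le> n\<close> by (intro borel_measurable_sum) auto
      show ?thesis by measurable
    qed
    then have "{\<omega> \<in> space M. \<forall>i\<in>{..<k}. norm (\<Sum>j<i. V j \<omega>) \<le> l} \<in> events"
      by (intro sets.sets_Collect_finite_All) auto
    moreover have "{\<omega> \<in> space M. norm (\<Sum>j<k. V j \<omega>) > l} \<in> events"
      using that by measurable
    ultimately have "{\<omega> \<in> space M. norm (\<Sum>j<k. V j \<omega>) > l} \<inter>
        {\<omega> \<in> space M. \<forall>i\<in>{..<k}. norm (\<Sum>j<i. V j \<omega>) \<le> l} \<in> events" by auto
    then show ?thesis unfolding E_def by (rule back_subst[where P="\<lambda>A. A \<in> events"]) auto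
  qed
  have [measurable]: "B k \<in> events" for k unfolding B_def by measurable
  have EB: "prob (E k \<inter> B k) = prob (E k) * prob (B k)" if "k \<le> n" for k
  proof -
    let ?P = "\<lambda>x :: nat \<Rightarrow> 'b. norm (\<Sum>j<k. x j) > l \<and> (\<forall>i\<in>{..<k}. norm (\<Sum>j<i. x j) \<le> l)"
    let ?Q = "\<lambda>x :: nat \<Rightarrow> 'b. norm (\<Sum>j\<in>{k..<n}. x j) > s"
    have s: "(\<lambda>x. \<Sum>j<i. x j) \<in> borel_measurable (PiM {..<k} (\<lambda>_. borel :: 'b measure))" if "i \<le> k" for i
      using that by (intro borel_measurable_sum measurable_component_singleton) auto
    have "Measurable.pred (PiM {..<k} (\<lambda>_. borel :: 'b measure)) (\<lambda>x. norm (\<Sum>j<i. x j) \<le> l)"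
      "Measurable.pred (PiM {..<k} (\<lambda>_. borel :: 'b measure)) (\<lambda>x. norm (\<Sum>j<i. x j) > l)" if "i \<le> k" for i
      using measurable_compose[OF s[OF that] borel_measurable_norm] by simp_all
    then have "Measurable.pred (PiM {..<k} (\<lambda>_. borel)) ?P"
      by (intro pred_intros_logic pred_intros_finite) auto
    moreover have "Measurable.pred (PiM {k..<n} (\<lambda>_. borel)) ?Q"
    proof -
      have "(\<lambda>x. \<Sum>j\<in>{k..<n}. x j) \<in> borel_measurable (PiM {k..<n} (\<lambda>_. borel :: 'b measure))"
        by (intro borel_measurable_sum measurable_component_singleton)
      from measurable_compose[OF this borel_measurable_norm] show ?thesis by simp
    qed
    moreover have "E k = {\<omega> \<in> space M. ?P (\<lambda>i\<in>{..<k}. V i \<omega>)}"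
      unfolding E_def by (intro Collect_cong conj_cong refl ball_cong) (auto intro!: arg_cong[where f=norm] sum.cong)
    moreover have "B k = {\<omega> \<in> space M. ?Q (\<lambda>i\<in>{k..<n}. V i \<omega>)}"
      unfolding B_def by (auto intro!: arg_cong[where f=norm] sum.cong)
    moreover have "E k \<inter> B k = {\<omega> \<in> space M. ?P (\<lambda>i\<in>{..<k}. V i \<omega>) \<and> ?Q (\<lambda>i\<in>{k..<n}. V i \<omega>)}"
      using calculation(3,4) by auto
    ultimately show ?thesis using prob_past_future[OF ind that, of ?P ?Q] by simp
  qed
  have disj: "disjoint_family_on E {..n}"
    unfolding disjoint_family_on_def E_def by (auto simp: not_less[symmetric]) (metis leD lessThan_iff nat_neq_iff)
  have first: "\<exists>k\<le>n. \<omega> \<in> E k" if w: "\<omega> \<in> space M" "\<exists>k\<le>n. norm (\<Sum>j<k. V j \<omega>) > l" for \<omega>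
  proof -
    obtain k where k: "k \<le> n" "norm (\<Sum>j<k. V j \<omega>) > l" using w(2) by blast
    define m where "m = (LEAST k. norm (\<Sum>j<k. V j \<omega>) > l)"
    have "norm (\<Sum>j<m. V j \<omega>) > l" unfolding m_def using k(2) by (rule LeastI)
    moreover have "m \<le> k" unfolding m_def using k(2) by (rule Least_le)
    moreover have "norm (\<Sum>j<i. V j \<omega>) \<le> l" if "i < m" for i
      using not_less_Least[OF that[unfolded m_def]] by simp
    ultimately show ?thesis using k w(1) by (auto simp: E_def intro!: exI[of _ m])
  qed
  have "A \<subseteq> C \<union> (\<Union>k\<le>n. E k \<inter> B k)"
  proof
    fix \<omega> assume w: "\<omega> \<in> A"
    then obtain k where k: "k \<le> n" "\<omega> \<in> E k" using first A by blast
    then have "\<omega> \<in> C \<or> norm (\<Sum>j\<in>{k..<n}. V j \<omega>) > s" by (intro split[OF w]) (auto simp: E_def)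
    then show "\<omega> \<in> C \<union> (\<Union>k\<le>n. E k \<inter> B k)" using k A[OF w] by (auto simp: B_def)
  qed
  then have "prob A \<le> prob (C \<union> (\<Union>k\<le>n. E k \<inter> B k))" using C by (intro finite_measure_mono) auto
  also have "\<dots> \<le> prob C + prob (\<Union>k\<le>n. E k \<inter> B k)" using C by (intro measure_Un_le) auto
  also have "prob (\<Union>k\<le>n. E k \<inter> B k) \<le> (\<Sum>k\<le>n. prob (E k \<inter> B k))"
    by (intro finite_measure_subadditive_finite) auto
  also have "\<dots> = (\<Sum>k\<le>n. prob (E k) * prob (B k))"
    using EB by auto
  also have "\<dots> \<le> (\<Sum>k\<le>n. prob (E k) * q)"
    using q by (intro sum_mono mult_left_mono) (auto simp: B_def)
  also have "\<dots> = q * prob (\<Union>k\<le>n. E k)"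
    using disj by (subst finite_measure_finite_Union) (auto simp: sum_distrib_left mult.commute)
  also have "(\<Union>k\<le>n. E k) = {\<omega> \<in> space M. \<exists>k\<le>n. norm (\<Sum>j<k. V j \<omega>) > l}"
    using first by (auto simp: E_def)
  finally show ?thesis by simp
qed

lemma sum_split_at: "k \<le> n \<Longrightarrow> (\<Sum>j<n. f j) = (\<Sum>j<k. f j) + (\<Sum>j\<in>{k..<n}. f j)"
  for f :: "nat \<Rightarrow> 'b::comm_monoid_add"
  using sum.atLeastLessThan_concat[of 0 k n f] by (simp add: atLeast0LessThan)

text \<open>If a partial sum exceeds 2 * r and the remaining sum does not exceed r, then the full
  sum exceeds r. The first-passage bound with q = 1 / 2 lets half of the left-hand side be
  absorbed.\<close>

lemma ottaviani:
  fixes V :: "nat \<Rightarrow> 'a \<Rightarrow> 'b::euclidean_space"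
  assumes ind: "indep_vars (\<lambda>_. borel) V {..<n}"
    and half: "\<And>k. k \<le> n \<Longrightarrow> \<P>(\<omega> in M. norm (\<Sum>j\<in>{k..<n}. V j \<omega>) > r) \<le> 1 / 2"
  shows "\<P>(\<omega> in M. \<exists>k\<le>n. norm (\<Sum>j<k. V j \<omega>) > 2 * r) \<le>
    2 * \<P>(\<omega> in M. norm (\<Sum>j<n. V j \<omega>) > r)"
proof -
  have [measurable]: "(\<lambda>\<omega>. \<Sum>j<n. V j \<omega>) \<in> borel_measurable M"
    using ind by (intro borel_measurable_sum) (auto simp: indep_vars_def)
  let ?A = "{\<omega> \<in> space M. \<exists>k\<le>n. norm (\<Sum>j<k. V j \<omega>) > 2 * r}"
  let ?C = "{\<omega> \<in> space M. norm (\<Sum>j<n. V j \<omega>) > r}"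
  have "prob ?A \<le> prob ?C + 1 / 2 * prob ?A"
  proof (rule first_passage_bound[OF ind half])
    fix \<omega> k assume w: "\<omega> \<in> ?A" and k: "k \<le> n" "norm (\<Sum>j<k. V j \<omega>) > 2 * r"
    have "norm (\<Sum>j<k. V j \<omega>) \<le> norm (\<Sum>j<n. V j \<omega>) + norm (\<Sum>j\<in>{k..<n}. V j \<omega>)"
      unfolding sum_split_at[OF k(1)] by (metis add_diff_cancel_right' norm_triangle_ineq4)
    then have "norm (\<Sum>j<n. V j \<omega>) > r \<or> norm (\<Sum>j\<in>{k..<n}. V j \<omega>) > r" using k(2) by linarith
    with w show "\<omega> \<in> ?C \<or> norm (\<Sum>j\<in>{k..<n}. V j \<omega>) > r" by blast
  qed auto
  then show ?thesis by simp
qed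

text \<open>At the first passage above t the previous partial sum is at most t. If the passing
  summand is at most t as well, a total above 3 * t leaves more than t for the remaining
  sum.\<close>

lemma hoffmann_jorgensen:
  fixes V :: "nat \<Rightarrow> 'a \<Rightarrow> 'b::euclidean_space"
  assumes ind: "indep_vars (\<lambda>_. borel) V {..<n}"
    and q: "\<And>k. k \<le> n \<Longrightarrow> \<P>(\<omega> in M. norm (\<Sum>j\<in>{k..<n}. V j \<omega>) > t) \<le> q"
    and "t \<ge> 0"
  shows "\<P>(\<omega> in M. norm (\<Sum>j<n. V j \<omega>) > 3 * t) \<le>
    (\<Sum>k<n. \<P>(\<omega> in M. norm (V k \<omega>) > t)) +
    q * \<P>(\<omega> in M. \<exists>k\<le>n. norm (\<Sum>j<k. V j \<omega>) > t)"
proof -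
  have V [measurable]: "V i \<in> borel_measurable M" if "i < n" for i
    using ind that by (auto simp: indep_vars_def)
  let ?A = "{\<omega> \<in> space M. norm (\<Sum>j<n. V j \<omega>) > 3 * t}"
  let ?C = "\<Union>k<n. {\<omega> \<in> space M. norm (V k \<omega>) > t}"
  have "prob ?A \<le> prob ?C + q * \<P>(\<omega> in M. \<exists>k\<le>n. norm (\<Sum>j<k. V j \<omega>) > t)"
  proof (rule first_passage_bound[OF ind q])
    show "?C \<in> events" by (intro sets.finite_UN) auto
    show "\<omega> \<in> space M \<and> (\<exists>k\<le>n. norm (\<Sum>j<k. V j \<omega>) > t)" if "\<omega> \<in> ?A" for \<omega>
      using that \<open>t \<ge> 0\<close> by (auto intro!: exI[of _ n])
    fix \<omega> k assume w: "\<omega> \<in> ?A" and k: "k \<le> n" "norm (\<Sum>j<k. V j \<omega>) > t"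
      and before: "\<And>i. i < k \<Longrightarrow> norm (\<Sum>j<i. V j \<omega>) \<le> t"
    have "k \<noteq> 0" using k(2) \<open>t \<ge> 0\<close> by (cases k) auto
    then obtain m where m: "k = Suc m" by (cases k) auto
    show "\<omega> \<in> ?C \<or> norm (\<Sum>j\<in>{k..<n}. V j \<omega>) > t"
    proof (cases "norm (V m \<omega>) > t")
      case True
      then show ?thesis using m k(1) w by auto
    next
      case False
      have "norm (\<Sum>j<k. V j \<omega>) \<le> norm (\<Sum>j<m. V j \<omega>) + norm (V m \<omega>)"
        unfolding m by (simp add: norm_triangle_ineq)
      moreover have "norm (\<Sum>j<n. V j \<omega>) \<le> norm (\<Sum>j<k. V j \<omega>) + norm (\<Sum>j\<in>{k..<n}. V j \<omega>)"
        unfolding sum_split_at[OF k(1)] by (rule norm_triangle_ineq)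
      moreover have "norm (\<Sum>j<n. V j \<omega>) > 3 * t" using w by simp
      ultimately show ?thesis using False before[of m] m by linarith
    qed
  qed
  also have "prob ?C \<le> (\<Sum>k<n. \<P>(\<omega> in M. norm (V k \<omega>) > t))"
    by (intro finite_measure_subadditive_finite) auto
  finally show ?thesis by simp
qed

text \<open>From 1 - p \<le> exp (- p) and independence. It serves as a quantitative second
  Borel--Cantelli lemma, for the blocks and again for the partitions.\<close>

lemma prob_none_exceeds:
  fixes V :: "nat \<Rightarrow> 'a \<Rightarrow> 'b::euclidean_space"
  assumes ind: "indep_vars (\<lambda>_. borel) V I" and I: "finite I"
  shows "\<P>(\<omega> in M. \<forall>k\<in>I. norm (V k \<omega>) \<le> s k) \<le>
    exp (- (\<Sum>k\<in>I. \<P>(\<omega> in M. norm (V k \<omega>) > s k)))"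
proof (cases "I = {}")
  case False
  have [measurable]: "V i \<in> borel_measurable M" if "i \<in> I" for i
    using ind that by (auto simp: indep_vars_def)
  have "{\<omega> \<in> space M. \<forall>k\<in>I. norm (V k \<omega>) \<le> s k} =
      (\<Inter>k\<in>I. V k -` {x. norm x \<le> s k} \<inter> space M)"
    using False by auto
  then have "\<P>(\<omega> in M. \<forall>k\<in>I. norm (V k \<omega>) \<le> s k) =
      prob (\<Inter>k\<in>I. V k -` {x. norm x \<le> s k} \<inter> space M)" by (simp only:)
  also have "\<dots> = (\<Prod>k\<in>I. prob (V k -` {x. norm x \<le> s k} \<inter> space M))"
    using False I by (intro indep_varsD_finite[OF ind]) auto
  also have "\<dots> \<le> (\<Prod>k\<in>I. exp (- \<P>(\<omega> in M. norm (V k \<omega>) > s k)))"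
  proof (intro prod_mono conjI measure_nonneg)
    fix k assume k: "k \<in> I"
    have "V k -` {x. norm x \<le> s k} \<inter> space M = space M - {\<omega> \<in> space M. norm (V k \<omega>) > s k}" by auto
    moreover have "{\<omega> \<in> space M. norm (V k \<omega>) > s k} \<in> events" using k by measurable
    ultimately have "prob (V k -` {x. norm x \<le> s k} \<inter> space M) = 1 - \<P>(\<omega> in M. norm (V k \<omega>) > s k)"
      using prob_compl by simp
    then show "prob (V k -` {x. norm x \<le> s k} \<inter> space M) \<le> exp (- \<P>(\<omega> in M. norm (V k \<omega>) > s k))"
      using exp_ge_add_one_self[of "- \<P>(\<omega> in M. norm (V k \<omega>) > s k)"] by simp
  qed
  also have "\<dots> = exp (- (\<Sum>k\<in>I. \<P>(\<omega> in M. norm (V k \<omega>) > s k)))"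
    using I by (simp add: exp_sum sum_negf[symmetric])
  finally show ?thesis .
qed simp

end

section \<open>Scaling of the increments\<close>

context selfsimilar_additive_process
begin

definition tail :: "real \<Rightarrow> real" where
  "tail r = \<P>(\<omega> in M. norm (X 1 \<omega>) > r)"

definition incr_tail :: "real \<Rightarrow> real \<Rightarrow> real" where
  "incr_tail b r = \<P>(\<omega> in M. norm (X 1 \<omega> - X (1 / b) \<omega>) > r)"

declare random_variable [measurable (raw)]

lemma distr_scale:
  assumes "c > 0" "finite I" "I \<subseteq> {0..}" and f: "f \<in> measurable (PiM I (\<lambda>_. borel)) N"
  shows "distr M N (\<lambda>\<omega>. f (\<lambda>t\<in>I. X (c * t) \<omega>)) = distr M N (\<lambda>\<omega>. f (\<lambda>t\<in>I. (c powr H) *\<^sub>R X t \<omega>))"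
proof -
  have t: "t \<ge> 0" if "t \<in> I" for t using that assms(3) by auto
  have 1: "(\<lambda>\<omega>. \<lambda>t\<in>I. X (c * t) \<omega>) \<in> measurable M (PiM I (\<lambda>_. borel))"
    using t \<open>c > 0\<close> by (intro measurable_restrict random_variable) simp
  have 2: "(\<lambda>\<omega>. \<lambda>t\<in>I. (c powr H) *\<^sub>R X t \<omega>) \<in> measurable M (PiM I (\<lambda>_. borel))"
    using t by (intro measurable_restrict borel_measurable_scaleR random_variable borel_measurable_const) simp
  have "distr M N (\<lambda>\<omega>. f (\<lambda>t\<in>I. X (c * t) \<omega>)) =
      distr (distr M (PiM I (\<lambda>_. borel)) (\<lambda>\<omega>. \<lambda>t\<in>I. X (c * t) \<omega>)) N f"
    by (subst distr_distr[OF f 1]) (simp only: comp_def)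
  also have "\<dots> = distr (distr M (PiM I (\<lambda>_. borel)) (\<lambda>\<omega>. \<lambda>t\<in>I. (c powr H) *\<^sub>R X t \<omega>)) N f"
    by (simp only: selfsimilar[OF assms(1-3)])
  also have "\<dots> = distr M N (\<lambda>\<omega>. f (\<lambda>t\<in>I. (c powr H) *\<^sub>R X t \<omega>))"
    by (subst distr_distr[OF f 2]) (simp only: comp_def)
  finally show ?thesis .
qed

lemma distr_scale_increment:
  assumes "c > 0" "s \<ge> 0" "t \<ge> 0"
  shows "distr M borel (\<lambda>\<omega>. X (c * t) \<omega> - X (c * s) \<omega>) =
    distr M borel (\<lambda>\<omega>. (c powr H) *\<^sub>R (X t \<omega> - X s \<omega>))"
proof -
  have "(\<lambda>x. x t - x s) \<in> measurable (PiM {s, t} (\<lambda>_. borel :: (real ^ 'n) measure)) borel"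
    by (intro borel_measurable_diff measurable_component_singleton) auto
  from distr_scale[OF assms(1) _ _ this] assms show ?thesis
    by (simp add: scaleR_diff_right)
qed

lemma distr_scale_single:
  assumes "c > 0" "t \<ge> 0"
  shows "distr M borel (X (c * t)) = distr M borel (\<lambda>\<omega>. (c powr H) *\<^sub>R X t \<omega>)"
proof -
  have "(\<lambda>x. x t) \<in> measurable (PiM {t} (\<lambda>_. borel :: (real ^ 'n) measure)) borel"
    by (intro measurable_component_singleton) auto
  from distr_scale[OF assms(1) _ _ this] assms show ?thesis by simp
qed

lemma prob_eq_if_distr_eq:
  assumes "distr M borel Y = distr M borel Z" "Y \<in> borel_measurable M" "Z \<in> borel_measurable M"
    and "Measurable.pred borel P"
  shows "\<P>(\<omega> in M. P (Y \<omega>)) = \<P>(\<omega> in M. P (Z \<omega>))"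
proof -
  have P: "{x. P x} \<in> sets borel" using assms(4) by simp
  have "measure (distr M borel Y) {x. P x} = measure (distr M borel Z) {x. P x}" using assms by simp
  with P assms(2,3) show ?thesis
    by (simp add: measure_distr vimage_def Int_def conj_commute)
qed

lemma prob_increment_scale:
  assumes "c > 0" "s \<ge> 0" "t \<ge> 0"
  shows "\<P>(\<omega> in M. norm (X (c * t) \<omega> - X (c * s) \<omega>) > c powr H * r) =
    \<P>(\<omega> in M. norm (X t \<omega> - X s \<omega>) > r)"
proof -
  have "\<P>(\<omega> in M. norm (X (c * t) \<omega> - X (c * s) \<omega>) > c powr H * r) =
     \<P>(\<omega> in M. norm ((c powr H) *\<^sub>R (X t \<omega> - X s \<omega>)) > c powr H * r)"
    using assms by (intro prob_eq_if_distr_eq[OF distr_scale_increment]) auto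
  also have "\<dots> = \<P>(\<omega> in M. norm (X t \<omega> - X s \<omega>) > r)"
    using \<open>c > 0\<close> by simp
  finally show ?thesis .
qed

lemma prob_norm_scale:
  assumes "t > 0"
  shows "\<P>(\<omega> in M. norm (X t \<omega>) > t powr H * r) = tail r"
proof -
  have "\<P>(\<omega> in M. norm (X (t * 1) \<omega>) > t powr H * r) =
     \<P>(\<omega> in M. norm ((t powr H) *\<^sub>R X 1 \<omega>) > t powr H * r)"
    using assms by (intro prob_eq_if_distr_eq[OF distr_scale_single]) auto
  also have "\<dots> = tail r"
    using assms by (simp add: tail_def)
  finally show ?thesis by simp
qed

lemma prob_norm_gt:
  assumes "t > 0"
  shows "\<P>(\<omega> in M. norm (X t \<omega>) > r) = tail (r / t powr H)"
  using prob_norm_scale[OF assms, of "r / t powr H"] assms by simp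

lemma tail_antimono: "r \<le> s \<Longrightarrow> tail s \<le> tail r"
  unfolding tail_def by (intro finite_measure_mono) auto

lemma incr_tail_antimono: "r \<le> s \<Longrightarrow> b > 0 \<Longrightarrow> incr_tail b s \<le> incr_tail b r"
  unfolding incr_tail_def by (intro finite_measure_mono) auto

lemma incr_tail_nonneg: "0 \<le> incr_tail b r" and incr_tail_le_1: "incr_tail b r \<le> 1"
  by (simp_all add: incr_tail_def)

lemma prob_norm_gt_tendsto_0:
  fixes Y :: "'w \<Rightarrow> 'b::euclidean_space"
  assumes [measurable]: "Y \<in> borel_measurable M"
  shows "((\<lambda>r. \<P>(\<omega> in M. norm (Y \<omega>) > r)) \<longlongrightarrow> 0) at_top"
proof (rule order_tendstoI)
  fix e :: real assume "0 < e"
  let ?A = "\<lambda>n::nat. {\<omega> \<in> space M. norm (Y \<omega>) > real n}"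
  have "(\<lambda>n. prob (?A n)) \<longlonglongrightarrow> prob (\<Inter>n. ?A n)"
    by (intro finite_Lim_measure_decseq) (auto simp: decseq_def)
  moreover have "(\<Inter>n. ?A n) = {}"
  proof (intro equals0I)
    fix \<omega> assume "\<omega> \<in> (\<Inter>n. ?A n)"
    then have "norm (Y \<omega>) > real n" for n by auto
    moreover obtain n where "norm (Y \<omega>) < real n" using reals_Archimedean2 by auto
    ultimately show False using less_asym by blast
  qed
  ultimately have "(\<lambda>n. prob (?A n)) \<longlonglongrightarrow> 0" by simp
  with \<open>0 < e\<close> obtain n where n: "prob (?A n) < e"
    by (metis (no_types, lifting) eventually_sequentially order_refl order_tendstoD(2))
  show "\<forall>\<^sub>F r in at_top. \<P>(\<omega> in M. norm (Y \<omega>) > r) < e"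
    using eventually_ge_at_top[of "real n"]
  proof eventually_elim
    case (elim r)
    then have "\<P>(\<omega> in M. norm (Y \<omega>) > r) \<le> prob (?A n)"
      by (intro finite_measure_mono) auto
    with n show ?case by simp
  qed
qed (auto intro!: always_eventually less_le_trans[OF _ measure_nonneg])

lemma tail_tendsto_0: "(tail \<longlongrightarrow> 0) at_top"
  unfolding tail_def[abs_def] using prob_norm_gt_tendsto_0[OF random_variable[of 1]] by simp

lemma tail_eventually_le: "e > 0 \<Longrightarrow> \<exists>r0>0. \<forall>r\<ge>r0. tail r \<le> e"
proof -
  assume "e > 0"
  then obtain r0 where "\<forall>r\<ge>r0. tail r < e"
    using order_tendstoD(2)[OF tail_tendsto_0, of e] by (auto simp: eventually_at_top_linorder)
  then have "\<forall>r\<ge>max r0 1. tail r \<le> e" by (simp add: less_imp_le)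
  then show ?thesis by (meson less_max_iff_disj zero_less_one)
qed

text \<open>X 0 has the law of c powr H times itself for every c > 0, so the probability that its
  norm exceeds a level is constant in the level, and it tends to 0.\<close>

lemma AE_X_0: "AE \<omega> in M. X 0 \<omega> = 0"
proof -
  have "\<P>(\<omega> in M. norm (X 0 \<omega>) > e) = 0" if "e > 0" for e
  proof (rule antisym)
    have eq: "\<P>(\<omega> in M. norm (X 0 \<omega>) > c powr H * e) = \<P>(\<omega> in M. norm (X 0 \<omega>) > e)"
      if "c > 0" for c
    proof -
      have "\<P>(\<omega> in M. norm (X (c * 0) \<omega>) > c powr H * e) =
         \<P>(\<omega> in M. norm ((c powr H) *\<^sub>R X 0 \<omega>) > c powr H * e)"
        using that by (intro prob_eq_if_distr_eq[OF distr_scale_single]) auto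
      with that show ?thesis by simp
    qed
    have "filterlim (\<lambda>c. c powr H * e) at_top at_top"
      using H_pos \<open>e > 0\<close> by real_asymp
    from filterlim_compose[OF prob_norm_gt_tendsto_0[OF random_variable[of 0]] this]
    have "((\<lambda>c. \<P>(\<omega> in M. norm (X 0 \<omega>) > c powr H * e)) \<longlongrightarrow> 0) at_top" by simp
    then have "((\<lambda>c::real. \<P>(\<omega> in M. norm (X 0 \<omega>) > e)) \<longlongrightarrow> 0) at_top"
      by (rule Lim_transform_eventually)
        (use eventually_gt_at_top[of 0] in eventually_elim, simp add: eq)
    then show "\<P>(\<omega> in M. norm (X 0 \<omega>) > e) \<le> 0"
      by (simp add: tendsto_const_iff)
  qed simp
  then have "AE \<omega> in M. \<not> norm (X 0 \<omega>) > e" if "e > 0" for e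
    using that by (subst AE_iff_measurable[OF _ refl]) (auto simp: emeasure_eq_measure)
  then have "AE \<omega> in M. \<forall>n. \<not> norm (X 0 \<omega>) > 1 / real (Suc n)"
    by (subst AE_all_countable) auto
  then show ?thesis
  proof eventually_elim
    case (elim \<omega>)
    show ?case
    proof (rule ccontr)
      assume "X 0 \<omega> \<noteq> 0"
      then have "norm (X 0 \<omega>) > 0" by simp
      then obtain n where "1 / real (Suc n) < norm (X 0 \<omega>)" using nat_approx_posE by blast
      with elim show False by auto
    qed
  qed
qed

text \<open>The bound does not depend on s, so one condition on \<open>tail\<close> provides the
  hypothesis of Ottaviani's inequality for all remaining increments.\<close>

lemma prob_increment_le_tail:
  assumes "0 < s" "s \<le> t" "r \<ge> 0"
  shows "\<P>(\<omega> in M. norm (X t \<omega> - X s \<omega>) > r) \<le> 2 * tail (r / (2 * t powr H))"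
proof -
  have [measurable]: "X s \<in> borel_measurable M" "X t \<in> borel_measurable M" using assms by auto
  have "\<P>(\<omega> in M. norm (X t \<omega> - X s \<omega>) > r) \<le>
      prob ({\<omega> \<in> space M. norm (X t \<omega>) > r / 2} \<union> {\<omega> \<in> space M. norm (X s \<omega>) > r / 2})"
  proof (intro finite_measure_mono subsetI)
    fix \<omega> assume "\<omega> \<in> {\<omega> \<in> space M. norm (X t \<omega> - X s \<omega>) > r}"
    moreover have "norm (X t \<omega> - X s \<omega>) \<le> norm (X t \<omega>) + norm (X s \<omega>)" by (rule norm_triangle_ineq4)
    ultimately show "\<omega> \<in> {\<omega> \<in> space M. norm (X t \<omega>) > r / 2} \<union> {\<omega> \<in> space M. norm (X s \<omega>) > r / 2}"
      by auto
  qed measurable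
  also have "\<dots> \<le> \<P>(\<omega> in M. norm (X t \<omega>) > r / 2) + \<P>(\<omega> in M. norm (X s \<omega>) > r / 2)"
    by (intro measure_Un_le) auto
  also have "\<dots> = tail (r / 2 / t powr H) + tail (r / 2 / s powr H)"
    using prob_norm_gt[of t "r / 2"] prob_norm_gt[of s "r / 2"] assms by simp
  also have "tail (r / 2 / s powr H) \<le> tail (r / 2 / t powr H)"
    using assms H_pos by (intro tail_antimono divide_left_mono powr_mono2) auto
  finally show ?thesis by simp
qed

section \<open>Maximal inequality for the paths over an interval\<close>

lemma ottaviani_process:
  fixes t :: "nat \<Rightarrow> real"
  assumes "0 \<le> t 0" "strict_mono_on {..n} t"
    and "\<And>k. k \<le> n \<Longrightarrow> \<P>(\<omega> in M. norm (X (t n) \<omega> - X (t k) \<omega>) > r) \<le> 1 / 2"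
  shows "\<P>(\<omega> in M. \<exists>k\<le>n. norm (X (t k) \<omega> - X (t 0) \<omega>) > 2 * r) \<le>
    2 * \<P>(\<omega> in M. norm (X (t n) \<omega> - X (t 0) \<omega>) > r)"
proof -
  let ?V = "\<lambda>j \<omega>. X (t (Suc j)) \<omega> - X (t j) \<omega>"
  have sum: "(\<Sum>j<k. ?V j \<omega>) = X (t k) \<omega> - X (t 0) \<omega>" for k \<omega>
    by (rule sum_lessThan_telescope[of "\<lambda>j. X (t j) \<omega>"])
  have sum': "(\<Sum>j\<in>{k..<n}. ?V j \<omega>) = X (t n) \<omega> - X (t k) \<omega>" if "k \<le> n" for k \<omega>
    by (rule sum_Suc_diff'[OF that, of "\<lambda>j. X (t j) \<omega>"])
  have "\<P>(\<omega> in M. \<exists>k\<le>n. norm (\<Sum>j<k. ?V j \<omega>) > 2 * r) \<le>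
      2 * \<P>(\<omega> in M. norm (\<Sum>j<n. ?V j \<omega>) > r)"
  proof (rule ottaviani[where V = ?V, OF independent_increments[of t n, OF assms(1,2)]])
    fix k assume "k \<le> n"
    from assms(3)[OF this] show "\<P>(\<omega> in M. norm (\<Sum>j\<in>{k..<n}. ?V j \<omega>) > r) \<le> 1 / 2"
      by (simp only: sum'[OF \<open>k \<le> n\<close>])
  qed
  then show ?thesis by (simp only: sum)
qed

text \<open>The maximal inequality is first proved on dyadic grids; right-continuity turns it into a
  statement about the whole interval.\<close>

definition grid_exceeds :: "real \<Rightarrow> real \<Rightarrow> real \<Rightarrow> 'w set" where
  "grid_exceeds u v r = (\<Union>m. {\<omega> \<in> space M. \<exists>k\<le>(2::nat) ^ m.
      norm (X (u + (v - u) * (real k / 2 ^ m)) \<omega> - X u \<omega>) > 2 * r})"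

lemma grid_level_measurable:
  assumes "0 \<le> u" "u < v"
  shows "{\<omega> \<in> space M. \<exists>k\<le>(2::nat) ^ m. norm (X (u + (v - u) * (real k / 2 ^ m)) \<omega> - X u \<omega>) > 2 * r} \<in> events"
proof -
  have "{\<omega> \<in> space M. norm (X (u + (v - u) * (real k / 2 ^ m)) \<omega> - X u \<omega>) > 2 * r} \<in> events" for k
  proof -
    have [measurable]: "X (u + (v - u) * (real k / 2 ^ m)) \<in> borel_measurable M" "X u \<in> borel_measurable M"
      using assms by (intro random_variable; simp)+
    show ?thesis by measurable
  qed
  then have "{\<omega> \<in> space M. \<exists>k\<in>{..2 ^ m}. norm (X (u + (v - u) * (real k / 2 ^ m)) \<omega> - X u \<omega>) > 2 * r} \<in> events"
    by (intro sets.sets_Collect_finite_Ex) auto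
  then show ?thesis by (simp only: Bex_def atMost_iff)
qed

lemma grid_exceeds_measurable [measurable]:
  "0 \<le> u \<Longrightarrow> u < v \<Longrightarrow> grid_exceeds u v r \<in> events"
  unfolding grid_exceeds_def using grid_level_measurable by (intro sets.countable_UN) auto

text \<open>The 1 / 4 becomes the 1 / 2 of Ottaviani's inequality through
  \<open>prob_increment_le_tail\<close>. The bound is the same on every dyadic level, and the events
  increase with the level because the grids refine each other.\<close>

lemma prob_grid_exceeds:
  assumes "0 < u" "u < v" "r \<ge> 0" "tail (r / (2 * v powr H)) \<le> 1 / 4"
  shows "prob (grid_exceeds u v r) \<le> 2 * \<P>(\<omega> in M. norm (X v \<omega> - X u \<omega>) > r)"
proof -
  let ?A = "\<lambda>m. {\<omega> \<in> space M. \<exists>k\<le>(2::nat) ^ m. norm (X (u + (v - u) * (real k / 2 ^ m)) \<omega> - X u \<omega>) > 2 * r}"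
  have le: "prob (?A m) \<le> 2 * \<P>(\<omega> in M. norm (X v \<omega> - X u \<omega>) > r)" for m
  proof -
    define t where "t k = u + (v - u) * (real k / 2 ^ m)" for k
    have t0: "t 0 = u" and tn: "t (2 ^ m) = v" by (simp_all add: t_def)
    have mono: "strict_mono_on {..2 ^ m} t"
      using assms by (auto simp: strict_mono_on_def t_def divide_strict_right_mono)
    have "\<P>(\<omega> in M. norm (X (t (2 ^ m)) \<omega> - X (t k) \<omega>) > r) \<le> 1 / 2" if "k \<le> 2 ^ m" for k
    proof -
      have "real k / 2 ^ m \<le> 1" using that by (simp add: divide_le_eq)
      then have "t k \<le> v" using mult_left_mono[of "real k / 2 ^ m" 1 "v - u"] assms by (simp add: t_def)
      moreover have "0 < t k" using assms by (auto simp: t_def intro!: add_pos_nonneg)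
      ultimately show ?thesis
        using prob_increment_le_tail[of "t k" v r] assms by (simp add: tn)
    qed
    from ottaviani_process[of t "2 ^ m" r, OF _ mono this] assms
    have "\<P>(\<omega> in M. \<exists>k\<le>2 ^ m. norm (X (t k) \<omega> - X u \<omega>) > 2 * r) \<le>
      2 * \<P>(\<omega> in M. norm (X v \<omega> - X u \<omega>) > r)" by (simp only: t0 tn)
    then show ?thesis by (simp add: t_def)
  qed
  have "incseq ?A"
  proof (rule incseq_SucI, rule subsetI)
    fix m \<omega> assume "\<omega> \<in> ?A m"
    then obtain k where k: "\<omega> \<in> space M" "k \<le> 2 ^ m"
      "norm (X (u + (v - u) * (real k / 2 ^ m)) \<omega> - X u \<omega>) > 2 * r" by auto
    moreover have "real (2 * k) / 2 ^ Suc m = real k / 2 ^ m" by simp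
    ultimately have "2 * k \<le> 2 ^ Suc m \<and>
        norm (X (u + (v - u) * (real (2 * k) / 2 ^ Suc m)) \<omega> - X u \<omega>) > 2 * r"
      by (simp only:) simp
    with k(1) show "\<omega> \<in> ?A (Suc m)" by blast
  qed
  then have "(\<lambda>m. prob (?A m)) \<longlonglongrightarrow> prob (\<Union>m. ?A m)"
    using grid_level_measurable assms by (intro finite_Lim_measure_incseq) auto
  then show ?thesis
    unfolding grid_exceeds_def using le by (intro LIMSEQ_le_const2) auto
qed

text \<open>If the bound failed at some s < v, right-continuity would make it fail on a whole
  interval to the right of s, which contains dyadic grid points. The end point v is itself a grid
  point.\<close>

lemma grid_bound_extends:
  fixes f :: "real \<Rightarrow> real ^ 'm"
  assumes uv: "0 \<le> u" "u < v" and rc: "\<And>t. t \<ge> 0 \<Longrightarrow> continuous (at_right t) f"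
    and grid: "\<And>m k. k \<le> (2::nat) ^ m \<Longrightarrow> norm (f (u + (v - u) * (real k / 2 ^ m)) - f u) \<le> c"
    and s: "u \<le> s" "s \<le> v"
  shows "norm (f s - f u) \<le> c"
proof (cases "s = v")
  case True
  with grid[of 1 0] show ?thesis by simp
next
  case False
  show ?thesis
  proof (rule ccontr)
    assume "\<not> norm (f s - f u) \<le> c"
    moreover have "((\<lambda>y. norm (f y - f u)) \<longlongrightarrow> norm (f s - f u)) (at_right s)"
      using rc[of s] s uv by (auto simp: continuous_within intro!: tendsto_intros)
    ultimately have "\<forall>\<^sub>F y in at_right s. norm (f y - f u) > c"
      by (intro order_tendstoD(1)) auto
    then obtain d where d: "d > s" "\<And>y. s < y \<Longrightarrow> y < d \<Longrightarrow> norm (f y - f u) > c"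
      by (auto simp: eventually_at_right_field)
    define e where "e = min d v - s"
    have "e > 0" using d s False by (auto simp: e_def)
    obtain m where m: "(v - u) / e < 2 ^ m"
      using real_arch_pow[of 2 "(v - u) / e"] by auto
    \<comment> \<open>x is the position of s in units of the grid; rounding down and adding 1 gives
      a grid point y strictly to the right of s, at distance at most (v - u) / 2 ^ m.\<close>
    define x where "x = (s - u) / (v - u) * 2 ^ m"
    define k where "k = nat \<lfloor>x\<rfloor> + 1"
    have "x \<ge> 0" using s uv by (simp add: x_def)
    then have k: "x < real k" "real k \<le> x + 1" unfolding k_def by linarith+
    define y where "y = u + (v - u) * (real k / 2 ^ m)"
    have x': "u + (v - u) * (x / 2 ^ m) = s" using uv by (simp add: x_def)
    have "y > s"
      unfolding y_def x'[symmetric] using k(1) uv by (intro add_strict_left_mono mult_strict_left_mono divide_strict_right_mono) auto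
    have "y \<le> u + (v - u) * ((x + 1) / 2 ^ m)"
      unfolding y_def using k(2) uv by (intro add_left_mono mult_left_mono divide_right_mono) auto
    also have "\<dots> = s + (v - u) / 2 ^ m"
      using x' by (simp add: add_divide_distrib distrib_left)
    also have "(v - u) / 2 ^ m < e" using m \<open>e > 0\<close> by (simp add: field_simps)
    finally have "y < d" "y < v" by (auto simp: e_def)
    have "real k / 2 ^ m < 1"
    proof (rule ccontr)
      assume "\<not> real k / 2 ^ m < 1"
      then have "(v - u) * 1 \<le> (v - u) * (real k / 2 ^ m)" using uv by (intro mult_left_mono) auto
      with \<open>y < v\<close> show False by (simp add: y_def)
    qed
    then have "real k \<le> real (2 ^ m)" by (simp add: divide_less_eq)
    then have "k \<le> 2 ^ m" by (simp only: of_nat_le_iff)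
    from grid[OF this] d(2)[OF \<open>y > s\<close> \<open>y < d\<close>] show False by (simp add: y_def)
  qed
qed

end

section \<open>The upper limit along geometric blocks\<close>

lemma class_G1_D:
  assumes "g \<in> class_G1"
  shows "x \<ge> 0 \<Longrightarrow> g x > 0" "0 \<le> x \<Longrightarrow> x \<le> y \<Longrightarrow> g x \<le> g y" "filterlim g at_top at_top"
  using assms by (auto simp: class_G1_def monotone_on_def)

lemma block_index:
  fixes b t :: real
  assumes "b > 1" "t \<ge> 1"
  obtains n :: nat where "b ^ n \<le> t" "t < b ^ Suc n"
proof -
  define n where "n = nat \<lfloor>ln t / ln b\<rfloor>"
  have "ln t / ln b \<ge> 0" using assms by simp
  then have n: "real n \<le> ln t / ln b" "ln t / ln b < real n + 1"
    unfolding n_def by linarith+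
  then have "real n * ln b \<le> ln t" "ln t < (real n + 1) * ln b"
    using assms by (simp_all add: pos_le_divide_eq pos_divide_less_eq)
  then have "real n * ln b \<le> ln t" "ln t < real (Suc n) * ln b"
    by (simp_all add: add.commute)
  then have "ln (b ^ n) \<le> ln t" "ln t < ln (b ^ Suc n)"
    using assms by (simp_all only: ln_realpow)
  then have "b ^ n \<le> t" "t < b ^ Suc n"
    using assms by (simp_all del: power_Suc)
  then show thesis by (rule that)
qed

text \<open>The normalised values \<open>u n\<close> along a geometric sequence obey
  \<open>u (Suc n) \<le> b powr (- H) * u n + 2 * d\<close>.\<close>

lemma eventually_le_of_block_bounds:
  fixes f :: "real \<Rightarrow> real ^ 'n" and b d H :: real
  assumes g: "g \<in> class_G1" and b: "b > 1" and H: "H > 0" and d: "d > 0"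
    and block: "\<And>n s. n \<ge> N \<Longrightarrow> b ^ n \<le> s \<Longrightarrow> s \<le> b ^ Suc n \<Longrightarrow>
      norm (f s - f (b ^ n)) \<le> 2 * (d * (b ^ Suc n) powr H * g (real n * ln b))"
  shows "\<forall>\<^sub>F t in at_top. norm (f t) / (t powr H * g (ln t)) \<le> d * (3 / (1 - b powr (- H)) + 2 * b powr H)"
proof -
  define a where "a = b powr (- H)"
  have a: "0 < a" "a < 1" using b H by (auto simp: a_def powr_less_one)
  have ab: "a * b powr H = 1" using b by (simp add: a_def powr_minus)
  define gn where "gn n = g (real n * ln b)" for n :: nat
  have gn: "gn n > 0" "gn n \<le> gn (Suc n)" for n
    using class_G1_D[OF g] b by (auto simp: gn_def intro!: mult_right_mono)
  define P where "P n = (b ^ n) powr H" for n :: nat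
  have P: "P n > 0" "P (Suc n) = b powr H * P n" for n
    using b by (auto simp: P_def powr_mult)
  define u where "u n = norm (f (b ^ n)) / (P n * gn n)" for n
  have u0: "u n \<ge> 0" for n using P gn by (auto simp: u_def intro!: divide_nonneg_pos)
  have step: "u (Suc n) \<le> a * u n + 2 * d" if "n \<ge> N" for n
  proof -
    have "norm (f (b ^ Suc n)) \<le> norm (f (b ^ n)) + norm (f (b ^ Suc n) - f (b ^ n))"
      using norm_triangle_ineq[of "f (b ^ n)" "f (b ^ Suc n) - f (b ^ n)"] by simp
    also have "\<dots> \<le> norm (f (b ^ n)) + 2 * (d * P (Suc n) * gn n)"
      using block[OF that, of "b ^ Suc n"] b by (auto simp: P_def gn_def intro!: power_increasing)
    also have "norm (f (b ^ n)) = u n * (P n * gn n)" using P[of n] gn[of n] by (simp add: u_def)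
    finally have "norm (f (b ^ Suc n)) \<le> (u n * P n + 2 * d * P (Suc n)) * gn n"
      by (simp add: algebra_simps)
    also have "\<dots> \<le> (u n * P n + 2 * d * P (Suc n)) * gn (Suc n)"
      using gn P[of n] P(1)[of "Suc n"] u0[of n] d by (intro mult_left_mono) (auto intro!: add_nonneg_nonneg)
    finally have "u (Suc n) \<le> (u n * P n + 2 * d * P (Suc n)) / P (Suc n)"
      using gn(1)[of "Suc n"] P(1)[of "Suc n"] by (simp add: u_def divide_le_eq mult.commute mult.left_commute)
    also have "\<dots> = u n * (P n / P (Suc n)) + 2 * d" using P(1)[of "Suc n"] by (simp add: field_simps)
    also have "P n / P (Suc n) = a" using P(1)[of n] ab b by (simp add: P(2) field_simps)
    finally show ?thesis by (simp add: mult.commute)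
  qed
  \<comment> \<open>2 * d / (1 - a) is the fixed point of the map x -> a * x + 2 * d.\<close>
  have bound: "u (N + k) \<le> a ^ k * u N + 2 * d / (1 - a)" for k
  proof (induction k)
    case 0
    then show ?case using a d by simp
  next
    case (Suc k)
    have "u (N + Suc k) \<le> a * u (N + k) + 2 * d" using step[of "N + k"] by simp
    also have "\<dots> \<le> a * (a ^ k * u N + 2 * d / (1 - a)) + 2 * d"
      using Suc a by (intro add_right_mono mult_left_mono) auto
    also have "\<dots> = a ^ Suc k * u N + 2 * d / (1 - a)" using a by (simp add: field_simps)
    finally show ?case .
  qed
  have "(\<lambda>k. a ^ k * u N) \<longlonglongrightarrow> 0 * u N" using a by (intro tendsto_intros) auto
  then have "\<forall>\<^sub>F k in sequentially. a ^ k * u N < d / (1 - a)"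
    using a d by (intro order_tendstoD) auto
  then obtain K where K: "\<And>k. k \<ge> K \<Longrightarrow> a ^ k * u N < d / (1 - a)"
    by (auto simp: eventually_sequentially)
  \<comment> \<open>The 3 is the 2 of the fixed point plus 1 for the transient term, which is small
    by now.\<close>
  have ub: "u n \<le> 3 * d / (1 - a)" if n: "n \<ge> N + K" for n
  proof -
    have "u (N + (n - N)) \<le> a ^ (n - N) * u N + 2 * d / (1 - a)" by (rule bound)
    also have "\<dots> \<le> d / (1 - a) + 2 * d / (1 - a)" using K[of "n - N"] n by linarith
    also have "\<dots> = 3 * d / (1 - a)" by (simp add: add_divide_distrib[symmetric])
    finally show ?thesis using n by simp
  qed
  show ?thesis using eventually_ge_at_top[of "b ^ (N + K)"]
  proof eventually_elim
    case (elim t)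
    have "t \<ge> 1" using elim b one_le_power[of b "N + K"] by linarith
    with b obtain n where n: "b ^ n \<le> t" "t < b ^ Suc n" by (rule block_index)
    have "b ^ (N + K) < b ^ Suc n" using elim n(2) by (rule le_less_trans)
    then have "N + K < Suc n" using b by (subst (asm) power_strict_increasing_iff) auto
    then have nK: "n \<ge> N + K" by simp
    have lnt: "real n * ln b \<le> ln t"
      using n(1) b \<open>t \<ge> 1\<close> by (simp add: ln_realpow[symmetric])
    have den: "P n * gn n \<le> t powr H * g (ln t)"
      unfolding P_def gn_def
      using n b H lnt class_G1_D[OF g] \<open>t \<ge> 1\<close>
      by (intro mult_mono powr_mono2) (auto intro: less_imp_le)
    have "norm (f t) \<le> norm (f (b ^ n)) + norm (f t - f (b ^ n))"
      using norm_triangle_ineq[of "f (b ^ n)" "f t - f (b ^ n)"] by simp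
    also have "\<dots> \<le> norm (f (b ^ n)) + 2 * (d * P (Suc n) * gn n)"
      using block[of n t] n nK by (auto simp: P_def gn_def)
    finally have 1: "norm (f t) \<le> norm (f (b ^ n)) + 2 * (d * P (Suc n) * gn n)" .
    have "norm (f t) / (t powr H * g (ln t)) \<le> norm (f t) / (P n * gn n)"
      using den P(1)[of n] gn(1)[of n] by (intro divide_left_mono) (auto intro!: mult_pos_pos less_le_trans[OF _ den])
    also have "\<dots> \<le> (norm (f (b ^ n)) + 2 * (d * P (Suc n) * gn n)) / (P n * gn n)"
      using 1 P(1)[of n] gn(1)[of n] by (intro divide_right_mono) auto
    also have "\<dots> = u n + 2 * d * b powr H"
      using P[of n] gn(1)[of n] by (simp add: u_def field_simps)
    also have "\<dots> \<le> 3 * d / (1 - a) + 2 * d * b powr H" using ub[OF nK] by simp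
    also have "\<dots> = d * (3 / (1 - b powr (- H)) + 2 * b powr H)" by (simp add: a_def algebra_simps)
    finally show ?case .
  qed
qed

section \<open>Borel--Cantelli along the blocks\<close>

context selfsimilar_additive_process
begin

lemma prob_block_increment:
  assumes "b > 1"
  shows "\<P>(\<omega> in M. norm (X (b ^ Suc n) \<omega> - X (b ^ n) \<omega>) > (b ^ Suc n) powr H * r) = incr_tail b r"
  using prob_increment_scale[of "b ^ Suc n" "1 / b" 1 r] assms by (simp add: incr_tail_def)

text \<open>By Ottaviani's inequality a block is bad with probability at most twice a term of the
  series, for all large n; Borel--Cantelli then leaves only finitely many bad blocks.\<close>

lemma AE_block_bounds:
  assumes g: "g \<in> class_G1" and b: "b > 1" and d: "d > 0"
    and sum: "summable (\<lambda>n. incr_tail b (d * g (real n * ln b)))"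
  shows "AE \<omega> in M. \<exists>N. \<forall>n\<ge>N. \<forall>s. b ^ n \<le> s \<longrightarrow> s \<le> b ^ Suc n \<longrightarrow>
      norm (X s \<omega> - X (b ^ n) \<omega>) \<le> 2 * (d * (b ^ Suc n) powr H * g (real n * ln b))"
proof -
  define r where "r n = d * (b ^ Suc n) powr H * g (real n * ln b)" for n
  have r0: "r n \<ge> 0" for n using d class_G1_D(1)[OF g, of "real n * ln b"] b by (auto simp: r_def)
  define A where "A n = grid_exceeds (b ^ n) (b ^ Suc n) (r n)" for n
  have b': "0 < b ^ n" "b ^ n < b ^ Suc n" for n using b by auto
  obtain r1 where r1: "r1 > 0" "\<And>r. r \<ge> r1 \<Longrightarrow> tail r \<le> 1 / 4" using tail_eventually_le[of "1 / 4"] by auto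
  have "ln b > 0" using b by simp
  then have "filterlim (\<lambda>n. real n * ln b) at_top sequentially" by real_asymp
  from filterlim_compose[OF class_G1_D(3)[OF g] this]
  have "filterlim (\<lambda>n. g (real n * ln b)) at_top sequentially" .
  \<comment> \<open>The threshold makes d * g / 2, the argument at which \<open>tail\<close> is
    evaluated below, at least r1.\<close>
  then have "\<forall>\<^sub>F n in sequentially. g (real n * ln b) \<ge> 2 * r1 / d"
    by (simp add: filterlim_at_top)
  then have "\<forall>\<^sub>F n in sequentially. norm (prob (A n)) \<le> 2 * incr_tail b (d * g (real n * ln b))"
  proof eventually_elim
    case (elim n)
    have "r n / (2 * (b ^ Suc n) powr H) = d * g (real n * ln b) / 2"
      using b by (simp add: r_def)
    also have "\<dots> \<ge> r1" using elim d by (simp add: field_simps)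
    finally have "tail (r n / (2 * (b ^ Suc n) powr H)) \<le> 1 / 4" by (rule r1)
    from prob_grid_exceeds[OF b' r0 this]
    have "prob (A n) \<le> 2 * \<P>(\<omega> in M. norm (X (b ^ Suc n) \<omega> - X (b ^ n) \<omega>) > r n)"
      by (simp add: A_def)
    also have "r n = (b ^ Suc n) powr H * (d * g (real n * ln b))" by (simp add: r_def)
    finally show ?case using prob_block_increment[OF b] by simp
  qed
  then have "summable (\<lambda>n. prob (A n))"
    by (rule summable_comparison_test_ev) (intro summable_mult sum)
  then have "AE \<omega> in M. eventually (\<lambda>n. \<omega> \<in> space M - A n) sequentially"
    using b' by (intro borel_cantelli_AE1) (auto simp: A_def less_imp_le emeasure_eq_measure)
  with cadlag_paths show ?thesis
  proof eventually_elim
    case (elim \<omega>)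
    then obtain N where N: "\<And>n. n \<ge> N \<Longrightarrow> \<omega> \<in> space M - A n" by (auto simp: eventually_sequentially)
    show ?case
    proof (intro exI[of _ N] allI impI)
      fix n s assume n: "n \<ge> N" "b ^ n \<le> s" "s \<le> b ^ Suc n"
      have "norm (X (b ^ n + (b ^ Suc n - b ^ n) * (real k / 2 ^ m)) \<omega> - X (b ^ n) \<omega>) \<le> 2 * r n"
        if "k \<le> 2 ^ m" for m k
      proof -
        have "\<omega> \<in> space M" "\<omega> \<notin> grid_exceeds (b ^ n) (b ^ Suc n) (r n)"
          using N[OF n(1)] by (simp_all add: A_def)
        then have "\<not> norm (X (b ^ n + (b ^ Suc n - b ^ n) * (real k / 2 ^ m)) \<omega> - X (b ^ n) \<omega>) > 2 * r n"
          unfolding grid_exceeds_def using that by blast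
        then show ?thesis by (simp only: not_less)
      qed
      note grid = this
      have rc: "continuous (at_right t) (\<lambda>s. X s \<omega>)" if "t \<ge> 0" for t
        using elim(1) that by blast
      have "norm (X s \<omega> - X (b ^ n) \<omega>) \<le> 2 * r n"
        by (rule grid_bound_extends[OF less_imp_le[OF b'(1)] b'(2) rc grid n(2,3)])
      then show "norm (X s \<omega> - X (b ^ n) \<omega>) \<le> 2 * (d * (b ^ Suc n) powr H * g (real n * ln b))"
        by (simp only: r_def)
    qed
  qed
qed

proposition limsup_zero:
  assumes g: "g \<in> class_G1" and b: "b > 1"
    and sum: "\<And>d. d > 0 \<Longrightarrow> summable (\<lambda>n. incr_tail b (d * g (real n * ln b)))"
  shows "AE \<omega> in M. Limsup at_top (\<lambda>t. ereal (norm (X t \<omega>) / (t powr H * g (ln t)))) = 0"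
proof -
  define C where "C = 3 / (1 - b powr (- H)) + 2 * b powr H"
  have "b powr (- H) < 1" using b H_pos by (simp add: powr_less_one)
  then have C: "C > 0" using b by (auto simp: C_def intro!: add_pos_pos)
  \<comment> \<open>The values d = 1 / (j + 1) suffice, and being countable they share one null
    set.\<close>
  have "AE \<omega> in M. \<forall>j::nat. \<exists>N. \<forall>n\<ge>N. \<forall>s. b ^ n \<le> s \<longrightarrow> s \<le> b ^ Suc n \<longrightarrow>
      norm (X s \<omega> - X (b ^ n) \<omega>) \<le> 2 * ((1 / Suc j) * (b ^ Suc n) powr H * g (real n * ln b))"
    by (intro AE_all_countable[THEN iffD2] allI AE_block_bounds g b sum) simp_all
  then show ?thesis
  proof eventually_elim
    case (elim \<omega>)
    let ?R = "\<lambda>t. norm (X t \<omega>) / (t powr H * g (ln t))"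
    have ev: "\<forall>\<^sub>F t in at_top. ?R t \<le> 1 / Suc j * C" for j
    proof -
      obtain N where N: "\<And>n s. n \<ge> N \<Longrightarrow> b ^ n \<le> s \<Longrightarrow> s \<le> b ^ Suc n \<Longrightarrow>
          norm (X s \<omega> - X (b ^ n) \<omega>) \<le> 2 * ((1 / Suc j) * (b ^ Suc n) powr H * g (real n * ln b))"
        using elim by meson
      show ?thesis unfolding C_def
        by (rule eventually_le_of_block_bounds[OF g b H_pos _ N]) auto
    qed
    have "Limsup at_top (\<lambda>t. ereal (?R t)) \<le> ereal e" if "e > 0" for e
    proof -
      obtain j where "1 / real (Suc j) < e / C" using nat_approx_posE[of "e / C"] \<open>e > 0\<close> C by auto
      then have "1 / real (Suc j) * C \<le> e" using C by (simp add: field_simps)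
      with ev[of j] have "\<forall>\<^sub>F t in at_top. ereal (?R t) \<le> ereal e"
        unfolding ereal_less_eq(3) by (auto elim: eventually_mono)
      then show ?thesis by (rule Limsup_bounded)
    qed
    then have "Limsup at_top (\<lambda>t. ereal (?R t)) \<le> 0"
      by (rule ereal_le_epsilon2[where y = 0, unfolded add_0_left])
    moreover have "0 \<le> Limsup at_top (\<lambda>t. ereal (?R t))"
    proof (rule le_Limsup)
      show "\<forall>\<^sub>F t in at_top. 0 \<le> ereal (?R t)" using eventually_ge_at_top[of 1]
      proof eventually_elim
        case (elim t)
        then have "g (ln t) > 0" by (intro class_G1_D(1)[OF g]) simp
        then show ?case by simp
      qed
    qed simp
    ultimately show ?case by (rule antisym)
  qed
qed

text \<open>The level uses g at the right end of the block, where the increment is compared with the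
  values of the process. By selfsimilarity the probabilities form the given series shifted by one
  index, so they still diverge.\<close>

lemma AE_infinitely_often_large:
  assumes g: "g \<in> class_G1" and b: "b > 1"
    and sum: "\<not> summable (\<lambda>n. incr_tail b (c * g (real n * ln b)))"
  shows "AE \<omega> in M. \<forall>m. \<exists>n\<ge>m. norm (X (b ^ Suc n) \<omega> - X (b ^ n) \<omega>) >
      (b ^ Suc n) powr H * (c * g (real (Suc n) * ln b))"
proof -
  define V where "V i \<omega> = X (b ^ Suc i) \<omega> - X (b ^ i) \<omega>" for i \<omega>
  define s where "s n = (b ^ Suc n) powr H * (c * g (real (Suc n) * ln b))" for n
  have [measurable]: "V i \<in> borel_measurable M" for i
    unfolding V_def using b by (intro borel_measurable_diff random_variable) auto
  define p where "p n = \<P>(\<omega> in M. norm (V n \<omega>) > s n)" for n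
  have p: "p n = incr_tail b (c * g (real (Suc n) * ln b))" for n
    unfolding p_def V_def s_def by (rule prob_block_increment[OF b])
  have nsum: "\<not> summable p"
    unfolding p using sum summable_Suc_iff[of "\<lambda>n. incr_tail b (c * g (real n * ln b))"] by simp
  have p0: "p n \<ge> 0" for n by (simp add: p_def)
  have null: "\<P>(\<omega> in M. \<forall>n\<ge>m. norm (V n \<omega>) \<le> s n) = 0" (is "prob ?B = 0") for m
  proof -
    have le: "prob ?B \<le> exp (- (\<Sum>n\<in>{m..<K}. p n))" for K
    proof -
      have "strict_mono_on {..K} (\<lambda>i. b ^ i)"
        using b by (auto simp: strict_mono_on_def intro: power_strict_increasing)
      from independent_increments[OF _ this] b
      have "indep_vars (\<lambda>_. borel) V {..<K}" unfolding V_def[abs_def] by simp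
      then have ind: "indep_vars (\<lambda>_. borel) V {m..<K}" by (rule indep_vars_subset) auto
      have "prob ?B \<le> \<P>(\<omega> in M. \<forall>n\<in>{m..<K}. norm (V n \<omega>) \<le> s n)"
        by (intro finite_measure_mono) auto
      also have "\<dots> \<le> exp (- (\<Sum>n\<in>{m..<K}. p n))"
        unfolding p_def by (rule prob_none_exceeds[OF ind]) simp
      finally show ?thesis .
    qed
    have "prob ?B \<le> e" if "e > 0" for e
    proof (rule ccontr)
      assume "\<not> prob ?B \<le> e"
      then have "(\<Sum>n\<in>{m..<K}. p n) < - ln e" for K
      proof -
        have "e < exp (- (\<Sum>n\<in>{m..<K}. p n))" using le[of K] \<open>\<not> prob ?B \<le> e\<close> by linarith
        then have "ln e < ln (exp (- (\<Sum>n\<in>{m..<K}. p n)))"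
          using \<open>e > 0\<close> by (subst ln_less_cancel_iff) auto
        then show ?thesis by simp
      qed
      then have "(\<Sum>n<K. p n) \<le> (\<Sum>n<m. p n) + - ln e" for K
      proof -
        assume A: "\<And>K. (\<Sum>n\<in>{m..<K}. p n) < - ln e"
        have "(\<Sum>n<K. p n) \<le> (\<Sum>n\<in>{..<m} \<union> {m..<K}. p n)"
          using p0 by (intro sum_mono2) auto
        also have "\<dots> = (\<Sum>n<m. p n) + (\<Sum>n\<in>{m..<K}. p n)"
          by (intro sum.union_disjoint) auto
        finally show ?thesis using A[of K] by linarith
      qed
      then have "(\<Sum>n\<le>K. p n) \<le> (\<Sum>n<m. p n) + - ln e" for K
        by (metis lessThan_Suc_atMost)
      then have "summable p" using p0 by (intro bounded_imp_summable[of p]) auto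
      with nsum show False by simp
    qed
    then have "prob ?B \<le> 0" by (rule field_le_epsilon[of _ 0, simplified])
    then show ?thesis by (simp add: measure_le_0_iff)
  qed
  have "AE \<omega> in M. \<forall>m. \<not> (\<forall>n\<ge>m. norm (V n \<omega>) \<le> s n)"
  proof (intro AE_all_countable[THEN iffD2] allI)
    fix m
    have "{\<omega> \<in> space M. \<forall>n\<ge>m. norm (V n \<omega>) \<le> s n} \<in> events" by measurable
    with null[of m] show "AE \<omega> in M. \<not> (\<forall>n\<ge>m. norm (V n \<omega>) \<le> s n)"
      by (subst AE_iff_measurable[OF _ refl]) (auto simp: emeasure_eq_measure)
  qed
  then show ?thesis
    by eventually_elim (auto simp: V_def s_def not_le)
qed

text \<open>An increment above a level forces one of the two end values above half of it, and the
  normalisation at either end is at most the one at the right end.\<close>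

proposition limsup_infinity:
  assumes g: "g \<in> class_G1" and b: "b > 1"
    and sum: "\<And>c. c > 0 \<Longrightarrow> \<not> summable (\<lambda>n. incr_tail b (c * g (real n * ln b)))"
  shows "AE \<omega> in M. Limsup at_top (\<lambda>t. ereal (norm (X t \<omega>) / (t powr H * g (ln t)))) = \<infinity>"
proof -
  have "AE \<omega> in M. \<forall>j::nat. \<forall>m. \<exists>n\<ge>m. norm (X (b ^ Suc n) \<omega> - X (b ^ n) \<omega>) >
      (b ^ Suc n) powr H * (real (Suc j) * g (real (Suc n) * ln b))"
    using g b sum by (intro AE_all_countable[THEN iffD2, of "\<lambda>j \<omega>. \<forall>m. P j m \<omega>" for P] allI
      AE_infinitely_often_large) auto
  then show ?thesis
  proof eventually_elim
    case (elim \<omega>)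
    let ?R = "\<lambda>t. norm (X t \<omega>) / (t powr H * g (ln t))"
    have ex: "\<exists>t\<ge>T. ?R t > real (Suc j) / 2" for T j
    proof -
      obtain m where m: "b ^ m > T" using real_arch_pow[OF b] by auto
      obtain n where n: "n \<ge> m" "norm (X (b ^ Suc n) \<omega> - X (b ^ n) \<omega>) >
          (b ^ Suc n) powr H * (real (Suc j) * g (real (Suc n) * ln b))" using elim by blast
      let ?c = "(b ^ Suc n) powr H * (real (Suc j) * g (real (Suc n) * ln b))"
      have "b ^ m \<le> b ^ n" "b ^ m \<le> b ^ Suc n"
        using n(1) b by (intro power_increasing; simp)+
      with m have T: "T \<le> b ^ n" "T \<le> b ^ Suc n" by linarith+
      have "norm (X (b ^ Suc n) \<omega> - X (b ^ n) \<omega>) \<le> norm (X (b ^ Suc n) \<omega>) + norm (X (b ^ n) \<omega>)"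
        by (rule norm_triangle_ineq4)
      with n(2) consider "norm (X (b ^ Suc n) \<omega>) > ?c / 2" | "norm (X (b ^ n) \<omega>) > ?c / 2" by linarith
      then show ?thesis
      proof cases
        case 1
        have "(b ^ Suc n) powr H * g (real (Suc n) * ln b) > 0"
          using class_G1_D(1)[OF g, of "real (Suc n) * ln b"] b by (intro mult_pos_pos) auto
        with 1 have "?R (b ^ Suc n) > real (Suc j) / 2"
          using b by (simp only: ln_realpow) (simp del: power_Suc of_nat_Suc add: less_divide_eq mult_ac)
        with T show ?thesis by blast
      next
        case 2
        have pos: "(b ^ n) powr H * g (real n * ln b) > 0"
          using class_G1_D(1)[OF g, of "real n * ln b"] b by (intro mult_pos_pos) auto
        have "(b ^ n) powr H * g (real n * ln b) \<le> (b ^ Suc n) powr H * g (real (Suc n) * ln b)"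
          using b H_pos class_G1_D[OF g] by (intro mult_mono powr_mono2 power_increasing) (auto intro!: mult_right_mono less_imp_le)
        then have "real (Suc j) * ((b ^ n) powr H * g (real n * ln b)) \<le>
            real (Suc j) * ((b ^ Suc n) powr H * g (real (Suc n) * ln b))" by (rule mult_left_mono) simp
        also have "\<dots> = ?c" by (simp only: mult_ac)
        finally have "norm (X (b ^ n) \<omega>) > real (Suc j) / 2 * ((b ^ n) powr H * g (real n * ln b))"
          using 2 by linarith
        with pos have "?R (b ^ n) > real (Suc j) / 2"
          using b by (simp only: ln_realpow) (simp del: power_Suc of_nat_Suc add: less_divide_eq mult_ac)
        with T show ?thesis by blast
      qed
    qed
    show ?case
    proof (rule ccontr)
      assume "Limsup at_top (\<lambda>t. ereal (?R t)) \<noteq> \<infinity>"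
      then obtain j where j: "Limsup at_top (\<lambda>t. ereal (?R t)) < ereal (real j)"
        using less_PInf_Ex_of_nat[of "Limsup at_top (\<lambda>t. ereal (?R t))"] by auto
      from Limsup_lessD[OF this] obtain T where T: "\<And>t. t \<ge> T \<Longrightarrow> ?R t < real j"
        by (auto simp: eventually_at_top_linorder)
      obtain t where "t \<ge> T" "?R t > real (Suc (2 * j)) / 2" using ex by blast
      moreover have "real j \<le> real (Suc (2 * j)) / 2" by simp
      ultimately show False using T[of t] by linarith
    qed
  qed
qed

end

section \<open>O-regular variation and the integral criterion\<close>

lemma class_OR_pos: "F \<in> class_OR \<Longrightarrow> x > 0 \<Longrightarrow> F x > 0"
  by (simp add: class_OR_def)

lemma class_OR_bound:
  assumes "F \<in> class_OR" "c > 0"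
  obtains B x0 where "B > 0" "x0 > 0" "\<And>x. x \<ge> x0 \<Longrightarrow> F (c * x) \<le> B * F x"
proof -
  have "Limsup at_top (\<lambda>x. ereal (F (c * x) / F x)) < \<infinity>"
    using assms by (auto simp: class_OR_def same_order_def)
  then obtain n where "Limsup at_top (\<lambda>x. ereal (F (c * x) / F x)) < ereal (real n)"
    using less_PInf_Ex_of_nat[of "Limsup at_top (\<lambda>x. ereal (F (c * x) / F x))"] by auto
  from Limsup_lessD[OF this] obtain T where T: "\<And>x. x \<ge> T \<Longrightarrow> F (c * x) / F x < real n"
    by (auto simp: eventually_at_top_linorder)
  show thesis
  proof (rule that[of "max (real n) 1" "max T 1"])
    fix x assume x: "x \<ge> max T 1"
    then have "F x > 0" using class_OR_pos[OF assms(1)] by simp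
    moreover have "F (c * x) / F x \<le> max (real n) 1" using T[of x] x by simp
    ultimately show "F (c * x) \<le> max (real n) 1 * F x" by (simp only: pos_divide_le_eq)
  qed auto
qed

section \<open>Comparison of series and integrals\<close>

lemma nat_floor_unique:
  fixes x \<beta> :: real
  assumes "\<beta> > 0" "x \<ge> 0"
  shows "x \<in> {real n * \<beta>..<real (Suc n) * \<beta>} \<longleftrightarrow> n = nat \<lfloor>x / \<beta>\<rfloor>"
proof -
  have "x \<in> {real n * \<beta>..<real (Suc n) * \<beta>} \<longleftrightarrow> real n \<le> x / \<beta> \<and> x / \<beta> < real n + 1"
    using assms(1) by (simp add: pos_le_divide_eq pos_divide_less_eq add.commute)
  also have "\<dots> \<longleftrightarrow> \<lfloor>x / \<beta>\<rfloor> = int n"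
    by (simp add: floor_eq_iff)
  also have "\<dots> \<longleftrightarrow> n = nat \<lfloor>x / \<beta>\<rfloor>" using assms by auto
  finally show ?thesis .
qed

text \<open>An integral test with two functions: F composed with g need not be monotone, so
  monotonicity is asked only of the minorant \<phi>, an increment tail. On each cell \<phi> is at
  least its value at the right end, hence the shifted index in the sums.\<close>

lemma summable_of_nn_integral:
  fixes \<phi> \<psi> :: "real \<Rightarrow> real"
  assumes "\<beta> > 0" and anti: "\<And>x y. 0 \<le> x \<Longrightarrow> x \<le> y \<Longrightarrow> \<phi> y \<le> \<phi> x" and nn: "\<And>x. \<phi> x \<ge> 0"
    and le: "\<And>x. x \<ge> x1 \<Longrightarrow> \<phi> x \<le> \<psi> x"
    and fin: "(\<integral>\<^sup>+x\<in>{0..}. ennreal (\<psi> x) \<partial>lborel) < \<infinity>"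
  shows "summable (\<lambda>n. \<phi> (real n * \<beta>))"
proof -
  define n1 where "n1 = nat \<lceil>x1 / \<beta>\<rceil>"
  have n1: "x1 \<le> real n1 * \<beta>"
    using assms(1) real_nat_ceiling_ge[of "x1 / \<beta>"] by (simp add: n1_def pos_divide_le_eq)
  define I where "I = enn2real (\<integral>\<^sup>+x\<in>{0..}. ennreal (\<psi> x) \<partial>lborel)"
  let ?J = "\<lambda>n. {real n * \<beta>..<real (Suc n) * \<beta>}"
  have len: "emeasure lborel (?J n) = ennreal \<beta>" for n
    using assms(1) by (simp add: algebra_simps)
  have *: "(\<Sum>n\<in>{n1..<K}. \<phi> (real (Suc n) * \<beta>)) * \<beta> \<le> I" for K
  proof -
    have "ennreal ((\<Sum>n\<in>{n1..<K}. \<phi> (real (Suc n) * \<beta>)) * \<beta>) =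
        (\<Sum>n\<in>{n1..<K}. ennreal (\<phi> (real (Suc n) * \<beta>)) * emeasure lborel (?J n))"
      unfolding len using nn assms(1)
      by (simp add: sum_distrib_right[symmetric] ennreal_mult' sum_nonneg flip: sum_ennreal)
    also have "\<dots> = (\<integral>\<^sup>+x. (\<Sum>n\<in>{n1..<K}. ennreal (\<phi> (real (Suc n) * \<beta>)) * indicator (?J n) x) \<partial>lborel)"
      by (subst nn_integral_sum) (auto intro!: sum.cong nn_integral_cmult_indicator[symmetric])
    also have "\<dots> \<le> (\<integral>\<^sup>+x\<in>{0..}. ennreal (\<psi> x) \<partial>lborel)"
    proof (rule nn_integral_mono)
      fix x :: real
      show "(\<Sum>n\<in>{n1..<K}. ennreal (\<phi> (real (Suc n) * \<beta>)) * indicator (?J n) x) \<le> ennreal (\<psi> x) * indicator {0..} x"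
      proof (cases "\<exists>m\<in>{n1..<K}. x \<in> ?J m")
        case True
        then obtain m where m: "m \<in> {n1..<K}" "x \<in> ?J m" by blast
        have "0 \<le> real m * \<beta>" using assms(1) by simp
        with m have x: "x \<ge> 0" by simp
        have iff: "x \<in> ?J n \<longleftrightarrow> n = m" for n
          using nat_floor_unique[OF assms(1) x, of n] nat_floor_unique[OF assms(1) x, of m] m(2) by blast
        have ind: "indicator (?J n) x = (if n = m then 1 else 0 :: ennreal)" for n
          by (simp only: indicator_def of_bool_def iff)
        have "real n1 * \<beta> \<le> real m * \<beta>" using m(1) assms(1) by (intro mult_right_mono) auto
        then have "x \<ge> x1" using n1 m(2) by simp
        have "(\<Sum>n\<in>{n1..<K}. ennreal (\<phi> (real (Suc n) * \<beta>)) * indicator (?J n) x) = ennreal (\<phi> (real (Suc m) * \<beta>))"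
          unfolding ind using m(1) by (simp add: if_distrib sum.delta cong: if_cong)
        also have "\<dots> \<le> ennreal (\<phi> x)" using m(2) x by (intro ennreal_leI anti) auto
        also have "\<dots> \<le> ennreal (\<psi> x)" using \<open>x \<ge> x1\<close> le by (intro ennreal_leI) auto
        finally show ?thesis using x by simp
      next
        case False
        then have "(\<Sum>n\<in>{n1..<K}. ennreal (\<phi> (real (Suc n) * \<beta>)) * indicator (?J n) x) = 0"
          by (intro sum.neutral ballI) (metis indicator_simps(2) mult_zero_right)
        then show ?thesis by (simp only: zero_le)
      qed
    qed
    also have "\<dots> = ennreal I" using fin by (simp add: I_def)
    finally show ?thesis by (simp add: I_def)
  qed
  have "(\<Sum>n\<le>K. \<phi> (real (Suc n) * \<beta>)) \<le> (\<Sum>n<n1. \<phi> (real (Suc n) * \<beta>)) + I / \<beta>" for K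
  proof -
    have "(\<Sum>n\<le>K. \<phi> (real (Suc n) * \<beta>)) \<le> (\<Sum>n\<in>{..<n1} \<union> {n1..<Suc K}. \<phi> (real (Suc n) * \<beta>))"
      using nn by (intro sum_mono2) auto
    also have "\<dots> = (\<Sum>n<n1. \<phi> (real (Suc n) * \<beta>)) + (\<Sum>n\<in>{n1..<Suc K}. \<phi> (real (Suc n) * \<beta>))"
      by (intro sum.union_disjoint) auto
    also have "(\<Sum>n\<in>{n1..<Suc K}. \<phi> (real (Suc n) * \<beta>)) \<le> I / \<beta>"
      using *[of "Suc K"] assms(1) by (simp only: pos_le_divide_eq)
    finally show ?thesis by simp
  qed
  then have "summable (\<lambda>n. \<phi> (real (Suc n) * \<beta>))" using nn by (intro bounded_imp_summable)
  then show ?thesis using summable_Suc_iff[of "\<lambda>n. \<phi> (real n * \<beta>)"] by simp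
qed

text \<open>The converse test, with left end points. The bound \<open>B\<close> handles the initial
  segment up to x1, where \<psi> is not yet compared with \<phi>.\<close>

lemma nn_integral_of_summable:
  fixes \<phi> \<psi> :: "real \<Rightarrow> real"
  assumes "\<beta> > 0" and anti: "\<And>x y. 0 \<le> x \<Longrightarrow> x \<le> y \<Longrightarrow> \<phi> y \<le> \<phi> x" and nn: "\<And>x. \<phi> x \<ge> 0"
    and le: "\<And>x. x \<ge> x1 \<Longrightarrow> \<psi> x \<le> \<phi> x" and bd: "\<And>x. x \<ge> 0 \<Longrightarrow> \<psi> x \<le> B"
    and sum: "summable (\<lambda>n. \<phi> (real n * \<beta>))"
  shows "(\<integral>\<^sup>+x\<in>{0..}. ennreal (\<psi> x) \<partial>lborel) < \<infinity>"
proof -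
  let ?J = "\<lambda>n. {real n * \<beta>..<real (Suc n) * \<beta>}"
  have len: "emeasure lborel (?J n) = ennreal \<beta>" for n
    using assms(1) by (simp add: algebra_simps)
  let ?S = "\<lambda>x. \<Sum>n. ennreal (\<phi> (real n * \<beta>)) * indicator (?J n) x"
  have "(\<integral>\<^sup>+x\<in>{0..}. ennreal (\<psi> x) \<partial>lborel) \<le> (\<integral>\<^sup>+x. ennreal B * indicator {0..x1} x + ?S x \<partial>lborel)"
  proof (rule nn_integral_mono)
    fix x :: real
    show "ennreal (\<psi> x) * indicator {0..} x \<le> ennreal B * indicator {0..x1} x + ?S x"
    proof (cases "x \<ge> 0")
      case x: True
      show ?thesis
      proof (cases "x \<le> x1")
        case True
        have "ennreal (\<psi> x) \<le> ennreal B" using bd[OF x] by (rule ennreal_leI)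
        also have "\<dots> \<le> ennreal B + ?S x" by simp
        finally show ?thesis using x True by simp
      next
        case False
        define m where "m = nat \<lfloor>x / \<beta>\<rfloor>"
        have m: "x \<in> ?J m" using nat_floor_unique[OF assms(1) x] by (simp add: m_def)
        have "ennreal (\<psi> x) \<le> ennreal (\<phi> x)" using le[of x] False by (intro ennreal_leI) simp
        also have "\<dots> \<le> ennreal (\<phi> (real m * \<beta>))" using m assms(1) by (intro ennreal_leI anti) auto
        also have "\<dots> = (\<Sum>n\<in>{m}. ennreal (\<phi> (real n * \<beta>)) * indicator (?J n) x)" using m by simp
        also have "\<dots> \<le> ?S x" by (intro sum_le_suminf) auto
        finally show ?thesis using x False by simp
      qed
    qed simp
  qed
  also have "\<dots> = (\<integral>\<^sup>+x. ennreal B * indicator {0..x1} x \<partial>lborel) + (\<integral>\<^sup>+x. ?S x \<partial>lborel)"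
    by (intro nn_integral_add) measurable
  also have "(\<integral>\<^sup>+x. ennreal B * indicator {0..x1} x \<partial>lborel) = ennreal B * emeasure lborel {0..x1}"
    by (simp add: nn_integral_cmult_indicator)
  also have "(\<integral>\<^sup>+x. ?S x \<partial>lborel) = (\<Sum>n. ennreal (\<phi> (real n * \<beta>)) * ennreal \<beta>)"
    by (subst nn_integral_suminf) (auto simp only: nn_integral_cmult_indicator len sets_lborel atLeastLessThan_borel
        intro!: borel_measurable_times_ennreal borel_measurable_const borel_measurable_indicator)
  also have "\<dots> = (\<Sum>n. ennreal (\<phi> (real n * \<beta>) * \<beta>))"
    using nn assms(1) by (simp add: ennreal_mult)
  also have "\<dots> = ennreal (\<Sum>n. \<phi> (real n * \<beta>) * \<beta>)"
    using nn assms(1) sum by (intro suminf_ennreal2 summable_mult2) auto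
  also have "ennreal B * emeasure lborel {0..x1} + \<dots> < \<infinity>"
    by (simp add: ennreal_mult_less_top emeasure_lborel_Icc_eq)
  finally show ?thesis .
qed

text \<open>Once \<eta> s < 1 / (2 * B), where B bounds the growth of F from c * s to c * s / l, the
  error term uses up at most C' / 2 and the main term another C' / 2. The induction enlarges the
  range of s by the factor l. It starts from G \<le> 1 and a positive lower bound of F on a compact
  interval, which \<open>loc\<close> supplies since membership in \<open>class_OR\<close> asserts
  only pointwise positivity and asymptotic ratios.\<close>

lemma recursive_bound:
  fixes F G \<eta> :: "real \<Rightarrow> real"
  assumes F: "F \<in> class_OR" and pos: "c > 0" "l > 1" "C > 0"
    and G1: "\<And>s. G s \<le> 1" and G0: "\<And>s. G s \<ge> 0"
    and \<eta>0: "\<And>s. \<eta> s \<ge> 0" and \<eta>: "(\<eta> \<longlongrightarrow> 0) at_top"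
    and rec: "\<And>s. s \<ge> s0 \<Longrightarrow> G s \<le> C * F (c * s) + \<eta> s * G (s / l)"
    and loc: "\<And>u v. u \<ge> y0 \<Longrightarrow> \<exists>m>0. \<forall>x\<in>{u..v}. m \<le> F x"
  obtains C' s1 where "C' > 0" "s1 > 0" "\<And>s. s \<ge> s1 \<Longrightarrow> G s \<le> C' * F (c * s)"
proof -
  obtain B x0 where B: "B > 0" "x0 > 0" "\<And>x. x \<ge> x0 \<Longrightarrow> F (1 / l * x) \<le> B * F x"
    using class_OR_bound[OF F, of "1 / l"] pos by auto
  have "\<forall>\<^sub>F s in at_top. \<eta> s < 1 / (2 * B)"
    using order_tendstoD(2)[OF \<eta>, of "1 / (2 * B)"] B by simp
  then obtain s2 where s2: "\<And>s. s \<ge> s2 \<Longrightarrow> \<eta> s < 1 / (2 * B)"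
    by (auto simp: eventually_at_top_linorder)
  define s1 where "s1 = max (max s0 s2) (max (x0 / c) (max (y0 * l / c) 1))"
  have s1: "s1 \<ge> s0" "s1 \<ge> s2" "s1 \<ge> x0 / c" "s1 \<ge> y0 * l / c" "s1 \<ge> 1"
    by (simp_all add: s1_def)
  have "c * s1 / l \<ge> y0" using s1(4) pos by (simp add: field_simps)
  from loc[OF this, of "c * s1"] obtain m where m: "m > 0" "\<And>x. x \<in> {c * s1 / l..c * s1} \<Longrightarrow> m \<le> F x" by auto
  \<comment> \<open>1 / m settles the initial interval, and 2 * C the induction step.\<close>
  define C' where "C' = max (1 / m) (2 * C)"
  have C': "C' \<ge> 1 / m" "C' \<ge> 2 * C" "C' > 0" using pos by (auto simp: C'_def)
  have Fpos: "s > 0 \<Longrightarrow> F (c * s) > 0" for s using class_OR_pos[OF F] pos by simp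
  have base: "G s \<le> C' * F (c * s)" if "s \<in> {s1 / l..s1}" for s
  proof -
    have "c * (s1 / l) \<le> c * s" "c * s \<le> c * s1" using that pos by (intro mult_left_mono; simp)+
    then have mF: "m \<le> F (c * s)" by (intro m(2)) simp
    have "G s \<le> 1 / m * m" using G1 m by simp
    also have "\<dots> \<le> C' * F (c * s)" using C' mF m by (intro mult_mono) auto
    finally show ?thesis .
  qed
  have ind: "\<forall>s. s1 / l \<le> s \<longrightarrow> s \<le> s1 * l ^ n \<longrightarrow> G s \<le> C' * F (c * s)" for n
  proof (induction n)
    case 0
    then show ?case using base by simp
  next
    case (Suc n)
    show ?case
    proof (intro allI impI)
      fix s assume s: "s1 / l \<le> s" "s \<le> s1 * l ^ Suc n"
      show "G s \<le> C' * F (c * s)"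
      proof (cases "s \<le> s1")
        case True
        with s base show ?thesis by simp
      next
        case False
        have "s / l \<le> s1 * l ^ n" using s(2) pos by (simp add: field_simps)
        moreover have "s1 / l \<le> s / l" using False pos by (intro divide_right_mono) auto
        ultimately have IH: "G (s / l) \<le> C' * F (c * (s / l))" using Suc by blast
        have "x0 / c \<le> s" using False s1(3) by linarith
        then have "c * s \<ge> x0" using pos by (simp add: field_simps)
        from B(3)[OF this] have "F (c * (s / l)) \<le> B * F (c * s)" by simp
        then have "C' * F (c * (s / l)) \<le> C' * (B * F (c * s))"
          using C'(3) by (intro mult_left_mono) simp_all
        with IH have "G (s / l) \<le> C' * (B * F (c * s))" by (rule order_trans)
        then have "\<eta> s * G (s / l) \<le> 1 / (2 * B) * (C' * (B * F (c * s)))"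
          using s2[of s] False s1(2) \<eta>0[of s] G0 B(1) by (intro mult_mono) auto
        also have "\<dots> = C' / 2 * F (c * s)" using B(1) by simp
        finally have "G s \<le> C * F (c * s) + C' / 2 * F (c * s)"
          using rec[of s] False s1(1) by simp
        also have "\<dots> = (C + C' / 2) * F (c * s)" by (simp add: algebra_simps)
        also have "\<dots> \<le> C' * F (c * s)"
          using C'(2) Fpos[of s] False s1(5) by (intro mult_right_mono) auto
        finally show ?thesis .
      qed
    qed
  qed
  show thesis
  proof (rule that[of C' s1])
    fix s assume s: "s \<ge> s1"
    obtain n where "s / s1 < l ^ n" using real_arch_pow[OF pos(2)] by auto
    then have "s \<le> s1 * l ^ n" using s1(5) by (simp add: field_simps)
    moreover have "s1 / l \<le> s1" using s1(5) pos(2) by (simp add: divide_le_eq)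
    ultimately show "G s \<le> C' * F (c * s)" using ind[of n] s by auto
  qed (use C' s1 in auto)
qed

context selfsimilar_additive_process
begin

text \<open>For any d > 0, the O-regular variation of F absorbs the factors c1 * d and c2 / d into
  constants. So a finite integral gives convergent series for all d, and a single convergent series
  makes the integral finite. The bound \<open>bd\<close> is needed on the range of g only, that is
  above g 0.\<close>

proposition limsup_criterion:
  assumes g: "g \<in> class_G1" and F: "F \<in> class_OR" and b: "b > 1"
    and up: "C1 > 0" "c1 > 0" "\<And>r. r \<ge> r1 \<Longrightarrow> incr_tail b r \<le> C1 * F (c1 * r)"
    and lo: "C2 > 0" "c2 > 0" "\<And>r. r \<ge> r2 \<Longrightarrow> F r \<le> C2 * incr_tail b (c2 * r)"
    and bd: "\<And>r. r \<ge> g 0 \<Longrightarrow> F r \<le> B"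
  shows "((\<integral>\<^sup>+x\<in>{0..}. ennreal (F (g x)) \<partial>lborel) < \<infinity> \<longrightarrow>
           (AE \<omega> in M. Limsup at_top (\<lambda>t. ereal (norm (X t \<omega>) / (t powr H * g (ln t)))) = 0)) \<and>
         ((\<integral>\<^sup>+x\<in>{0..}. ennreal (F (g x)) \<partial>lborel) = \<infinity> \<longrightarrow>
           (AE \<omega> in M. Limsup at_top (\<lambda>t. ereal (norm (X t \<omega>) / (t powr H * g (ln t)))) = \<infinity>))"
proof (intro conjI impI)
  note g' = class_G1_D[OF g]
  have \<beta>: "ln b > 0" using b by simp
  have anti: "incr_tail b (c * g y) \<le> incr_tail b (c * g x)" if "c > 0" "0 \<le> x" "x \<le> y" for c x y
    using that g'(2) b by (intro incr_tail_antimono mult_left_mono) auto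
  {
    assume fin: "(\<integral>\<^sup>+x\<in>{0..}. ennreal (F (g x)) \<partial>lborel) < \<infinity>"
    show "AE \<omega> in M. Limsup at_top (\<lambda>t. ereal (norm (X t \<omega>) / (t powr H * g (ln t)))) = 0"
    proof (rule limsup_zero[OF g b])
      fix d :: real assume d: "d > 0"
      obtain D x0 where D: "D > 0" "x0 > 0" "\<And>x. x \<ge> x0 \<Longrightarrow> F (c1 * d * x) \<le> D * F x"
        using class_OR_bound[OF F, of "c1 * d"] up(2) d by auto
      have "\<forall>\<^sub>F x in at_top. g x \<ge> max x0 (r1 / d)"
        using g'(3) by (simp only: filterlim_at_top)
      then obtain x1 where x1: "\<And>x. x \<ge> x1 \<Longrightarrow> g x \<ge> max x0 (r1 / d)"
        by (auto simp: eventually_at_top_linorder)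
      have le: "incr_tail b (d * g x) / (C1 * D) \<le> F (g x)" if "x \<ge> x1" for x
      proof -
        have gx: "g x \<ge> x0" "g x \<ge> r1 / d" using x1[OF that] by auto
        then have "d * g x \<ge> r1" using d by (simp add: field_simps)
        then have "incr_tail b (d * g x) \<le> C1 * F (c1 * (d * g x))" by (rule up(3))
        also have "\<dots> \<le> C1 * (D * F (g x))"
          using D(3)[OF gx(1)] up(1) by (intro mult_left_mono) (auto simp: mult.assoc)
        finally have "incr_tail b (d * g x) \<le> F (g x) * (C1 * D)" by (simp add: mult_ac)
        then show ?thesis using up(1) D(1) by (subst pos_divide_le_eq) auto
      qed
      have "summable (\<lambda>n. incr_tail b (d * g (real n * ln b)) / (C1 * D))"
      proof (rule summable_of_nn_integral[where \<phi> = "\<lambda>x. incr_tail b (d * g x) / (C1 * D)", OF \<beta> _ _ le fin])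
        show "incr_tail b (d * g y) / (C1 * D) \<le> incr_tail b (d * g x) / (C1 * D)" if "0 \<le> x" "x \<le> y" for x y
          using anti[OF d that] up(1) D(1) by (intro divide_right_mono) auto
        show "incr_tail b (d * g x) / (C1 * D) \<ge> 0" for x
          using incr_tail_nonneg up(1) D(1) by (intro divide_nonneg_nonneg) auto
      qed
      then show "summable (\<lambda>n. incr_tail b (d * g (real n * ln b)))"
        using up(1) D(1) by (simp add: summable_divide_iff)
    qed
  next
    assume inf: "(\<integral>\<^sup>+x\<in>{0..}. ennreal (F (g x)) \<partial>lborel) = \<infinity>"
    show "AE \<omega> in M. Limsup at_top (\<lambda>t. ereal (norm (X t \<omega>) / (t powr H * g (ln t)))) = \<infinity>"
    proof (rule limsup_infinity[OF g b], rule notI)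
      fix d :: real assume d: "d > 0"
      assume sum: "summable (\<lambda>n. incr_tail b (d * g (real n * ln b)))"
      obtain D x0 where D: "D > 0" "x0 > 0" "\<And>x. x \<ge> x0 \<Longrightarrow> F (c2 / d * x) \<le> D * F x"
        using class_OR_bound[OF F, of "c2 / d"] lo(2) d by auto
      have "\<forall>\<^sub>F x in at_top. g x \<ge> max (x0 * c2 / d) (r2 * c2 / d)"
        using g'(3) by (simp only: filterlim_at_top)
      then obtain x1 where x1: "\<And>x. x \<ge> x1 \<Longrightarrow> g x \<ge> max (x0 * c2 / d) (r2 * c2 / d)"
        by (auto simp: eventually_at_top_linorder)
      have le: "F (g x) \<le> D * C2 * incr_tail b (d * g x)" if "x \<ge> x1" for x
      proof -
        have gx: "g x \<ge> x0 * c2 / d" "g x \<ge> r2 * c2 / d" using x1[OF that] by auto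
        then have y: "d / c2 * g x \<ge> x0" "d / c2 * g x \<ge> r2" using d lo(2) by (simp_all add: field_simps)
        have "F (g x) = F (c2 / d * (d / c2 * g x))" using d lo(2) by simp
        also have "\<dots> \<le> D * F (d / c2 * g x)" by (rule D(3)[OF y(1)])
        also have "\<dots> \<le> D * (C2 * incr_tail b (c2 * (d / c2 * g x)))"
          using lo(3)[OF y(2)] D(1) by (intro mult_left_mono) auto
        finally show ?thesis using lo(2) by (simp add: mult.assoc)
      qed
      have "(\<integral>\<^sup>+x\<in>{0..}. ennreal (F (g x)) \<partial>lborel) < \<infinity>"
      proof (rule nn_integral_of_summable[where \<phi> = "\<lambda>x. D * C2 * incr_tail b (d * g x)", OF \<beta> _ _ le])
        show "D * C2 * incr_tail b (d * g y) \<le> D * C2 * incr_tail b (d * g x)" if "0 \<le> x" "x \<le> y" for x y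
          using anti[OF d that] lo(1) D(1) by (intro mult_left_mono) auto
        show "D * C2 * incr_tail b (d * g x) \<ge> 0" for x
          using incr_tail_nonneg lo(1) D(1) by (intro mult_nonneg_nonneg) auto
        show "F (g x) \<le> B" if "x \<ge> 0" for x using g'(2)[of 0 x] that by (intro bd) simp
        show "summable (\<lambda>n. D * C2 * incr_tail b (d * g (real n * ln b)))"
          by (intro summable_mult sum)
      qed
      with inf show False by simp
    qed
  }
qed

lemma increment_tail_eq: "increment_tail M X = incr_tail (exp 1)"
  by (simp add: fun_eq_iff increment_tail_def incr_tail_def exp_minus inverse_eq_divide)

section \<open>Increments and shell probabilities\<close>

lemma indep_var_increment:
  assumes "0 < s" "s < t"
  shows "indep_var borel (\<lambda>\<omega>. X s \<omega> - X 0 \<omega>) borel (\<lambda>\<omega>. X t \<omega> - X s \<omega>)"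
proof -
  define \<tau> :: "nat \<Rightarrow> real" where "\<tau> k = (if k = 0 then 0 else if k = 1 then s else t)" for k
  have "0 \<le> \<tau> 0" by (simp add: \<tau>_def)
  moreover have "strict_mono_on {..2} \<tau>"
    using assms by (auto simp: strict_mono_on_def \<tau>_def)
  ultimately have ind: "indep_vars (\<lambda>_. borel) (\<lambda>i \<omega>. X (\<tau> (Suc i)) \<omega> - X (\<tau> i) \<omega>) {..<2}"
    by (rule independent_increments[of \<tau> 2])
  have "indep_var borel ((\<lambda>x. x 0) \<circ> (\<lambda>\<omega>. \<lambda>i\<in>{0}. X (\<tau> (Suc i)) \<omega> - X (\<tau> i) \<omega>))
      borel ((\<lambda>x. x 1) \<circ> (\<lambda>\<omega>. \<lambda>i\<in>{1}. X (\<tau> (Suc i)) \<omega> - X (\<tau> i) \<omega>))"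
    by (intro indep_var_compose[OF indep_var_restrict[OF ind]] measurable_component_singleton) auto
  then show ?thesis by (simp add: comp_def \<tau>_def)
qed

text \<open>Since X 0 = 0 almost surely, X s is itself an increment, and independence of increments
  applies to it.\<close>

lemma prob_X_increment:
  assumes "0 < s" "s < t" "Measurable.pred borel P" "Measurable.pred borel Q"
  shows "\<P>(\<omega> in M. P (X s \<omega>) \<and> Q (X t \<omega> - X s \<omega>)) =
    \<P>(\<omega> in M. P (X s \<omega>)) * \<P>(\<omega> in M. Q (X t \<omega> - X s \<omega>))"
proof -
  have [measurable]: "X s \<in> borel_measurable M" "X t \<in> borel_measurable M" "X 0 \<in> borel_measurable M"
    using assms by (auto intro: random_variable)
  note [measurable] = assms(3,4)
  have "\<P>(\<omega> in M. P (X s \<omega>) \<and> Q (X t \<omega> - X s \<omega>)) =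
      \<P>(\<omega> in M. P (X s \<omega> - X 0 \<omega>) \<and> Q (X t \<omega> - X s \<omega>))"
    using AE_X_0 by (intro finite_measure_eq_AE) (auto elim!: eventually_mono)
  also have "\<dots> = prob ((\<lambda>\<omega>. (X s \<omega> - X 0 \<omega>, X t \<omega> - X s \<omega>)) -` ({x. P x} \<times> {x. Q x}) \<inter> space M)"
    by (intro arg_cong[where f=prob]) auto
  also have "\<dots> = prob ((\<lambda>\<omega>. X s \<omega> - X 0 \<omega>) -` {x. P x} \<inter> space M) *
      prob ((\<lambda>\<omega>. X t \<omega> - X s \<omega>) -` {x. Q x} \<inter> space M)"
    using assms by (intro indep_varD[OF indep_var_increment]) auto
  also have "prob ((\<lambda>\<omega>. X s \<omega> - X 0 \<omega>) -` {x. P x} \<inter> space M) = \<P>(\<omega> in M. P (X s \<omega>))"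
    using AE_X_0 by (intro finite_measure_eq_AE) (auto elim!: eventually_mono)
  also have "prob ((\<lambda>\<omega>. X t \<omega> - X s \<omega>) -` {x. Q x} \<inter> space M) = \<P>(\<omega> in M. Q (X t \<omega> - X s \<omega>))"
    by (intro arg_cong[where f=prob]) auto
  finally show ?thesis .
qed

lemma shell_prob_eq: "r > 0 \<Longrightarrow> shell_prob M H X r = tail r - tail (exp (3 * H) * r)"
proof -
  assume r: "r > 0"
  have le: "r \<le> exp (3 * H) * r" using r H_pos by simp
  have "{\<omega> \<in> space M. r < norm (X 1 \<omega>) \<and> norm (X 1 \<omega>) \<le> exp (3 * H) * r} =
      {\<omega> \<in> space M. r < norm (X 1 \<omega>)} - {\<omega> \<in> space M. exp (3 * H) * r < norm (X 1 \<omega>)}"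
    by auto
  then show ?thesis unfolding shell_prob_def tail_def
    using le by (simp add: finite_measure_Diff subset_iff)
qed

lemma powr_exp: "exp a powr H = exp (a * H)"
  by (simp add: powr_def)

text \<open>The block ratio \<open>exp 4\<close> exceeds the shell ratio \<open>exp 3\<close>, which leaves room for the error terms.\<close>

lemma shell_prob_le:
  assumes "r > 0"
  shows "shell_prob M H X r \<le> incr_tail (exp 4) ((1 - exp (- H)) * r)"
proof -
  let ?s = "1 / exp 4 :: real"
  have [measurable]: "X ?s \<in> borel_measurable M" by (intro random_variable) simp
  have s: "?s powr H = exp (- 4 * H)" by (simp add: powr_divide powr_exp exp_minus field_simps)
  \<comment> \<open>The share exp (- H) * r is exceeded by the value at time exp (- 4) with
    probability \<open>tail (exp (3 * H) * r)\<close>, exactly the term that the shell probability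
    subtracts from \<open>tail r\<close>.\<close>
  have "tail r \<le> prob ({\<omega> \<in> space M. norm (X ?s \<omega>) > exp (- H) * r} \<union>
      {\<omega> \<in> space M. norm (X 1 \<omega> - X ?s \<omega>) > (1 - exp (- H)) * r})"
    unfolding tail_def
  proof (intro finite_measure_mono subsetI)
    fix \<omega> assume "\<omega> \<in> {\<omega> \<in> space M. norm (X 1 \<omega>) > r}"
    moreover have "norm (X 1 \<omega>) \<le> norm (X ?s \<omega>) + norm (X 1 \<omega> - X ?s \<omega>)"
      using norm_triangle_ineq[of "X ?s \<omega>" "X 1 \<omega> - X ?s \<omega>"] by simp
    moreover have "exp (- H) * r + (1 - exp (- H)) * r = r" by (simp add: algebra_simps)
    ultimately have "\<omega> \<in> space M"
      "\<not> norm (X ?s \<omega>) > exp (- H) * r \<Longrightarrow> norm (X 1 \<omega> - X ?s \<omega>) > (1 - exp (- H)) * r"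
      by (simp, simp only: mem_Collect_eq not_less, linarith)
    then show "\<omega> \<in> {\<omega> \<in> space M. norm (X ?s \<omega>) > exp (- H) * r} \<union>
      {\<omega> \<in> space M. norm (X 1 \<omega> - X ?s \<omega>) > (1 - exp (- H)) * r}"
      by blast
  qed measurable
  also have "\<dots> \<le> \<P>(\<omega> in M. norm (X ?s \<omega>) > exp (- H) * r) + incr_tail (exp 4) ((1 - exp (- H)) * r)"
    unfolding incr_tail_def by (intro measure_Un_le) measurable
  also have "\<P>(\<omega> in M. norm (X ?s \<omega>) > exp (- H) * r) = tail (exp (- H) * r / ?s powr H)"
    by (intro prob_norm_gt) simp
  also have "exp (- H) * r / ?s powr H = exp (3 * H) * r"
    unfolding s by (simp add: exp_minus field_simps flip: exp_add)
  finally show ?thesis using shell_prob_eq[OF assms] by simp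
qed

text \<open>Two disjoint events force the norm of X 1 above r: exactly one of X (exp (- 4)) and the
  complementary increment exceeds exp H * r, while the other is at most (exp H - 1) * r. By
  independence their probabilities are products with factors close to 1. The first has main term
  \<open>tail (exp (5 * H) * r)\<close>, which is at least \<open>tail (exp (6 * H) * r)\<close>, so
  subtracting it from \<open>tail r\<close> leaves at most two adjacent shells.\<close>

lemma incr_tail_le_shell_prob:
  assumes "r > 0" "tail (exp (4 * H) * ((exp H - 1) * r)) \<le> 1 / 2"
  shows "incr_tail (exp 4) (exp H * r) \<le> 2 * (shell_prob M H X r + shell_prob M H X (exp (3 * H) * r)) +
    2 * tail r * incr_tail (exp 4) ((exp H - 1) * r)"
proof -
  let ?s = "1 / exp 4 :: real" and ?e = "(exp H - 1) * r"
  have e: "exp H * r - ?e = r" by (simp add: algebra_simps)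
  have "exp H > 1" using H_pos by simp
  have e0: "?e > 0" "r \<le> exp H * r" "?e \<le> exp H * r" using assms(1) \<open>exp H > 1\<close> by auto
  have [measurable]: "X ?s \<in> borel_measurable M" by (intro random_variable) simp
  have s: "?s powr H = exp (- 4 * H)" by (simp add: powr_divide powr_exp exp_minus field_simps)
  have tl: "\<P>(\<omega> in M. norm (X ?s \<omega>) > x) = tail (exp (4 * H) * x)" for x
    using prob_norm_gt[of ?s x] s by (simp add: exp_minus field_simps)
  let ?A = "{\<omega> \<in> space M. norm (X ?s \<omega>) > exp H * r \<and> \<not> norm (X 1 \<omega> - X ?s \<omega>) > ?e}"
  let ?B = "{\<omega> \<in> space M. \<not> norm (X ?s \<omega>) > ?e \<and> norm (X 1 \<omega> - X ?s \<omega>) > exp H * r}"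
  have compl: "\<P>(\<omega> in M. \<not> norm (Y \<omega>) > x) = 1 - \<P>(\<omega> in M. norm (Y \<omega>) > x)"
    if [measurable]: "Y \<in> borel_measurable M" for Y :: "'w \<Rightarrow> real ^ 'n" and x
    by (rule prob_neg) measurable
  have "prob ?A = \<P>(\<omega> in M. norm (X ?s \<omega>) > exp H * r) * \<P>(\<omega> in M. \<not> norm (X 1 \<omega> - X ?s \<omega>) > ?e)"
    by (intro prob_X_increment[where P = "\<lambda>x. norm x > exp H * r" and Q = "\<lambda>x. \<not> norm x > ?e"]) (simp_all add: one_less_exp_iff)
  also have "\<P>(\<omega> in M. \<not> norm (X 1 \<omega> - X ?s \<omega>) > ?e) = 1 - incr_tail (exp 4) ?e"
    unfolding incr_tail_def by (rule compl) measurable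
  also have "\<P>(\<omega> in M. norm (X ?s \<omega>) > exp H * r) = tail (exp (4 * H) * (exp H * r))" by (rule tl)
  finally have A: "prob ?A = tail (exp (4 * H) * (exp H * r)) * (1 - incr_tail (exp 4) ?e)" .
  have "prob ?B = \<P>(\<omega> in M. \<not> norm (X ?s \<omega>) > ?e) * \<P>(\<omega> in M. norm (X 1 \<omega> - X ?s \<omega>) > exp H * r)"
    by (intro prob_X_increment[where P = "\<lambda>x. \<not> norm x > ?e" and Q = "\<lambda>x. norm x > exp H * r"]) (simp_all add: one_less_exp_iff)
  also have "\<P>(\<omega> in M. \<not> norm (X ?s \<omega>) > ?e) = 1 - tail (exp (4 * H) * ?e)"
    unfolding tl[symmetric] by (rule compl) measurable
  also have "\<P>(\<omega> in M. norm (X 1 \<omega> - X ?s \<omega>) > exp H * r) = incr_tail (exp 4) (exp H * r)"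
    by (simp add: incr_tail_def)
  finally have B: "prob ?B = (1 - tail (exp (4 * H) * ?e)) * incr_tail (exp 4) (exp H * r)" .
  have "prob ?A + prob ?B = prob (?A \<union> ?B)"
    using e0(3) by (intro finite_measure_Union[symmetric]) (measurable, auto)
  also have "\<dots> \<le> tail r"
    unfolding tail_def
  proof (intro finite_measure_mono subsetI)
    fix \<omega> assume w: "\<omega> \<in> ?A \<union> ?B"
    have "norm (X ?s \<omega>) \<le> norm (X 1 \<omega>) + norm (X 1 \<omega> - X ?s \<omega>)"
      "norm (X 1 \<omega> - X ?s \<omega>) \<le> norm (X 1 \<omega>) + norm (X ?s \<omega>)"
      using norm_triangle_ineq4[of "X 1 \<omega>" "X 1 \<omega> - X ?s \<omega>"] norm_triangle_ineq4[of "X 1 \<omega>" "X ?s \<omega>"] by simp_all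
    with w e show "\<omega> \<in> {\<omega> \<in> space M. norm (X 1 \<omega>) > r}"
      by (simp only: Un_iff mem_Collect_eq) linarith
  qed measurable
  finally have main: "tail (exp (4 * H) * (exp H * r)) * (1 - incr_tail (exp 4) ?e) +
      (1 - tail (exp (4 * H) * ?e)) * incr_tail (exp 4) (exp H * r) \<le> tail r"
    by (simp only: A B)
  have "1 / 2 * incr_tail (exp 4) (exp H * r) \<le> (1 - tail (exp (4 * H) * ?e)) * incr_tail (exp 4) (exp H * r)"
    using assms(2) incr_tail_nonneg by (intro mult_right_mono) auto
  moreover have "tail (exp (4 * H) * (exp H * r)) \<ge> tail (exp (3 * H) * (exp (3 * H) * r))"
    using assms(1) H_pos by (intro tail_antimono) (simp flip: mult.assoc exp_add)
  moreover have "tail (exp (4 * H) * (exp H * r)) * incr_tail (exp 4) ?e \<le> tail r * incr_tail (exp 4) ?e"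
  proof -
    have "1 * r \<le> exp (4 * H + H) * r" using assms(1) H_pos by (intro mult_right_mono) auto
    then have "r \<le> exp (4 * H) * (exp H * r)" by (simp only: exp_add mult.assoc mult_1)
    then show ?thesis using incr_tail_nonneg by (intro mult_right_mono tail_antimono) auto
  qed
  moreover have "shell_prob M H X r = tail r - tail (exp (3 * H) * r)"
    "shell_prob M H X (exp (3 * H) * r) = tail (exp (3 * H) * r) - tail (exp (3 * H) * (exp (3 * H) * r))"
    using shell_prob_eq[of r] shell_prob_eq[of "exp (3 * H) * r"] assms(1) by simp_all
  ultimately show ?thesis using main by (simp add: algebra_simps)
qed

text \<open>This is the local hypothesis of \<open>recursive_bound\<close>, not obvious because
  shell probabilities are not monotone. For u \<le> x \<le> q * u the shell at q * u is covered by
  those at x and q * x, and the latter has at most B times the mass of the former; iteration reaches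
  any compact interval.\<close>

lemma shell_prob_locally_bounded_below:
  assumes F: "shell_prob M H X \<in> class_OR"
  shows "\<exists>y0. \<forall>u\<ge>y0. \<forall>v. \<exists>m>0. \<forall>x\<in>{u..v}. m \<le> shell_prob M H X x"
proof -
  let ?L = "shell_prob M H X" and ?q = "exp (3 * H)"
  have q: "?q > 1" using H_pos by simp
  obtain B x0 where B: "B > 0" "x0 > 0" "\<And>x. x \<ge> x0 \<Longrightarrow> ?L (?q * x) \<le> B * ?L x"
    using class_OR_bound[OF F, of ?q] by auto
  have one: "?L (?q * u) / (1 + B) \<le> ?L x" if u: "u \<ge> x0" "u \<le> x" "x \<le> ?q * u" for u x
  proof -
    have pos: "u > 0" "x > 0" "?q * u > 0" "?q * x > 0" using u B(2) by auto
    have "tail (?q * u) \<le> tail x" using u by (intro tail_antimono)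
    moreover have "tail (?q * (?q * x)) \<le> tail (?q * (?q * u))" using u by (intro tail_antimono mult_left_mono) auto
    ultimately have "?L (?q * u) \<le> ?L x + ?L (?q * x)"
      using shell_prob_eq[OF pos(2)] shell_prob_eq[OF pos(3)] shell_prob_eq[OF pos(4)] by linarith
    also have "\<dots> \<le> ?L x * (1 + B)" using B(3)[of x] u by (simp add: algebra_simps)
    finally show ?thesis using B(1) by (subst pos_divide_le_eq) auto
  qed
  have "\<exists>m>0. \<forall>x\<in>{u..u * ?q ^ n}. m \<le> ?L x" if u: "u \<ge> x0" for u n
  proof (induction n)
    case 0
    have "?L u > 0" using class_OR_pos[OF F] u B(2) by simp
    then show ?case by (intro exI[of _ "?L u"]) auto
  next
    case (Suc n)
    then obtain m where m: "m > 0" "\<And>x. x \<in> {u..u * ?q ^ n} \<Longrightarrow> m \<le> ?L x" by blast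
    let ?w = "u * ?q ^ n"
    have "u * 1 \<le> ?w" using u B(2) q by (intro mult_left_mono one_le_power) auto
    then have w: "?w \<ge> x0" "?w > 0" using u B(2) by linarith+
    have "?L (?q * ?w) > 0" using w(2) class_OR_pos[OF F] by simp
    then have "min m (?L (?q * ?w) / (1 + B)) > 0" using m(1) B(1) by simp
    moreover have "min m (?L (?q * ?w) / (1 + B)) \<le> ?L x" if x: "x \<in> {u..u * ?q ^ Suc n}" for x
    proof (cases "x \<le> ?w")
      case True
      then have "m \<le> ?L x" using x by (intro m(2)) auto
      then show ?thesis by (rule min.coboundedI1)
    next
      case False
      then have "?L (?q * ?w) / (1 + B) \<le> ?L x" using x by (intro one[OF w(1)]) (auto simp: mult_ac)
      then show ?thesis by (rule min.coboundedI2)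
    qed
    ultimately show ?case by blast
  qed
  note steps = this
  show ?thesis
  proof (rule exI[of _ x0], intro allI impI)
    fix u v assume u: "u \<ge> x0"
    obtain n where n: "v / u < ?q ^ n" using real_arch_pow[OF q] by auto
    have "u > 0" using u B(2) by simp
    then have "v \<le> u * ?q ^ n" using n by (simp add: field_simps)
    then have "{u..v} \<subseteq> {u..u * ?q ^ n}" by auto
    with steps[OF u, of n] show "\<exists>m>0. \<forall>x\<in>{u..v}. m \<le> ?L x" by blast
  qed
qed

lemma incr_tail_bound_shell_prob:
  assumes F: "shell_prob M H X \<in> class_OR"
  obtains C1 c1 r1 where "C1 > 0" "c1 > 0" "\<And>r. r \<ge> r1 \<Longrightarrow> incr_tail (exp 4) r \<le> C1 * shell_prob M H X (c1 * r)"
proof -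
  let ?L = "shell_prob M H X" and ?q = "exp (3 * H)" and ?G = "incr_tail (exp 4)"
  have eH: "exp H > 1" using H_pos by simp
  obtain B x0 where B: "B > 0" "x0 > 0" "\<And>x. x \<ge> x0 \<Longrightarrow> ?L (?q * x) \<le> B * ?L x"
    using class_OR_bound[OF F, of ?q] by auto
  obtain y0 where y0: "\<And>u v. u \<ge> y0 \<Longrightarrow> \<exists>m>0. \<forall>x\<in>{u..v}. m \<le> ?L x"
    using shell_prob_locally_bounded_below[OF F] by blast
  obtain t0 where t0: "t0 > 0" "\<And>r. r \<ge> t0 \<Longrightarrow> tail r \<le> 1 / 2" using tail_eventually_le[of "1 / 2"] by auto
  \<comment> \<open>k scales the argument of the \<open>tail\<close> condition in
    \<open>incr_tail_le_shell_prob\<close>; l below is the quotient of its two levels exp H * r and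
    (exp H - 1) * r.\<close>
  define k where "k = exp (4 * H) * (exp H - 1)"
  have k: "k > 0" using eH by (simp add: k_def)
  define l where "l = exp H / (exp H - 1)"
  have l: "l > 1" using eH by (simp add: l_def field_simps)
  have rec: "?G s \<le> 2 * (1 + B) * ?L (exp (- H) * s) + 2 * tail (exp (- H) * s) * ?G (s / l)"
    if s: "s \<ge> exp H * max x0 (t0 / k)" for s
  proof -
    define r where "r = exp (- H) * s"
    have sr: "s = exp H * r" by (simp add: r_def exp_minus)
    have r: "r \<ge> x0" "r \<ge> t0 / k" using s by (simp_all add: sr)
    have "r > 0" using r(1) B(2) by simp
    moreover have "tail (exp (4 * H) * ((exp H - 1) * r)) \<le> 1 / 2"
      using t0(2)[of "k * r"] r(2) k by (simp add: k_def field_simps)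
    ultimately have "?G (exp H * r) \<le> 2 * (?L r + ?L (?q * r)) + 2 * tail r * ?G ((exp H - 1) * r)"
      by (rule incr_tail_le_shell_prob)
    also have "?L (?q * r) \<le> B * ?L r" by (rule B(3)[OF r(1)])
    also have "(exp H - 1) * r = s / l" using eH by (simp add: sr l_def)
    finally have "?G (exp H * r) \<le> 2 * (1 + B) * ?L r + 2 * tail r * ?G (s / l)"
      by (simp add: algebra_simps)
    then show ?thesis unfolding sr[symmetric] unfolding r_def .
  qed
  have "filterlim (\<lambda>s. exp (- H) * s) at_top at_top" by real_asymp
  from filterlim_compose[OF tail_tendsto_0 this]
  have "((\<lambda>s. 2 * tail (exp (- H) * s)) \<longlongrightarrow> 2 * 0) at_top" by (intro tendsto_mult tendsto_const)
  then have eta: "((\<lambda>s. 2 * tail (exp (- H) * s)) \<longlongrightarrow> 0) at_top" by simp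
  obtain C' s1 where "C' > 0" "s1 > 0" "\<And>s. s \<ge> s1 \<Longrightarrow> ?G s \<le> C' * ?L (exp (- H) * s)"
  proof (rule recursive_bound[OF F _ l _ incr_tail_le_1 incr_tail_nonneg _ eta rec y0])
    show "2 * tail (exp (- H) * s) \<ge> 0" for s by (simp add: tail_def)
  qed (use B(1) in auto)
  then show thesis using that[of C' "exp (- H)" s1] by auto
qed

end

section \<open>Fourier representation of truncated mass\<close>

text \<open>The bound separates t from y: the first factor is integrable against the kernel, the
  second against a Levy measure.\<close>

lemma one_minus_cos_le: "1 - cos (t * y) \<le> 2 * (1 + t\<^sup>2) * min 1 (y\<^sup>2)" for t y :: real
proof -
  have "1 - cos (t * y) = 2 * (sin (t * y / 2))\<^sup>2"
    using cos_double_sin[of "t * y / 2"] by simp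
  moreover have "(sin (t * y / 2))\<^sup>2 \<le> (t * y / 2)\<^sup>2"
    using abs_sin_x_le_abs_x[of "t * y / 2"] unfolding abs_le_square_iff[symmetric] .
  moreover have "(sin (t * y / 2))\<^sup>2 \<le> 1" by (simp add: abs_square_le_1)
  ultimately have *: "1 - cos (t * y) \<le> 2" "1 - cos (t * y) \<le> t\<^sup>2 * y\<^sup>2 / 2"
    by (simp_all add: power_mult_distrib power_divide)
  show ?thesis
  proof (cases "y\<^sup>2 \<le> 1")
    case True
    have "t\<^sup>2 * y\<^sup>2 / 2 \<le> 2 * (1 + t\<^sup>2) * y\<^sup>2" by (simp add: algebra_simps)
    with * True show ?thesis by (simp add: min_absorb2)
  next
    case False
    then have "2 * (1 + t\<^sup>2) * min 1 (y\<^sup>2) = 2 + 2 * t\<^sup>2" by simp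
    with *(1) zero_le_power2[of t] show ?thesis by linarith
  qed
qed

lemma integrable_cutoff_kernel_quadratic: "integrable lborel (\<lambda>t. (1 + t\<^sup>2) * \<bar>cutoff_kernel t\<bar>)"
proof -
  have "integrable lborel (\<lambda>t. t\<^sup>2 * cutoff_kernel t)"
    using cutoff_kernel_second_moment by (simp add: has_bochner_integral_iff)
  from integrable_abs[OF this] integrable_abs[OF integrable_cutoff_kernel]
  have "integrable lborel (\<lambda>t. \<bar>cutoff_kernel t\<bar> + t\<^sup>2 * \<bar>cutoff_kernel t\<bar>)"
    by (intro Bochner_Integration.integrable_add) (simp_all add: abs_mult)
  then show ?thesis by (simp add: algebra_simps)
qed

text \<open>The defining integral of \<open>cutoff\<close> is integrated over N. It is used both for
  a Levy measure and for the product of the probability space with itself, so that the two sides of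
  the later limit have the same Fourier form.\<close>

lemma cutoff_fubini:
  fixes y :: "'a \<Rightarrow> real"
  assumes "sigma_finite_measure N" and [measurable]: "y \<in> borel_measurable N"
    and int: "integrable N (\<lambda>x. min 1 ((y x)\<^sup>2))"
  shows "integrable N (\<lambda>x. cutoff (y x))"
    and "integrable lborel (\<lambda>t. cutoff_kernel t * (\<integral>x. 1 - cos (t * y x) \<partial>N))"
    and "(\<integral>x. cutoff (y x) \<partial>N) = (\<integral>t. cutoff_kernel t * (\<integral>x. 1 - cos (t * y x) \<partial>N) \<partial>lborel)"
proof -
  interpret N: sigma_finite_measure N by fact
  interpret pair_sigma_finite N lborel ..
  let ?h = "\<lambda>x t. (1 - cos (y x * t)) * cutoff_kernel t"
  define C where "C = (\<integral>t. (1 + t\<^sup>2) * \<bar>cutoff_kernel t\<bar> \<partial>lborel)"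
  have bound: "norm (?h x t) \<le> 2 * min 1 ((y x)\<^sup>2) * ((1 + t\<^sup>2) * \<bar>cutoff_kernel t\<bar>)" for x t
  proof -
    have "norm (?h x t) = (1 - cos (t * y x)) * \<bar>cutoff_kernel t\<bar>"
      by (simp add: abs_mult mult.commute)
    also have "\<dots> \<le> 2 * (1 + t\<^sup>2) * min 1 ((y x)\<^sup>2) * \<bar>cutoff_kernel t\<bar>"
      by (intro mult_right_mono one_minus_cos_le) simp
    finally show ?thesis by (simp only: mult_ac)
  qed
  have inth: "integrable lborel (\<lambda>t. ?h x t)" for x
  proof (rule Bochner_Integration.integrable_bound)
    show "integrable lborel (\<lambda>t. 2 * min 1 ((y x)\<^sup>2) * ((1 + t\<^sup>2) * \<bar>cutoff_kernel t\<bar>))"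
      by (intro integrable_mult_right integrable_cutoff_kernel_quadratic)
    show "AE t in lborel. norm (?h x t) \<le> norm (2 * min 1 ((y x)\<^sup>2) * ((1 + t\<^sup>2) * \<bar>cutoff_kernel t\<bar>))"
      using bound by (intro AE_I2) (auto intro: order_trans)
  qed measurable
  have I: "integrable (N \<Otimes>\<^sub>M lborel) (\<lambda>(x, t). ?h x t)"
  proof (rule Fubini_integrable)
    show "AE x in N. integrable lborel (\<lambda>t. case (x, t) of (x, t) \<Rightarrow> ?h x t)"
      using inth by simp
    have "integrable N (\<lambda>x. \<integral>t. norm (?h x t) \<partial>lborel)"
    proof (rule Bochner_Integration.integrable_bound)
      show "integrable N (\<lambda>x. 2 * C * min 1 ((y x)\<^sup>2))" by (intro integrable_mult_right int)
      show "AE x in N. norm (\<integral>t. norm (?h x t) \<partial>lborel) \<le> norm (2 * C * min 1 ((y x)\<^sup>2))"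
      proof (rule AE_I2)
        fix x
        have "(\<integral>t. norm (?h x t) \<partial>lborel) \<le> (\<integral>t. 2 * min 1 ((y x)\<^sup>2) * ((1 + t\<^sup>2) * \<bar>cutoff_kernel t\<bar>) \<partial>lborel)"
          using bound integrable_norm[OF inth[of x]]
          by (intro integral_mono integrable_mult_right integrable_cutoff_kernel_quadratic) auto
        also have "\<dots> = 2 * C * min 1 ((y x)\<^sup>2)" by (simp add: C_def)
        finally have "(\<integral>t. norm (?h x t) \<partial>lborel) \<le> 2 * C * min 1 ((y x)\<^sup>2)" .
        moreover have "(\<integral>t. norm (?h x t) \<partial>lborel) \<ge> 0" by simp
        ultimately show "norm (\<integral>t. norm (?h x t) \<partial>lborel) \<le> norm (2 * C * min 1 ((y x)\<^sup>2))"
          by (simp only: real_norm_def[of "integral\<^sup>L _ _"] real_norm_def[of "2 * _ * _"] abs_of_nonneg)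
      qed
    qed measurable
    then show "integrable N (\<lambda>x. \<integral>t. norm (case (x, t) of (x, t) \<Rightarrow> ?h x t) \<partial>lborel)" by simp
  qed measurable
  have eq: "(\<integral>x. ?h x t \<partial>N) = cutoff_kernel t * (\<integral>x. 1 - cos (t * y x) \<partial>N)" for t
    by (simp add: mult.commute)
  show "integrable N (\<lambda>x. cutoff (y x))"
    using integrable_fst[OF I] by (simp add: cutoff_def)
  show "integrable lborel (\<lambda>t. cutoff_kernel t * (\<integral>x. 1 - cos (t * y x) \<partial>N))"
    using integrable_snd[OF I] by (simp only: eq prod.case)
  have "(\<integral>x. cutoff (y x) \<partial>N) = (\<integral>x. (\<integral>t. ?h x t \<partial>lborel) \<partial>N)" by (simp add: cutoff_def)
  also have "\<dots> = (\<integral>t. (\<integral>x. ?h x t \<partial>N) \<partial>lborel)" by (rule Fubini_integral[OF I, symmetric])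
  finally show "(\<integral>x. cutoff (y x) \<partial>N) = (\<integral>t. cutoff_kernel t * (\<integral>x. 1 - cos (t * y x) \<partial>N) \<partial>lborel)"
    by (simp only: eq)
qed

text \<open>The ratio 10 is at least the ratio 5 of the end points of the transition zone of \<open>cutoff\<close>, which
  makes the difference nonnegative.\<close>

lemma cutoff_difference:
  "cutoff y - cutoff (y / 10) \<le> indicator {1..50} \<bar>y\<bar>"
  "indicator {5..10} \<bar>y\<bar> \<le> cutoff y - cutoff (y / 10)"
proof -
  have "cutoff y \<ge> 0" "cutoff y \<le> 1" "cutoff (y / 10) \<ge> 0" "cutoff (y / 10) \<le> 1"
    by (rule cutoff_nonneg cutoff_le_1)+
  moreover have "\<bar>y\<bar> \<le> 1 \<Longrightarrow> cutoff y = 0" "\<bar>y\<bar> \<ge> 5 \<Longrightarrow> cutoff y = 1"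
    "\<bar>y\<bar> \<le> 10 \<Longrightarrow> cutoff (y / 10) = 0" "\<bar>y\<bar> \<ge> 50 \<Longrightarrow> cutoff (y / 10) = 1"
    using cutoff_eq_0[of y] cutoff_eq_1[of y] cutoff_eq_0[of "y / 10"] cutoff_eq_1[of "y / 10"] by auto
  ultimately show "cutoff y - cutoff (y / 10) \<le> indicator {1..50} \<bar>y\<bar>"
    "indicator {5..10} \<bar>y\<bar> \<le> cutoff y - cutoff (y / 10)"
    by (auto simp: indicator_def not_le)
qed

text \<open>For \<theta> \<ge> 0 the defect \<theta> - (1 - exp (- \<theta>)) lies between 0 and
  \<theta>^2. The \<theta> telescope and are uniformly small by uniform continuity, so the total
  defect vanishes. In the application the summands are 1 minus the squared modulus of the
  characteristic function of a small increment.\<close>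

lemma sum_one_minus_exp_tendsto:
  fixes p :: "real \<Rightarrow> real"
  assumes cont: "continuous_on {0..1} p"
    and mono: "\<And>n k. k < n \<Longrightarrow> p (real k / real n) \<le> p (real (Suc k) / real n)"
  shows "(\<lambda>n. \<Sum>k<n. 1 - exp (- 2 * (p (real (Suc k) / real n) - p (real k / real n)))) \<longlonglongrightarrow> 2 * (p 1 - p 0)"
proof (rule LIMSEQ_I)
  fix e :: real assume "e > 0"
  define D where "D = 2 * (p 1 - p 0)"
  have "p 0 \<le> p 1" using mono[of 0 1] by simp
  then have "D \<ge> 0" by (simp add: D_def)
  \<comment> \<open>The total defect is at most 2 * D * e', which equals e - 2 * e'.\<close>
  define e' where "e' = e / (2 * (D + 1))"
  have "e' > 0" using \<open>e > 0\<close> \<open>D \<ge> 0\<close> by (simp add: e'_def)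
  have "uniformly_continuous_on {0..1} p" using cont by (intro compact_uniformly_continuous) auto
  then obtain d where d: "d > 0" "\<And>x x'. x \<in> {0..1} \<Longrightarrow> x' \<in> {0..1} \<Longrightarrow> dist x' x < d \<Longrightarrow> dist (p x') (p x) < e'"
    using \<open>e' > 0\<close> unfolding uniformly_continuous_on_def by metis
  obtain n0 where n0: "n0 > 0" "1 / real n0 < d" using nat_approx_posE[OF d(1)] by blast
  show "\<exists>no. \<forall>n\<ge>no. norm ((\<Sum>k<n. 1 - exp (- 2 * (p (real (Suc k) / real n) - p (real k / real n)))) - 2 * (p 1 - p 0)) < e"
  proof (intro exI[of _ n0] allI impI)
    fix n assume n: "n \<ge> n0"
    define \<theta> where "\<theta> k = 2 * (p (real (Suc k) / real n) - p (real k / real n))" for k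
    have npos: "n > 0" using n n0 by simp
    have th0: "\<theta> k \<ge> 0" if "k < n" for k using mono[OF that] by (simp add: \<theta>_def)
    have th1: "\<theta> k \<le> 2 * e'" if "k < n" for k
    proof -
      have "dist (real (Suc k) / real n) (real k / real n) = 1 / real n"
        by (simp add: dist_real_def diff_divide_distrib[symmetric])
      also have "\<dots> \<le> 1 / real n0" using n n0 by (simp add: frac_le)
      finally have "dist (real (Suc k) / real n) (real k / real n) < d" using n0 by simp
      then have "dist (p (real (Suc k) / real n)) (p (real k / real n)) < e'"
        using that npos by (intro d(2)) (auto simp: divide_le_eq)
      then have "p (real (Suc k) / real n) - p (real k / real n) < e'"
        unfolding dist_real_def by (rule le_less_trans[OF abs_ge_self])
      then show ?thesis unfolding \<theta>_def by (intro mult_left_mono less_imp_le) simp_all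
    qed
    have sum: "(\<Sum>k<n. \<theta> k) = D"
    proof -
      have "(\<Sum>k<n. \<theta> k) = 2 * (\<Sum>k<n. p (real (Suc k) / real n) - p (real k / real n))"
        by (simp add: \<theta>_def sum_distrib_left)
      also have "(\<Sum>k<n. p (real (Suc k) / real n) - p (real k / real n)) = p (real n / real n) - p (real 0 / real n)"
        by (rule sum_lessThan_telescope[of "\<lambda>k. p (real k / real n)"])
      finally show ?thesis using npos by (simp add: D_def)
    qed
    have each: "0 \<le> \<theta> k - (1 - exp (- \<theta> k))" "\<theta> k - (1 - exp (- \<theta> k)) \<le> \<theta> k * (2 * e')" if "k < n" for k
    proof -
      show "0 \<le> \<theta> k - (1 - exp (- \<theta> k))" using exp_ge_add_one_self[of "- \<theta> k"] by simp
      have "exp (\<theta> k) \<ge> 1 + \<theta> k" by (rule exp_ge_add_one_self)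
      then have "exp (- \<theta> k) \<le> 1 / (1 + \<theta> k)"
        using th0[OF that] by (simp add: exp_minus field_simps)
      also have "1 / (1 + \<theta> k) \<le> 1 - \<theta> k + \<theta> k * \<theta> k"
      proof -
        have "(1 - \<theta> k + \<theta> k * \<theta> k) * (1 + \<theta> k) = 1 + \<theta> k * \<theta> k * \<theta> k" by (simp add: algebra_simps)
        also have "\<dots> \<ge> 1" using th0[OF that] by simp
        finally show ?thesis using th0[OF that] by (subst pos_divide_le_eq) auto
      qed
      finally have "\<theta> k - (1 - exp (- \<theta> k)) \<le> \<theta> k * \<theta> k" by simp
      also have "\<dots> \<le> \<theta> k * (2 * e')" using th0[OF that] th1[OF that] by (intro mult_left_mono)
      finally show "\<theta> k - (1 - exp (- \<theta> k)) \<le> \<theta> k * (2 * e')" .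
    qed
    have "D - (\<Sum>k<n. 1 - exp (- \<theta> k)) = (\<Sum>k<n. \<theta> k - (1 - exp (- \<theta> k)))"
      by (simp add: sum_subtractf sum)
    moreover have "0 \<le> (\<Sum>k<n. \<theta> k - (1 - exp (- \<theta> k)))" by (intro sum_nonneg) (use each in auto)
    moreover have "(\<Sum>k<n. \<theta> k - (1 - exp (- \<theta> k))) \<le> (\<Sum>k<n. \<theta> k * (2 * e'))"
      by (intro sum_mono) (use each in auto)
    moreover have "(\<Sum>k<n. \<theta> k * (2 * e')) = D * (2 * e')" by (simp add: sum_distrib_right[symmetric] sum)
    moreover have "D * (2 * e') < e"
    proof -
      have "e / c * c = e" if "c > 0" for c using that by simp
      moreover have "2 * (D + 1) > 0" using \<open>D \<ge> 0\<close> by simp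
      ultimately have "e' * (2 * (D + 1)) = e" unfolding e'_def by blast
      then have "D * (2 * e') = e - 2 * e'" by (simp add: algebra_simps)
      then show ?thesis using \<open>e' > 0\<close> by simp
    qed
    ultimately have "norm ((\<Sum>k<n. 1 - exp (- \<theta> k)) - D) < e" by (simp only: real_norm_def)
    then show "norm ((\<Sum>k<n. 1 - exp (- 2 * (p (real (Suc k) / real n) - p (real k / real n)))) - 2 * (p 1 - p 0)) < e"
      by (simp add: \<theta>_def D_def)
  qed
qed

text \<open>Symmetrisation: the integral below is the expectation of \<open>cutoff ((Y - Y') / r)\<close> for an
  independent copy \<open>Y'\<close> of \<open>Y\<close>.\<close>

definition (in prob_space) sym_cutoff :: "('a \<Rightarrow> real) \<Rightarrow> real \<Rightarrow> real" where
  "sym_cutoff Y r = (\<integral>t. cutoff_kernel t * (1 - (cmod (CLINT \<omega>|M. iexp (t / r * Y \<omega>)))\<^sup>2) \<partial>lborel)"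

context prob_space
begin

lemma integral_cos_difference:
  fixes Y :: "'a \<Rightarrow> real"
  assumes [measurable]: "Y \<in> borel_measurable M"
  shows "(\<integral>z. 1 - cos (t * (Y (fst z) - Y (snd z))) \<partial>(M \<Otimes>\<^sub>M M)) = 1 - (cmod (CLINT \<omega>|M. iexp (t * Y \<omega>)))\<^sup>2"
proof -
  interpret P: pair_prob_space M M ..
  let ?c = "\<lambda>\<omega>. cos (t * Y \<omega>)" and ?s = "\<lambda>\<omega>. sin (t * Y \<omega>)"
  have int: "integrable M ?c" "integrable M ?s"
    by (intro integrable_const_bound[where B=1]; simp)+
  have ci: "integrable M (\<lambda>\<omega>. iexp (t * Y \<omega>))"
    by (rule integrable_const_bound[where B=1]) auto
  have re: "Re (CLINT \<omega>|M. iexp (t * Y \<omega>)) = (\<integral>\<omega>. ?c \<omega> \<partial>M)"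
    "Im (CLINT \<omega>|M. iexp (t * Y \<omega>)) = (\<integral>\<omega>. ?s \<omega> \<partial>M)"
    using integral_Re[OF ci] integral_Im[OF ci] by (simp_all add: Re_exp Im_exp)
  have 1: "integrable (M \<Otimes>\<^sub>M M) (\<lambda>(x, y). f x * f y)" "(\<integral>z. (case z of (x, y) \<Rightarrow> f x * f y) \<partial>(M \<Otimes>\<^sub>M M)) = (\<integral>x. f x \<partial>M)\<^sup>2"
    if f: "integrable M f" and b: "\<And>x. \<bar>f x\<bar> \<le> 1" for f :: "'a \<Rightarrow> real"
  proof -
    have [measurable]: "f \<in> borel_measurable M" using f by auto
    have "\<bar>f x * f y\<bar> \<le> 1" for x y using b[of x] b[of y] by (simp add: abs_mult mult_le_one)
    then show I: "integrable (M \<Otimes>\<^sub>M M) (\<lambda>(x, y). f x * f y)"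
      by (intro P.integrable_const_bound[where B=1]) auto
    show "(\<integral>z. (case z of (x, y) \<Rightarrow> f x * f y) \<partial>(M \<Otimes>\<^sub>M M)) = (\<integral>x. f x \<partial>M)\<^sup>2"
      by (subst P.integral_fst'[OF I, symmetric]) (simp add: power2_eq_square mult.commute)
  qed
  have "(\<integral>z. 1 - cos (t * (Y (fst z) - Y (snd z))) \<partial>(M \<Otimes>\<^sub>M M)) =
      (\<integral>z. 1 - ((case z of (x, y) \<Rightarrow> ?c x * ?c y) + (case z of (x, y) \<Rightarrow> ?s x * ?s y)) \<partial>(M \<Otimes>\<^sub>M M))"
    by (intro Bochner_Integration.integral_cong) (auto simp: right_diff_distrib cos_diff)
  also have "\<dots> = 1 - ((\<integral>\<omega>. ?c \<omega> \<partial>M)\<^sup>2 + (\<integral>\<omega>. ?s \<omega> \<partial>M)\<^sup>2)"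
    using 1[OF int(1)] 1[OF int(2)] by (simp add: P.prob_space del: split_beta' prod.case_distrib)
  also have "(\<integral>\<omega>. ?c \<omega> \<partial>M)\<^sup>2 + (\<integral>\<omega>. ?s \<omega> \<partial>M)\<^sup>2 = (cmod (CLINT \<omega>|M. iexp (t * Y \<omega>)))\<^sup>2"
    unfolding cmod_power2 re ..
  finally show ?thesis .
qed

lemma sym_cutoff_eq:
  assumes [measurable]: "Y \<in> borel_measurable M"
  shows "integrable (M \<Otimes>\<^sub>M M) (\<lambda>z. cutoff ((Y (fst z) - Y (snd z)) / r))"
    and "sym_cutoff Y r = (\<integral>z. cutoff ((Y (fst z) - Y (snd z)) / r) \<partial>(M \<Otimes>\<^sub>M M))"
    and "integrable lborel (\<lambda>t. cutoff_kernel t * (1 - (cmod (CLINT \<omega>|M. iexp (t / r * Y \<omega>)))\<^sup>2))"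
proof -
  interpret P: pair_prob_space M M ..
  let ?y = "\<lambda>z. (Y (fst z) - Y (snd z)) / r"
  have s: "sigma_finite_measure (M \<Otimes>\<^sub>M M)" ..
  have m: "?y \<in> borel_measurable (M \<Otimes>\<^sub>M M)" by measurable
  have i: "integrable (M \<Otimes>\<^sub>M M) (\<lambda>z. min 1 ((?y z)\<^sup>2))"
    by (rule P.integrable_const_bound[where B=1]) auto
  have e: "(\<integral>z. 1 - cos (t * ?y z) \<partial>(M \<Otimes>\<^sub>M M)) = 1 - (cmod (CLINT \<omega>|M. iexp (t / r * Y \<omega>)))\<^sup>2" for t
    using integral_cos_difference[of Y "t / r"] by simp
  show "integrable (M \<Otimes>\<^sub>M M) (\<lambda>z. cutoff (?y z))" by (rule cutoff_fubini(1)[OF s m i])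
  show "integrable lborel (\<lambda>t. cutoff_kernel t * (1 - (cmod (CLINT \<omega>|M. iexp (t / r * Y \<omega>)))\<^sup>2))"
    using cutoff_fubini(2)[OF s m i] by (simp only: e)
  show "sym_cutoff Y r = (\<integral>z. cutoff (?y z) \<partial>(M \<Otimes>\<^sub>M M))"
    unfolding sym_cutoff_def using cutoff_fubini(3)[OF s m i] by (simp only: e)
qed

lemma measure_pair_Times:
  assumes "A \<in> events" "B \<in> events"
  shows "measure (M \<Otimes>\<^sub>M M) (A \<times> B) = prob A * prob B"
proof -
  interpret P: pair_prob_space M M ..
  have "emeasure (M \<Otimes>\<^sub>M M) (A \<times> B) = emeasure M A * emeasure M B"
    using assms by (intro emeasure_pair_measure_Times)
  then show ?thesis
    by (simp add: P.emeasure_eq_measure emeasure_eq_measure flip: ennreal_mult)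
qed

text \<open>Weak symmetrisation: with probability at least 1 / 2 the independent copy is at most 5 *
  r, and then the difference is at least 5 * r, where the cutoff is 1.\<close>

lemma prob_le_sym_cutoff:
  assumes [measurable]: "Y \<in> borel_measurable M" and "r > 0"
    and half: "\<P>(\<omega> in M. \<bar>Y \<omega>\<bar> > 5 * r) \<le> 1 / 2"
  shows "\<P>(\<omega> in M. \<bar>Y \<omega>\<bar> > 10 * r) \<le> 2 * sym_cutoff Y r"
proof -
  interpret P: pair_prob_space M M ..
  let ?A = "{\<omega> \<in> space M. \<bar>Y \<omega>\<bar> > 10 * r}" and ?B = "{\<omega> \<in> space M. \<not> \<bar>Y \<omega>\<bar> > 5 * r}"
  have [measurable]: "?A \<in> events" "?B \<in> events" by measurable
  have "prob ?B = 1 - \<P>(\<omega> in M. \<bar>Y \<omega>\<bar> > 5 * r)" by (rule prob_neg) measurable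
  with half have B: "prob ?B \<ge> 1 / 2" by simp
  have "prob ?A * prob ?B = measure (M \<Otimes>\<^sub>M M) (?A \<times> ?B)"
    by (simp only: measure_pair_Times \<open>?A \<in> events\<close> \<open>?B \<in> events\<close>)
  also have "\<dots> = (\<integral>z. indicator (?A \<times> ?B) z \<partial>(M \<Otimes>\<^sub>M M))"
    by simp
  also have "\<dots> \<le> (\<integral>z. cutoff ((Y (fst z) - Y (snd z)) / r) \<partial>(M \<Otimes>\<^sub>M M))"
  proof (rule integral_mono[OF _ sym_cutoff_eq(1)])
    show "integrable (M \<Otimes>\<^sub>M M) (indicator (?A \<times> ?B) :: _ \<Rightarrow> real)"
      by (intro P.integrable_const_bound[where B=1]) (auto simp: indicator_def)
    fix z
    show "indicator (?A \<times> ?B) z \<le> cutoff ((Y (fst z) - Y (snd z)) / r)"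
    proof (cases "z \<in> ?A \<times> ?B")
      case True
      then have "\<bar>Y (fst z)\<bar> > 10 * r" "\<bar>Y (snd z)\<bar> \<le> 5 * r" by auto
      then have "\<bar>Y (fst z) - Y (snd z)\<bar> \<ge> 5 * r" by linarith
      then have "\<bar>(Y (fst z) - Y (snd z)) / r\<bar> \<ge> 5" using \<open>r > 0\<close> by (simp add: pos_le_divide_eq)
      then show ?thesis using True cutoff_eq_1 by simp
    qed (simp add: cutoff_nonneg)
  qed measurable
  also have "\<dots> = sym_cutoff Y r" by (rule sym_cutoff_eq(2)[symmetric]) measurable
  finally have "prob ?A * prob ?B \<le> sym_cutoff Y r" .
  moreover have "prob ?A * (1 / 2) \<le> prob ?A * prob ?B" using B by (intro mult_left_mono) auto
  ultimately show ?thesis by simp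
qed

text \<open>The cutoff vanishes unless the difference exceeds r, and then one of the two copies
  exceeds r / 2.\<close>

lemma sym_cutoff_le_prob:
  assumes [measurable]: "Y \<in> borel_measurable M" and "r > 0"
  shows "sym_cutoff Y r \<le> 2 * \<P>(\<omega> in M. \<bar>Y \<omega>\<bar> > r / 2)"
proof -
  interpret P: pair_prob_space M M ..
  let ?A = "{\<omega> \<in> space M. \<bar>Y \<omega>\<bar> > r / 2}"
  have [measurable]: "?A \<in> events" by measurable
  have i: "integrable (M \<Otimes>\<^sub>M M) (indicator S :: _ \<Rightarrow> real)" if "S \<in> sets (M \<Otimes>\<^sub>M M)" for S
    using that by (intro P.integrable_const_bound[where B=1]) (auto simp: indicator_def)
  have "sym_cutoff Y r = (\<integral>z. cutoff ((Y (fst z) - Y (snd z)) / r) \<partial>(M \<Otimes>\<^sub>M M))"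
    by (rule sym_cutoff_eq(2)) measurable
  also have "\<dots> \<le> (\<integral>z. indicator (?A \<times> space M) z + indicator (space M \<times> ?A) z \<partial>(M \<Otimes>\<^sub>M M))"
  proof (rule integral_mono[OF sym_cutoff_eq(1)])
    fix z assume z: "z \<in> space (M \<Otimes>\<^sub>M M)"
    show "cutoff ((Y (fst z) - Y (snd z)) / r) \<le> indicator (?A \<times> space M) z + indicator (space M \<times> ?A) z"
    proof (cases "z \<in> ?A \<times> space M \<or> z \<in> space M \<times> ?A")
      case True
      then show ?thesis using cutoff_le_1[of "(Y (fst z) - Y (snd z)) / r"] by (auto simp: indicator_def)
    next
      case False
      with z have "\<bar>Y (fst z)\<bar> \<le> r / 2" "\<bar>Y (snd z)\<bar> \<le> r / 2" by (auto simp: space_pair_measure)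
      then have "\<bar>Y (fst z) - Y (snd z)\<bar> \<le> r" by linarith
      then have "\<bar>(Y (fst z) - Y (snd z)) / r\<bar> \<le> 1" using \<open>r > 0\<close> by (simp add: pos_divide_le_eq)
      then show ?thesis using cutoff_eq_0 by simp
    qed
  qed (auto intro!: i)
  also have "\<dots> = measure (M \<Otimes>\<^sub>M M) (?A \<times> space M) + measure (M \<Otimes>\<^sub>M M) (space M \<times> ?A)"
    by (subst Bochner_Integration.integral_add) (auto intro!: i)
  also have "\<dots> = 2 * prob ?A"
    by (simp add: measure_pair_Times prob_space)
  finally show ?thesis .
qed

end

section \<open>Levy measures in polar coordinates\<close>

lemma levy_measure_sets: "levy_measure_of \<mu> \<nu> \<Longrightarrow> sets \<nu> = sets borel"
  by (simp add: levy_measure_of_def)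

lemma levy_measure_integrable:
  fixes \<nu> :: "(real ^ 'n) measure"
  assumes "levy_measure_of \<mu> \<nu>"
  shows "integrable \<nu> (\<lambda>x. min 1 ((norm x)\<^sup>2))"
proof -
  note [measurable_cong] = levy_measure_sets[OF assms]
  show ?thesis using assms by (intro integrableI_nonneg) (auto simp: levy_measure_of_def)
qed

lemma levy_measure_sigma_finite:
  fixes \<nu> :: "(real ^ 'n) measure"
  assumes "levy_measure_of \<mu> \<nu>"
  shows "sigma_finite_measure \<nu>"
proof
  note [measurable_cong] = levy_measure_sets[OF assms]
  define A where "A n = {x :: real ^ 'n. norm x > 1 / real (Suc n)}" for n
  have [measurable]: "A n \<in> sets \<nu>" for n unfolding A_def by measurable
  have fin: "emeasure \<nu> (A n) \<noteq> \<infinity>" for n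
  proof -
    let ?c = "(real (Suc n))\<^sup>2"
    have "emeasure \<nu> (A n) \<le> (\<integral>\<^sup>+x. ennreal ?c * ennreal (min 1 ((norm x)\<^sup>2)) \<partial>\<nu>)"
    proof -
      have "emeasure \<nu> (A n) = (\<integral>\<^sup>+x. indicator (A n) x \<partial>\<nu>)" by simp
      also have "\<dots> \<le> (\<integral>\<^sup>+x. ennreal ?c * ennreal (min 1 ((norm x)\<^sup>2)) \<partial>\<nu>)"
      proof (rule nn_integral_mono)
        fix x :: "real ^ 'n"
        show "indicator (A n) x \<le> ennreal ?c * ennreal (min 1 ((norm x)\<^sup>2))"
        proof (cases "x \<in> A n")
          case True
          then have "1 \<le> real (Suc n) * norm x" by (simp add: A_def field_simps del: of_nat_Suc)
          then have "1 \<le> (real (Suc n) * norm x)\<^sup>2" by (rule one_le_power)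
          moreover have "1 \<le> ?c" by simp
          ultimately have "1 \<le> ?c * min 1 ((norm x)\<^sup>2)" by (simp add: min_def power_mult_distrib del: of_nat_Suc)
          then have "ennreal 1 \<le> ennreal (?c * min 1 ((norm x)\<^sup>2))" by (rule ennreal_leI)
          then show ?thesis using True by (simp add: ennreal_mult del: of_nat_Suc)
        qed simp
      qed
      finally show ?thesis .
    qed
    also have "\<dots> = ennreal ?c * (\<integral>\<^sup>+x. ennreal (min 1 ((norm x)\<^sup>2)) \<partial>\<nu>)"
      by (rule nn_integral_cmult) measurable
    also have "\<dots> < \<infinity>" using assms by (simp add: levy_measure_of_def ennreal_mult_less_top)
    finally show ?thesis by simp
  qed
  have "(\<Union>n. A n) = - {0}"
  proof (intro equalityI subsetI)
    fix x :: "real ^ 'n" assume "x \<in> - {0}"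
    then have "norm x > 0" by simp
    then obtain n where "1 / real (Suc n) < norm x" using nat_approx_posE by blast
    then show "x \<in> (\<Union>n. A n)" by (auto simp: A_def)
  next
    fix x :: "real ^ 'n" assume "x \<in> (\<Union>n. A n)"
    then obtain n where n: "norm x > 1 / real (Suc n)" by (auto simp: A_def)
    have "1 / real (Suc n) > 0" by simp
    with n have "norm x > 0" by linarith
    then show "x \<in> - {0}" by simp
  qed
  moreover have "space \<nu> = UNIV" using sets_eq_imp_space_eq[OF levy_measure_sets[OF assms]] by simp
  moreover have "{0} \<in> sets \<nu>" by measurable
  ultimately show "\<exists>S. countable S \<and> S \<subseteq> sets \<nu> \<and> \<Union> S = space \<nu> \<and> (\<forall>a\<in>S. emeasure \<nu> a \<noteq> \<infinity>)"
    using fin assms by (intro exI[of _ "insert {0} (range A)"]) (auto simp: levy_measure_of_def)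
qed

lemma levy_coordinate_integrable:
  fixes \<nu> :: "(real ^ 'n) measure"
  assumes "levy_measure_of \<mu> \<nu>"
  shows "integrable \<nu> (\<lambda>x. min 1 ((x $ i / r)\<^sup>2))"
proof (rule Bochner_Integration.integrable_bound)
  note [measurable_cong] = levy_measure_sets[OF assms]
  show "integrable \<nu> (\<lambda>x. (1 + 1 / r\<^sup>2) * min 1 ((norm x)\<^sup>2))"
    by (intro integrable_mult_right levy_measure_integrable[OF assms])
  show "(\<lambda>x. min 1 ((x $ i / r)\<^sup>2)) \<in> borel_measurable \<nu>" by measurable
  show "AE x in \<nu>. norm (min 1 ((x $ i / r)\<^sup>2)) \<le> norm ((1 + 1 / r\<^sup>2) * min 1 ((norm x)\<^sup>2))"
  proof (rule AE_I2)
    fix x :: "real ^ 'n"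
    have "\<bar>x $ i\<bar> \<le> \<bar>norm x\<bar>" using component_le_norm_cart[of x i] by simp
    then have le: "(x $ i)\<^sup>2 \<le> (norm x)\<^sup>2" unfolding abs_le_square_iff .
    have "min 1 ((x $ i / r)\<^sup>2) \<le> (1 + 1 / r\<^sup>2) * min 1 ((norm x)\<^sup>2)"
    proof (cases "(norm x)\<^sup>2 \<le> 1")
      case True
      have "(x $ i / r)\<^sup>2 = 1 / r\<^sup>2 * (x $ i)\<^sup>2" by (simp add: power_divide)
      also have "\<dots> \<le> 1 / r\<^sup>2 * (norm x)\<^sup>2" using le by (intro mult_left_mono) auto
      also have "\<dots> \<le> (1 + 1 / r\<^sup>2) * (norm x)\<^sup>2" by (intro mult_right_mono) auto
      finally show ?thesis using True by (simp add: min_absorb2 min.coboundedI2)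
    next
      case False
      have "min 1 ((x $ i / r)\<^sup>2) \<le> 1" by simp
      also have "\<dots> \<le> 1 + 1 / r\<^sup>2" by simp
      finally show ?thesis using False by (simp add: min_absorb1)
    qed
    moreover have "min 1 ((x $ i / r)\<^sup>2) \<ge> 0" by simp
    ultimately show "norm (min 1 ((x $ i / r)\<^sup>2)) \<le> norm ((1 + 1 / r\<^sup>2) * min 1 ((norm x)\<^sup>2))"
      by (simp only: real_norm_def abs_of_nonneg)
  qed
qed

text \<open>The modulus sees only the real part of the exponent, so the drift and the compensating
  term drop out. q is the variance of the Gaussian part in the i-th coordinate.\<close>

lemma cmod_char_levy:
  fixes \<mu> \<nu> :: "(real ^ 'n) measure"
  assumes L: "levy_measure_of \<mu> \<nu>"
  shows "\<exists>q\<ge>0. \<forall>t. cmod (CLINT x|\<mu>. iexp (t * x $ i)) =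
    exp (- (q * t\<^sup>2 / 2 + (\<integral>x. 1 - cos (t * x $ i) \<partial>\<nu>)))"
proof -
  note [measurable_cong] = levy_measure_sets[OF L]
  obtain A :: "real ^ 'n ^ 'n" and \<gamma> :: "real ^ 'n" where A: "\<And>z. 0 \<le> z \<bullet> (A *v z)"
    and eq: "\<And>z. (CLINT x|\<mu>. iexp (z \<bullet> x)) =
        exp (- complex_of_real (z \<bullet> (A *v z)) / 2 + \<i> * complex_of_real (\<gamma> \<bullet> z) +
          (CLINT x|\<nu>. iexp (z \<bullet> x) - 1
             - \<i> * complex_of_real ((z \<bullet> x) * indicator (cball 0 1) x)))"
    using L unfolding levy_measure_of_def by blast
  define e :: "real ^ 'n" where "e = axis i 1"
  define q where "q = e \<bullet> (A *v e)"
  have "cmod (CLINT x|\<mu>. iexp (t * x $ i)) = exp (- (q * t\<^sup>2 / 2 + (\<integral>x. 1 - cos (t * x $ i) \<partial>\<nu>)))" for t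
  proof -
    have z: "(t *\<^sub>R e) \<bullet> x = t * x $ i" for x
      by (simp add: e_def inner_axis')
    have zA: "(t *\<^sub>R e) \<bullet> (A *v (t *\<^sub>R e)) = q * t\<^sup>2"
      by (simp add: q_def matrix_vector_mult_scaleR power2_eq_square)
    let ?h = "\<lambda>x :: real ^ 'n. iexp (t * x $ i) - 1 - \<i> * complex_of_real ((t * x $ i) * indicator (cball 0 1) x)"
    \<comment> \<open>Integrability allows the real part to be taken inside the integral.\<close>
    have int: "integrable \<nu> ?h"
    proof (rule Bochner_Integration.integrable_bound)
      show "integrable \<nu> (\<lambda>x. (2 + t\<^sup>2) * min 1 ((norm x)\<^sup>2))"
        by (intro integrable_mult_right levy_measure_integrable[OF L])
      have [measurable]: "cball (0 :: real ^ 'n) 1 \<in> sets borel" by simp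
      show "?h \<in> borel_measurable \<nu>" by measurable
      show "AE x in \<nu>. norm (?h x) \<le> norm ((2 + t\<^sup>2) * min 1 ((norm x)\<^sup>2))"
      proof (rule AE_I2)
        fix x :: "real ^ 'n"
        have "norm (?h x) \<le> (2 + t\<^sup>2) * min 1 ((norm x)\<^sup>2)"
        proof (cases "norm x \<le> 1")
          case True
          have "norm (?h x) = cmod (iexp (t * x $ i) - (\<Sum>k\<le>1. (\<i> * (t * x $ i)) ^ k / fact k))"
            using True by (simp add: algebra_simps)
          also have "\<dots> \<le> \<bar>t * x $ i\<bar> ^ Suc 1 / fact (Suc 1)" by (rule iexp_approx1)
          also have "\<dots> = (t * x $ i)\<^sup>2 / 2" by (simp add: power2_eq_square)
          also have "\<dots> \<le> t\<^sup>2 * (norm x)\<^sup>2"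
          proof -
            have "\<bar>x $ i\<bar> \<le> \<bar>norm x\<bar>" using component_le_norm_cart[of x i] by simp
            then have "(x $ i)\<^sup>2 \<le> (norm x)\<^sup>2" unfolding abs_le_square_iff .
            then have "t\<^sup>2 * (x $ i)\<^sup>2 \<le> t\<^sup>2 * (norm x)\<^sup>2" by (intro mult_left_mono) auto
            moreover have "t\<^sup>2 * (x $ i)\<^sup>2 \<ge> 0" by simp
            ultimately show ?thesis by (simp only: power_mult_distrib)
          qed
          also have "\<dots> \<le> (2 + t\<^sup>2) * (norm x)\<^sup>2" by (intro mult_right_mono) auto
          also have "(norm x)\<^sup>2 = min 1 ((norm x)\<^sup>2)" using True by (simp add: min_absorb2 power_le_one)
          finally show ?thesis .
        next
          case False
          then have "norm (?h x) = cmod (iexp (t * x $ i) - 1)" by simp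
          also have "\<dots> \<le> cmod (iexp (t * x $ i)) + cmod 1" by (rule norm_triangle_ineq4)
          also have "\<dots> \<le> 2 + t\<^sup>2" by simp
          also have "1 \<le> (norm x)\<^sup>2" using False by (simp add: one_le_power)
          then have "2 + t\<^sup>2 = (2 + t\<^sup>2) * min 1 ((norm x)\<^sup>2)" by (simp add: min_absorb1)
          finally show ?thesis .
        qed
        then show "norm (?h x) \<le> norm ((2 + t\<^sup>2) * min 1 ((norm x)\<^sup>2))"
          unfolding real_norm_def[of "_ * min _ _"] by (rule order_trans[OF _ abs_ge_self])
      qed
    qed
    have "Re (CLINT x|\<nu>. ?h x) = (\<integral>x. Re (?h x) \<partial>\<nu>)" by (rule integral_Re[OF int, symmetric])
    also have "\<dots> = (\<integral>x. - (1 - cos (t * x $ i)) \<partial>\<nu>)"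
      by (intro Bochner_Integration.integral_cong) (simp_all add: Re_exp)
    also have "\<dots> = - (\<integral>x. 1 - cos (t * x $ i) \<partial>\<nu>)" by (rule integral_minus)
    finally have Re: "Re (CLINT x|\<nu>. ?h x) = - (\<integral>x. 1 - cos (t * x $ i) \<partial>\<nu>)" .
    have "cmod (CLINT x|\<mu>. iexp (t * x $ i)) = cmod (exp (- complex_of_real (q * t\<^sup>2) / 2 +
        \<i> * complex_of_real (\<gamma> \<bullet> (t *\<^sub>R e)) + (CLINT x|\<nu>. ?h x)))"
      using eq[of "t *\<^sub>R e", unfolded zA] by (simp only: z)
    also have "\<dots> = exp (- (q * t\<^sup>2 / 2) + Re (CLINT x|\<nu>. ?h x))"
      by (subst norm_exp_eq_Re) simp
    also have "\<dots> = exp (- (q * t\<^sup>2 / 2 + (\<integral>x. 1 - cos (t * x $ i) \<partial>\<nu>)))"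
      unfolding Re by simp
    finally show ?thesis .
  qed
  moreover have "q \<ge> 0" unfolding q_def by (rule A)
  ultimately show ?thesis by blast
qed

section \<open>Masses of coordinate slabs\<close>

lemma polar_emeasure:
  "polar_decomposition \<nu> \<sigma> k \<Longrightarrow> B \<in> sets borel \<Longrightarrow> emeasure \<nu> B =
      (\<integral>\<^sup>+\<xi>. (\<integral>\<^sup>+u\<in>{0<..}. indicator B (u *\<^sub>R \<xi>) * ennreal (k \<xi> u / u) \<partial>lborel) \<partial>\<sigma>)"
  by (simp add: polar_decomposition_def)

lemma polar_space: "polar_decomposition \<nu> \<sigma> k \<Longrightarrow> space \<sigma> = sphere 0 1"
  unfolding polar_decomposition_def by (auto dest: sets_eq_imp_space_eq simp: space_restrict_space)

lemma slab_sets: "{x :: real ^ 'n. l \<le> \<bar>x $ i\<bar> \<and> \<bar>x $ i\<bar> \<le> h} \<in> sets borel"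
  by measurable

text \<open>The ray through \<xi> with |\<xi>_i| = c meets the slab in an interval of length 49 * r
  / c starting at r / c \<ge> r. There 1 / u \<le> c / r, and k is at most its value at r. The ratio
  50 is the support bound in \<open>cutoff_difference\<close>.\<close>

lemma polar_upper:
  fixes \<nu> :: "(real ^ 'n) measure"
  assumes P: "polar_decomposition \<nu> \<sigma> k" and r: "r > 0" and int: "integrable \<sigma> (\<lambda>\<xi>. k \<xi> r)"
  shows "emeasure \<nu> {x. r \<le> \<bar>x $ i\<bar> \<and> \<bar>x $ i\<bar> \<le> 50 * r} \<le> ennreal (49 * (LINT \<xi>|\<sigma>. k \<xi> r))"
proof -
  let ?B = "{x :: real ^ 'n. r \<le> \<bar>x $ i\<bar> \<and> \<bar>x $ i\<bar> \<le> 50 * r}"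
  have k0: "k \<xi> u \<ge> 0" if "\<xi> \<in> sphere 0 1" "u > 0" for \<xi> u using P that by (auto simp: polar_decomposition_def)
  have km: "k \<xi> v \<le> k \<xi> u" if "\<xi> \<in> sphere 0 1" "u > 0" "u \<le> v" for \<xi> u v
    using P that by (auto simp: polar_decomposition_def monotone_on_def)
  have "emeasure \<nu> ?B = (\<integral>\<^sup>+\<xi>. (\<integral>\<^sup>+u\<in>{0<..}. indicator ?B (u *\<^sub>R \<xi>) * ennreal (k \<xi> u / u) \<partial>lborel) \<partial>\<sigma>)"
    by (rule polar_emeasure[OF P slab_sets])
  also have "\<dots> \<le> (\<integral>\<^sup>+\<xi>. ennreal (49 * k \<xi> r) \<partial>\<sigma>)"
  proof (rule nn_integral_mono)
    fix \<xi> assume "\<xi> \<in> space \<sigma>"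
    then have \<xi>: "\<xi> \<in> sphere 0 1" by (simp add: polar_space[OF P])
    define c where "c = \<bar>\<xi> $ i\<bar>"
    have c1: "c \<le> 1" using component_le_norm_cart[of \<xi> i] \<xi> by (simp add: c_def)
    show "(\<integral>\<^sup>+u\<in>{0<..}. indicator ?B (u *\<^sub>R \<xi>) * ennreal (k \<xi> u / u) \<partial>lborel) \<le> ennreal (49 * k \<xi> r)"
    proof (cases "c = 0")
      case True
      then have "u *\<^sub>R \<xi> \<notin> ?B" for u using r by (simp add: c_def)
      then show ?thesis by simp
    next
      case False
      then have c: "c > 0" by (simp add: c_def)
      have "(\<integral>\<^sup>+u\<in>{0<..}. indicator ?B (u *\<^sub>R \<xi>) * ennreal (k \<xi> u / u) \<partial>lborel) \<le>
          (\<integral>\<^sup>+u. ennreal (k \<xi> r * (c / r)) * indicator {r / c..50 * r / c} u \<partial>lborel)"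
      proof (rule nn_integral_mono)
        fix u :: real
        show "indicator ?B (u *\<^sub>R \<xi>) * ennreal (k \<xi> u / u) * indicator {0<..} u \<le>
            ennreal (k \<xi> r * (c / r)) * indicator {r / c..50 * r / c} u"
        proof (cases "u > 0 \<and> u *\<^sub>R \<xi> \<in> ?B")
          case True
          then have u: "u > 0" "r \<le> u * c" "u * c \<le> 50 * r" by (auto simp: c_def abs_mult)
          then have u': "u \<in> {r / c..50 * r / c}" using c by (simp add: pos_divide_le_eq pos_le_divide_eq)
          have "u * c \<le> u * 1" using c1 u by (intro mult_left_mono) auto
          then have "r \<le> u" using u(2) by linarith
          then have "k \<xi> u \<le> k \<xi> r" by (rule km[OF \<xi> r])
          moreover have "1 / u \<le> c / r" using u r by (simp add: field_simps)
          ultimately have "k \<xi> u * (1 / u) \<le> k \<xi> r * (c / r)"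
            using k0[OF \<xi> r] u by (intro mult_mono) auto
          then have "ennreal (k \<xi> u / u) \<le> ennreal (k \<xi> r * (c / r))" by (intro ennreal_leI) simp
          then show ?thesis using True u' by simp
        qed (auto simp: indicator_def)
      qed
      also have "\<dots> = ennreal (k \<xi> r * (c / r)) * ennreal (50 * r / c - r / c)"
        using r c by (simp add: nn_integral_cmult_indicator divide_right_mono)
      also have "\<dots> = ennreal (k \<xi> r * (c / r) * (50 * r / c - r / c))"
        using r c k0[OF \<xi> r] by (intro ennreal_mult[symmetric]) (auto simp: divide_right_mono)
      also have "k \<xi> r * (c / r) * (50 * r / c - r / c) = 49 * k \<xi> r"
        using r c by (simp add: field_simps)
      finally show ?thesis .
    qed
  qed
  also have "\<dots> = ennreal (LINT \<xi>|\<sigma>. 49 * k \<xi> r)"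
    using int k0 r by (intro nn_integral_eq_integral integrable_mult_right AE_I2) (auto simp: polar_space[OF P])
  finally show ?thesis by simp
qed

text \<open>With d the dimension, every unit vector has a coordinate c of modulus at least 1 / d, so
  its ray meets the corresponding slab before 10 * d * r, where k is at least its value at that
  point. The length 5 * r / c times the lower bound c / (10 * r) of 1 / u gives the 1 / 2.\<close>

lemma polar_lower:
  fixes \<nu> :: "(real ^ 'n) measure"
  assumes P: "polar_decomposition \<nu> \<sigma> k" and r: "r > 0"
    and int: "integrable \<sigma> (\<lambda>\<xi>. k \<xi> (10 * real CARD('n) * r))"
  shows "ennreal (1 / 2 * (LINT \<xi>|\<sigma>. k \<xi> (10 * real CARD('n) * r))) \<le>
    (\<Sum>i\<in>UNIV. emeasure \<nu> {x. 5 * r \<le> \<bar>x $ i\<bar> \<and> \<bar>x $ i\<bar> \<le> 10 * r})"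
proof -
  define d where "d = real CARD('n)"
  have d: "d \<ge> 1" unfolding d_def by (simp add: Suc_leI)
  let ?B = "\<lambda>i. {x :: real ^ 'n. 5 * r \<le> \<bar>x $ i\<bar> \<and> \<bar>x $ i\<bar> \<le> 10 * r}"
  let ?R = "10 * d * r"
  have R: "?R > 0" using d r by simp
  have k0: "k \<xi> u \<ge> 0" if "\<xi> \<in> sphere 0 1" "u > 0" for \<xi> u using P that by (auto simp: polar_decomposition_def)
  have km: "k \<xi> v \<le> k \<xi> u" if "\<xi> \<in> sphere 0 1" "u > 0" "u \<le> v" for \<xi> u v
    using P that by (auto simp: polar_decomposition_def monotone_on_def)
  have [measurable_cong]: "sets \<sigma> = sets (restrict_space borel (sphere 0 1))" and
    [measurable]: "(\<lambda>\<xi>. k \<xi> ?R) \<in> borel_measurable \<sigma>"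
    using P R by (auto simp: polar_decomposition_def)
  have [measurable]: "(\<lambda>\<xi> :: real ^ 'n. \<xi> $ i) \<in> borel_measurable (restrict_space borel (sphere 0 1))" for i :: 'n
    by (intro measurable_restrict_space1) measurable
  let ?E = "\<lambda>i. {\<xi> \<in> space \<sigma>. 1 / d \<le> \<bar>\<xi> $ i\<bar>}"
  have E: "?E i \<in> sets \<sigma>" for i by measurable
  have "ennreal (1 / 2 * (LINT \<xi>|\<sigma>. k \<xi> ?R)) = (\<integral>\<^sup>+\<xi>. ennreal (1 / 2 * k \<xi> ?R) \<partial>\<sigma>)"
    using int k0 R by (subst nn_integral_eq_integral) (auto simp: polar_space[OF P] d_def intro!: AE_I2 integrable_mult_right)
  also have "\<dots> \<le> (\<integral>\<^sup>+\<xi>. (\<Sum>i\<in>UNIV. ennreal (1 / 2 * k \<xi> ?R) * indicator (?E i) \<xi>) \<partial>\<sigma>)"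
  proof (rule nn_integral_mono)
    fix \<xi> assume s: "\<xi> \<in> space \<sigma>"
    then have \<xi>: "norm \<xi> = 1" by (simp add: polar_space[OF P])
    have "\<exists>i. 1 / d \<le> \<bar>\<xi> $ i\<bar>"
    proof (rule ccontr)
      assume "\<not> (\<exists>i. 1 / d \<le> \<bar>\<xi> $ i\<bar>)"
      then have "(\<Sum>i\<in>UNIV. \<bar>\<xi> $ i\<bar>) < (\<Sum>i\<in>(UNIV :: 'n set). 1 / d)" by (intro sum_strict_mono) (auto simp: not_le)
      also have "\<dots> = 1" using d by (simp add: d_def)
      finally show False using norm_le_l1_cart[of \<xi>] \<xi> by simp
    qed
    then obtain i where i: "1 / d \<le> \<bar>\<xi> $ i\<bar>" by blast
    have "ennreal (1 / 2 * k \<xi> ?R) = ennreal (1 / 2 * k \<xi> ?R) * indicator (?E i) \<xi>" using i s by simp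
    also have "\<dots> \<le> (\<Sum>i\<in>UNIV. ennreal (1 / 2 * k \<xi> ?R) * indicator (?E i) \<xi>)"
      by (rule member_le_sum) auto
    finally show "ennreal (1 / 2 * k \<xi> ?R) \<le> (\<Sum>i\<in>UNIV. ennreal (1 / 2 * k \<xi> ?R) * indicator (?E i) \<xi>)" .
  qed
  also have "\<dots> = (\<Sum>i\<in>UNIV. (\<integral>\<^sup>+\<xi>. ennreal (1 / 2 * k \<xi> ?R) * indicator (?E i) \<xi> \<partial>\<sigma>))"
    using E by (intro nn_integral_sum) measurable
  also have "\<dots> \<le> (\<Sum>i\<in>UNIV. emeasure \<nu> (?B i))"
  proof (rule sum_mono)
    fix i :: 'n
    have "(\<integral>\<^sup>+\<xi>. ennreal (1 / 2 * k \<xi> ?R) * indicator (?E i) \<xi> \<partial>\<sigma>) \<le>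
        (\<integral>\<^sup>+\<xi>. (\<integral>\<^sup>+u\<in>{0<..}. indicator (?B i) (u *\<^sub>R \<xi>) * ennreal (k \<xi> u / u) \<partial>lborel) \<partial>\<sigma>)"
    proof (rule nn_integral_mono)
      fix \<xi> assume s: "\<xi> \<in> space \<sigma>"
      then have \<xi>: "\<xi> \<in> sphere 0 1" by (simp add: polar_space[OF P])
      define c where "c = \<bar>\<xi> $ i\<bar>"
      show "ennreal (1 / 2 * k \<xi> ?R) * indicator (?E i) \<xi> \<le>
          (\<integral>\<^sup>+u\<in>{0<..}. indicator (?B i) (u *\<^sub>R \<xi>) * ennreal (k \<xi> u / u) \<partial>lborel)"
      proof (cases "\<xi> \<in> ?E i")
        case True
        then have cd: "1 / d \<le> c" by (simp add: c_def)
        then have c: "c > 0" using d by (meson less_le_trans zero_less_divide_1_iff zero_less_one)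
        have kR: "k \<xi> ?R \<ge> 0" using k0[OF \<xi> R] .
        have "1 / 2 * k \<xi> ?R = k \<xi> ?R * (c / (10 * r)) * (10 * r / c - 5 * r / c)"
          using r c by (simp add: field_simps)
        then have "ennreal (1 / 2 * k \<xi> ?R) = ennreal (k \<xi> ?R * (c / (10 * r)) * (10 * r / c - 5 * r / c))"
          by (simp only:)
        also have "\<dots> = ennreal (k \<xi> ?R * (c / (10 * r))) * ennreal (10 * r / c - 5 * r / c)"
          using r c kR by (intro ennreal_mult) (auto simp: divide_right_mono)
        also have "\<dots> = (\<integral>\<^sup>+u. ennreal (k \<xi> ?R * (c / (10 * r))) * indicator {5 * r / c..10 * r / c} u \<partial>lborel)"
          using r c by (simp add: nn_integral_cmult_indicator divide_right_mono)
        also have "\<dots> \<le> (\<integral>\<^sup>+u\<in>{0<..}. indicator (?B i) (u *\<^sub>R \<xi>) * ennreal (k \<xi> u / u) \<partial>lborel)"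
        proof (rule nn_integral_mono)
          fix u :: real
          show "ennreal (k \<xi> ?R * (c / (10 * r))) * indicator {5 * r / c..10 * r / c} u \<le>
            indicator (?B i) (u *\<^sub>R \<xi>) * ennreal (k \<xi> u / u) * indicator {0<..} u"
          proof (cases "u \<in> {5 * r / c..10 * r / c}")
            case True
            then have u: "5 * r \<le> u * c" "u * c \<le> 10 * r" using c by (simp_all add: pos_divide_le_eq pos_le_divide_eq)
            have "5 * r / c > 0" using r c by simp
            then have u0: "u > 0" using True by (simp del: zero_less_divide_iff) 
            have uB: "u *\<^sub>R \<xi> \<in> ?B i" using u u0 by (simp add: abs_mult c_def)
            have "u * (1 / d) \<le> u * c" using cd u0 by (intro mult_left_mono) auto
            then have "u / d \<le> 10 * r" using u by simp
            then have "u \<le> ?R" using d by (simp add: field_simps)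
            then have "k \<xi> ?R \<le> k \<xi> u" using u0 by (intro km[OF \<xi>]) auto
            moreover have "c / (10 * r) \<le> 1 / u" using u r u0 by (simp add: field_simps)
            ultimately have "k \<xi> ?R * (c / (10 * r)) \<le> k \<xi> u * (1 / u)"
              using k0[OF \<xi> u0] r c by (intro mult_mono) auto
            then have "ennreal (k \<xi> ?R * (c / (10 * r))) \<le> ennreal (k \<xi> u / u)" by (intro ennreal_leI) simp
            then show ?thesis using True uB u0 by simp
          qed simp
        qed
        finally show ?thesis using True by simp
      qed simp
    qed
    also have "\<dots> = emeasure \<nu> (?B i)" by (rule polar_emeasure[OF P slab_sets, symmetric])
    finally show "(\<integral>\<^sup>+\<xi>. ennreal (1 / 2 * k \<xi> ?R) * indicator (?E i) \<xi> \<partial>\<sigma>) \<le> emeasure \<nu> (?B i)" .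
  qed
  finally show ?thesis by (simp only: d_def)
qed

text \<open>For b powr H = 10 the second term accounts for X (1 / b), whose Levy measure is the
  image of \<nu> under division by 10. So this is the integral of \<open>cutoff\<close> of the
  scaled coordinate against the Levy measure of X 1 - X (1 / b).\<close>

definition cutoff_mass :: "(real ^ 'n) measure \<Rightarrow> 'n \<Rightarrow> real \<Rightarrow> real" where
  "cutoff_mass \<nu> i r = (\<integral>x. cutoff (x $ i / r) - cutoff (x $ i / r / 10) \<partial>\<nu>)"

lemma cutoff_mass_bounds:
  fixes \<nu> :: "(real ^ 'n) measure"
  assumes L: "levy_measure_of \<mu> \<nu>" and P: "polar_decomposition \<nu> \<sigma> k" and r: "r > 0"
    and int: "\<And>r. r > 0 \<Longrightarrow> integrable \<sigma> (\<lambda>\<xi>. k \<xi> r)"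
  shows "cutoff_mass \<nu> i r \<le> 49 * (LINT \<xi>|\<sigma>. k \<xi> r)"
    and "1 / 2 * (LINT \<xi>|\<sigma>. k \<xi> (10 * real CARD('n) * r)) \<le> (\<Sum>i\<in>UNIV. cutoff_mass \<nu> i r)"
proof -
  note [measurable_cong] = levy_measure_sets[OF L]
  let ?B = "\<lambda>i. {x :: real ^ 'n. 5 * r \<le> \<bar>x $ i\<bar> \<and> \<bar>x $ i\<bar> \<le> 10 * r}"
  let ?C = "\<lambda>i. {x :: real ^ 'n. r \<le> \<bar>x $ i\<bar> \<and> \<bar>x $ i\<bar> \<le> 50 * r}"
  have sets: "?B i \<in> sets \<nu>" "?C i \<in> sets \<nu>" for i by measurable
  have "integrable \<nu> (\<lambda>x. cutoff (x $ i / s))" for s i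
    by (rule cutoff_fubini(1)[OF levy_measure_sigma_finite[OF L] _ levy_coordinate_integrable[OF L]]) measurable
  from this[of _ r] this[of _ "10 * r"]
  have I: "integrable \<nu> (\<lambda>x. cutoff (x $ i / r) - cutoff (x $ i / r / 10))" for i
    by (intro Bochner_Integration.integrable_diff) (simp_all add: mult.commute)
  have up: "emeasure \<nu> (?C i) \<le> ennreal (49 * (LINT \<xi>|\<sigma>. k \<xi> r))" for i
    by (rule polar_upper[OF P r int[OF r]])
  have K0: "0 \<le> (LINT \<xi>|\<sigma>. k \<xi> s)" if "s > 0" for s
    using P that by (intro integral_nonneg_AE AE_I2) (auto simp: polar_decomposition_def polar_space[OF P])
  have Cfin: "emeasure \<nu> (?C i) < \<infinity>" for i using up[of i] by (rule le_less_trans) simp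
  have "emeasure \<nu> (?B i) \<le> emeasure \<nu> (?C i)" for i
    using r sets by (intro emeasure_mono) auto
  then have Bfin: "emeasure \<nu> (?B i) < \<infinity>" for i using Cfin[of i] by (rule le_less_trans)
  have scale: "indicator {l..h} \<bar>x / r\<bar> = (indicator {l * r..h * r} \<bar>x\<bar> :: real)" for l h x
    using r by (simp add: indicator_def pos_divide_le_eq pos_le_divide_eq)
  show "cutoff_mass \<nu> i r \<le> 49 * (LINT \<xi>|\<sigma>. k \<xi> r)"
  proof -
    have "cutoff_mass \<nu> i r \<le> (\<integral>x. indicator (?C i) x \<partial>\<nu>)"
      unfolding cutoff_mass_def
    proof (rule integral_mono[OF I])
      show "integrable \<nu> (indicator (?C i) :: _ \<Rightarrow> real)" using Cfin sets by (simp add: integrable_indicator_iff)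
      show "cutoff (x $ i / r) - cutoff (x $ i / r / 10) \<le> indicator (?C i) x" for x
        using cutoff_difference(1)[of "x $ i / r"] unfolding scale by (simp add: indicator_def)
    qed
    also have "\<dots> = measure \<nu> (?C i)" using sets_eq_imp_space_eq[OF levy_measure_sets[OF L]] by simp
    also have "\<dots> \<le> 49 * (LINT \<xi>|\<sigma>. k \<xi> r)"
      using up[of i] K0[OF r] by (simp add: measure_def enn2real_leI)
    finally show ?thesis .
  qed
  have low: "measure \<nu> (?B i) \<le> cutoff_mass \<nu> i r" for i
  proof -
    have "measure \<nu> (?B i) = (\<integral>x. indicator (?B i) x \<partial>\<nu>)"
      using sets_eq_imp_space_eq[OF levy_measure_sets[OF L]] by simp
    also have "\<dots> \<le> cutoff_mass \<nu> i r"
      unfolding cutoff_mass_def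
    proof (rule integral_mono[OF _ I])
      show "integrable \<nu> (indicator (?B i) :: _ \<Rightarrow> real)" using Bfin sets by (simp add: integrable_indicator_iff)
      show "indicator (?B i) x \<le> cutoff (x $ i / r) - cutoff (x $ i / r / 10)" for x
        using cutoff_difference(2)[of "x $ i / r"] unfolding scale by (simp add: indicator_def)
    qed
    finally show ?thesis .
  qed
  let ?R = "10 * real CARD('n) * r"
  have "?R > 0" using r by simp
  have "ennreal (1 / 2 * (LINT \<xi>|\<sigma>. k \<xi> ?R)) \<le> (\<Sum>i\<in>UNIV. emeasure \<nu> (?B i))"
    by (rule polar_lower[OF P r int[OF \<open>?R > 0\<close>]])
  also have "\<dots> = (\<Sum>i\<in>UNIV. ennreal (measure \<nu> (?B i)))"
    using Bfin by (intro sum.cong refl emeasure_eq_ennreal_measure) (simp add: less_top)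
  also have "\<dots> = ennreal (\<Sum>i\<in>UNIV. measure \<nu> (?B i))" by (rule sum_ennreal) simp
  finally have "1 / 2 * (LINT \<xi>|\<sigma>. k \<xi> ?R) \<le> (\<Sum>i\<in>UNIV. measure \<nu> (?B i))"
    by (subst (asm) ennreal_le_iff) (auto intro: sum_nonneg)
  also have "\<dots> \<le> (\<Sum>i\<in>UNIV. cutoff_mass \<nu> i r)" using low by (intro sum_mono)
  finally show "1 / 2 * (LINT \<xi>|\<sigma>. k \<xi> ?R) \<le> (\<Sum>i\<in>UNIV. cutoff_mass \<nu> i r)" .
qed

section \<open>Jumps of the process and the function K\<close>

lemma borel_measurable_vec_nth_comp [measurable (raw)]:
  fixes f :: "'a \<Rightarrow> real ^ 'n"
  assumes "f \<in> borel_measurable M"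
  shows "(\<lambda>x. f x $ i) \<in> borel_measurable M"
  by (rule measurable_compose[OF assms]) measurable

context selfsimilar_additive_process
begin

declare random_variable [measurable del]

lemma char_scale:
  assumes "s > 0"
  shows "(CLINT \<omega>|M. iexp (t * X s \<omega> $ i)) = (CLINT \<omega>|M. iexp (s powr H * t * X 1 \<omega> $ i))"
proof -
  have [measurable]: "X s \<in> borel_measurable M" "X 1 \<in> borel_measurable M"
    using assms by (simp_all add: random_variable)
  have m: "(\<lambda>x :: real ^ 'n. iexp (t * x $ i)) \<in> borel_measurable borel" by measurable
  have "(CLINT \<omega>|M. iexp (t * X s \<omega> $ i)) = (CLINT x|distr M borel (X s). iexp (t * x $ i))"
    using random_variable[of s] assms by (subst integral_distr) (simp_all add: m)
  also have "distr M borel (X s) = distr M borel (\<lambda>\<omega>. (s powr H) *\<^sub>R X 1 \<omega>)"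
    using distr_scale_single[OF assms, of 1] by simp
  also have "(CLINT x|distr M borel (\<lambda>\<omega>. (s powr H) *\<^sub>R X 1 \<omega>). iexp (t * x $ i)) =
      (CLINT \<omega>|M. iexp (t * ((s powr H) *\<^sub>R X 1 \<omega>) $ i))"
    using random_variable[of 1] by (subst integral_distr) (simp_all add: m)
  also have "(\<lambda>\<omega>. t * ((s powr H) *\<^sub>R X 1 \<omega>) $ i) = (\<lambda>\<omega>. s powr H * t * X 1 \<omega> $ i)" by auto
  finally show ?thesis .
qed

lemma char_distr:
  "Y \<in> borel_measurable M \<Longrightarrow> char (distr M borel Y) t = (CLINT \<omega>|M. iexp (t * Y \<omega>))"
  unfolding char_def by (subst integral_distr) auto

lemma char_increment:
  assumes "0 < s" "s < t"
  shows "(CLINT \<omega>|M. iexp (u * X t \<omega> $ i)) =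
    (CLINT \<omega>|M. iexp (u * X s \<omega> $ i)) * (CLINT \<omega>|M. iexp (u * (X t \<omega> - X s \<omega>) $ i))"
proof -
  have [measurable]: "X s \<in> borel_measurable M" "X t \<in> borel_measurable M" "X 0 \<in> borel_measurable M"
    using assms by (auto intro: random_variable)
  let ?A = "\<lambda>\<omega>. (X s \<omega> - X 0 \<omega>) $ i" and ?B = "\<lambda>\<omega>. (X t \<omega> - X s \<omega>) $ i"
  have n: "(\<lambda>x :: real ^ 'n. x $ i) \<in> borel_measurable borel" by measurable
  have "indep_var borel ((\<lambda>x. x $ i) \<circ> (\<lambda>\<omega>. X s \<omega> - X 0 \<omega>)) borel ((\<lambda>x. x $ i) \<circ> (\<lambda>\<omega>. X t \<omega> - X s \<omega>))"
    by (rule indep_var_compose[OF indep_var_increment[OF assms] n n])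
  then have "indep_var borel ?A borel ?B" by (simp add: comp_def)
  from char_distr_add[OF this, of u]
  have "(CLINT \<omega>|M. iexp (u * (?A \<omega> + ?B \<omega>))) = (CLINT \<omega>|M. iexp (u * ?A \<omega>)) * (CLINT \<omega>|M. iexp (u * ?B \<omega>))"
    by (subst (asm) (1 2 3) char_distr) measurable
  moreover have "(CLINT \<omega>|M. iexp (u * (?A \<omega> + ?B \<omega>))) = (CLINT \<omega>|M. iexp (u * X t \<omega> $ i))"
    by (rule integral_cong_AE; measurable) (use AE_X_0 in eventually_elim, simp)
  moreover have "(CLINT \<omega>|M. iexp (u * ?A \<omega>)) = (CLINT \<omega>|M. iexp (u * X s \<omega> $ i))"
    by (rule integral_cong_AE; measurable) (use AE_X_0 in eventually_elim, simp)
  ultimately show ?thesis by simp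
qed

text \<open>\<Theta> is minus the logarithm of the modulus of the characteristic function of the
  i-th coordinate of X 1. Scaling gives it at other times, independence gives the increments by
  division, and monotonicity says that a characteristic function has modulus at most 1.\<close>

lemma levy_exponent:
  assumes L: "levy_measure_of (distr M borel (X 1)) \<nu>"
  obtains q \<Theta> where "q \<ge> 0" "\<And>t. \<Theta> t = q * t\<^sup>2 / 2 + (\<integral>x. 1 - cos (t * x $ i) \<partial>\<nu>)"
    "continuous_on UNIV \<Theta>" "\<And>t. \<Theta> t \<ge> 0"
    "\<And>s t u. 0 < s \<Longrightarrow> s < t \<Longrightarrow> (cmod (CLINT \<omega>|M. iexp (u * (X t \<omega> - X s \<omega>) $ i)))\<^sup>2 =
        exp (- 2 * (\<Theta> (t powr H * u) - \<Theta> (s powr H * u)))"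
    "\<And>s t u. 0 < s \<Longrightarrow> s < t \<Longrightarrow> \<Theta> (s powr H * u) \<le> \<Theta> (t powr H * u)"
proof -
  have [measurable]: "X 1 \<in> borel_measurable M" by (rule random_variable) simp
  obtain q where q: "q \<ge> 0" and c: "\<And>t. cmod (CLINT x|distr M borel (X 1). iexp (t * x $ i)) =
      exp (- (q * t\<^sup>2 / 2 + (\<integral>x. 1 - cos (t * x $ i) \<partial>\<nu>)))"
    using cmod_char_levy[OF L, of i] by blast
  define \<Theta> where "\<Theta> t = q * t\<^sup>2 / 2 + (\<integral>x. 1 - cos (t * x $ i) \<partial>\<nu>)" for t
  have m: "(\<lambda>x :: real ^ 'n. iexp (t * x $ i)) \<in> borel_measurable borel" for t by measurable
  have c1: "cmod (CLINT \<omega>|M. iexp (t * X 1 \<omega> $ i)) = exp (- \<Theta> t)" for t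
    using c[of t] by (subst (asm) integral_distr) (measurable, simp_all add: m \<Theta>_def)
  have cs: "cmod (CLINT \<omega>|M. iexp (t * X s \<omega> $ i)) = exp (- \<Theta> (s powr H * t))" if "s > 0" for s t
    unfolding char_scale[OF that] c1 ..
  have \<Theta>0: "\<Theta> t \<ge> 0" for t
    using q by (auto simp: \<Theta>_def intro!: add_nonneg_nonneg integral_nonneg_AE)
  have inc: "cmod (CLINT \<omega>|M. iexp (u * (X t \<omega> - X s \<omega>) $ i)) = exp (- (\<Theta> (t powr H * u) - \<Theta> (s powr H * u)))"
    if "0 < s" "s < t" for s t u
  proof -
    have "exp (- \<Theta> (t powr H * u)) = exp (- \<Theta> (s powr H * u)) * cmod (CLINT \<omega>|M. iexp (u * (X t \<omega> - X s \<omega>) $ i))"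
      using arg_cong[OF char_increment[OF that, of u i], of cmod] that
      by (simp only: norm_mult cs[OF that(1)] cs[OF less_trans[OF that]])
    then have "cmod (CLINT \<omega>|M. iexp (u * (X t \<omega> - X s \<omega>) $ i)) = exp (- \<Theta> (t powr H * u)) / exp (- \<Theta> (s powr H * u))"
      by simp
    also have "\<dots> = exp (- (\<Theta> (t powr H * u) - \<Theta> (s powr H * u)))"
      by (simp flip: exp_diff)
    finally show ?thesis .
  qed
  show thesis
  proof (rule that[OF q \<Theta>_def _ \<Theta>0])
    have rd: "real_distribution (distr M borel (\<lambda>\<omega>. X 1 \<omega> $ i))"
      by (rule real_distribution_distr) measurable
    \<comment> \<open>Continuity is inherited from the characteristic function, which has no
      zeros.\<close>
    have e: "\<Theta> = (\<lambda>t. - ln (cmod (char (distr M borel (\<lambda>\<omega>. X 1 \<omega> $ i)) t)))"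
    proof
      fix t
      have "cmod (char (distr M borel (\<lambda>\<omega>. X 1 \<omega> $ i)) t) = exp (- \<Theta> t)"
        by (subst char_distr) (measurable, rule c1)
      then show "\<Theta> t = - ln (cmod (char (distr M borel (\<lambda>\<omega>. X 1 \<omega> $ i)) t))" by simp
    qed
    have nz: "cmod (char (distr M borel (\<lambda>\<omega>. X 1 \<omega> $ i)) t) \<noteq> 0" for t
    proof -
      have "cmod (char (distr M borel (\<lambda>\<omega>. X 1 \<omega> $ i)) t) = exp (- \<Theta> t)"
        by (subst char_distr) (measurable, rule c1)
      then show ?thesis by simp
    qed
    have "continuous_on UNIV (char (distr M borel (\<lambda>\<omega>. X 1 \<omega> $ i)))"
      using real_distribution.isCont_char[OF rd] by (intro continuous_at_imp_continuous_on) blast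
    with nz show "continuous_on UNIV \<Theta>"
      unfolding e by (intro continuous_intros) auto
    show "(cmod (CLINT \<omega>|M. iexp (u * (X t \<omega> - X s \<omega>) $ i)))\<^sup>2 =
        exp (- 2 * (\<Theta> (t powr H * u) - \<Theta> (s powr H * u)))" if "0 < s" "s < t" for s t u
      unfolding inc[OF that] by (simp flip: exp_of_nat_mult add: power2_eq_square exp_add[symmetric])
    show "\<Theta> (s powr H * u) \<le> \<Theta> (t powr H * u)" if st: "0 < s" "s < t" for s t u
    proof -
      have [measurable]: "X s \<in> borel_measurable M" "X t \<in> borel_measurable M"
        using st by (auto intro: random_variable)
      have "cmod (CLINT \<omega>|M. iexp (u * (X t \<omega> - X s \<omega>) $ i)) \<le> (\<integral>\<omega>. cmod (iexp (u * (X t \<omega> - X s \<omega>) $ i)) \<partial>M)"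
        by (rule integral_norm_bound)
      also have "\<dots> = 1" by (simp add: prob_space)
      finally show ?thesis unfolding inc[OF st] by simp
    qed
  qed
qed

text \<open>In Fourier form the sum has, for fixed t, the limit 2 * (\<Theta> (t / r) - \<Theta> (t
  / (10 * r))) and the bound 2 * \<Theta> (t / r), which is integrable against the kernel; so
  dominated convergence applies. The factor 2 is the square of the modulus, that is, the
  symmetrisation.\<close>

lemma sym_cutoff_sum_tendsto:
  assumes L: "levy_measure_of (distr M borel (X 1)) \<nu>" and b: "b > 1" "b powr H = 10" and r: "r > 0"
  shows "(\<lambda>n. \<Sum>k<n. sym_cutoff (\<lambda>\<omega>. (X (b powr (real (Suc k) / real n - 1)) \<omega> - X (b powr (real k / real n - 1)) \<omega>) $ i) r)
    \<longlonglongrightarrow> 2 * cutoff_mass \<nu> i r"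
proof -
  obtain q \<Theta> where q: "q \<ge> 0" and \<Theta>: "\<And>t. \<Theta> t = q * t\<^sup>2 / 2 + (\<integral>x. 1 - cos (t * x $ i) \<partial>\<nu>)"
    and cont: "continuous_on UNIV \<Theta>" and \<Theta>0: "\<And>t. \<Theta> t \<ge> 0"
    and sq: "\<And>s t u. 0 < s \<Longrightarrow> s < t \<Longrightarrow> (cmod (CLINT \<omega>|M. iexp (u * (X t \<omega> - X s \<omega>) $ i)))\<^sup>2 =
        exp (- 2 * (\<Theta> (t powr H * u) - \<Theta> (s powr H * u)))"
    and mono: "\<And>s t u. 0 < s \<Longrightarrow> s < t \<Longrightarrow> \<Theta> (s powr H * u) \<le> \<Theta> (t powr H * u)"
    using levy_exponent[OF L, of i] by blast
  have [measurable]: "\<Theta> \<in> borel_measurable borel" using cont by (rule borel_measurable_continuous_onI)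
  note [measurable_cong] = levy_measure_sets[OF L]
  define \<tau> where "\<tau> n k = b powr (real k / real n - 1)" for n k :: nat
  have \<tau>0: "\<tau> n k > 0" for n k using b by (simp add: \<tau>_def)
  have \<tau>lt: "\<tau> n k < \<tau> n (Suc k)" if "k < n" for n k
    unfolding \<tau>_def using b that by (intro powr_less_mono) (auto simp: divide_strict_right_mono)
  \<comment> \<open>As b powr H = 10, the scale factors run from 1 / 10 to 1 along the grid; these
    end points produce the two scales of \<open>cutoff_mass\<close>.\<close>
  have \<tau>H: "\<tau> n k powr H = 10 powr (real k / real n - 1)" for n k
    using b by (simp add: \<tau>_def powr_powr mult.commute flip: b(2))
  define p where "p u x = \<Theta> (10 powr (x - 1) * u)" for u x :: real
  have p\<tau>: "\<Theta> (\<tau> n k powr H * u) = p u (real k / real n)" for n k u by (simp add: p_def \<tau>H)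
  have pmono: "p u (real k / real n) \<le> p u (real (Suc k) / real n)" if "k < n" for k n u
    using mono[OF \<tau>0 \<tau>lt[OF that], of u] by (simp only: p\<tau>)
  have pcont: "continuous_on {0..1} (p u)" for u
    unfolding p_def by (intro continuous_on_compose2[OF cont] continuous_intros) auto
  have p01: "p u 1 = \<Theta> u" "p u 0 = \<Theta> (u / 10)" for u
    by (simp_all add: p_def powr_minus field_simps)
  let ?Y = "\<lambda>n k \<omega>. (X (\<tau> n (Suc k)) \<omega> - X (\<tau> n k) \<omega>) $ i"
  have Ym: "?Y n k \<in> borel_measurable M" for n k
  proof -
    have [measurable]: "X (\<tau> n k) \<in> borel_measurable M" for n k
      using \<tau>0[of n k] by (intro random_variable) simp
    show ?thesis by measurable
  qed
  define S where "S n u = (\<Sum>k<n. 1 - exp (- 2 * (p u (real (Suc k) / real n) - p u (real k / real n))))" for n u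
  have summand: "1 - (cmod (CLINT \<omega>|M. iexp (u * ?Y n k \<omega>)))\<^sup>2 = 1 - exp (- 2 * (p u (real (Suc k) / real n) - p u (real k / real n)))"
    if "k < n" for n k u
    unfolding sq[OF \<tau>0 \<tau>lt[OF that]] p\<tau> ..
  have sum_eq: "(\<Sum>k<n. sym_cutoff (?Y n k) r) = (\<integral>t. cutoff_kernel t * S n (t / r) \<partial>lborel)" for n
  proof -
    have "(\<Sum>k<n. sym_cutoff (?Y n k) r) =
        (\<integral>t. (\<Sum>k<n. cutoff_kernel t * (1 - (cmod (CLINT \<omega>|M. iexp (t / r * ?Y n k \<omega>)))\<^sup>2)) \<partial>lborel)"
      unfolding sym_cutoff_def by (rule Bochner_Integration.integral_sum[symmetric]) (rule sym_cutoff_eq(3)[OF Ym])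
    also have "\<dots> = (\<integral>t. cutoff_kernel t * S n (t / r) \<partial>lborel)"
      unfolding S_def sum_distrib_left
      by (intro Bochner_Integration.integral_cong refl sum.cong) (simp only: summand lessThan_iff)
    finally show ?thesis .
  qed
  have Slim: "(\<lambda>n. S n u) \<longlonglongrightarrow> 2 * (\<Theta> u - \<Theta> (u / 10))" for u
    unfolding S_def using sum_one_minus_exp_tendsto[OF pcont pmono, of u] by (simp only: p01)
  have Sbound: "\<bar>S n u\<bar> \<le> 2 * \<Theta> u" for n u
  proof (cases "n = 0")
    case True
    then show ?thesis using \<Theta>0[of u] by (simp add: S_def)
  next
    case False
    have "0 \<le> S n u" unfolding S_def using pmono by (intro sum_nonneg) auto
    moreover have "S n u \<le> (\<Sum>k<n. 2 * (p u (real (Suc k) / real n) - p u (real k / real n)))"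
      unfolding S_def
    proof (rule sum_mono)
      fix k
      show "1 - exp (- 2 * (p u (real (Suc k) / real n) - p u (real k / real n))) \<le>
          2 * (p u (real (Suc k) / real n) - p u (real k / real n))"
        using exp_ge_add_one_self[of "- 2 * (p u (real (Suc k) / real n) - p u (real k / real n))"] by linarith
    qed
    moreover have "(\<Sum>k<n. 2 * (p u (real (Suc k) / real n) - p u (real k / real n))) = 2 * (p u (real n / real n) - p u (real 0 / real n))"
      unfolding sum_distrib_left[symmetric]
      by (subst sum_lessThan_telescope[of "\<lambda>k. p u (real k / real n)"]) (rule refl)
    moreover have "\<dots> \<le> 2 * \<Theta> u" using False p01 \<Theta>0[of "u / 10"] by simp
    ultimately show ?thesis by linarith
  qed
  have J: "integrable lborel (\<lambda>t. cutoff_kernel t * (\<integral>x. 1 - cos (t / s * x $ i) \<partial>\<nu>))"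
    "(\<integral>t. cutoff_kernel t * (\<integral>x. 1 - cos (t / s * x $ i) \<partial>\<nu>) \<partial>lborel) = (\<integral>x. cutoff (x $ i / s) \<partial>\<nu>)"
    "integrable \<nu> (\<lambda>x. cutoff (x $ i / s))" for s
  proof -
    have m: "(\<lambda>x. x $ i / s) \<in> borel_measurable \<nu>" by measurable
    note F = cutoff_fubini[OF levy_measure_sigma_finite[OF L] m levy_coordinate_integrable[OF L]]
    show "integrable lborel (\<lambda>t. cutoff_kernel t * (\<integral>x. 1 - cos (t / s * x $ i) \<partial>\<nu>))"
      "(\<integral>t. cutoff_kernel t * (\<integral>x. 1 - cos (t / s * x $ i) \<partial>\<nu>) \<partial>lborel) = (\<integral>x. cutoff (x $ i / s) \<partial>\<nu>)"
      "integrable \<nu> (\<lambda>x. cutoff (x $ i / s))"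
      using F by simp_all
  qed
  \<comment> \<open>The Gaussian part of the exponent contributes 0 because the kernel has second
    moment 0.\<close>
  have K2: "has_bochner_integral lborel (\<lambda>t. q / (2 * s\<^sup>2) * (t\<^sup>2 * cutoff_kernel t)) (q / (2 * s\<^sup>2) * 0)" for s
    by (intro has_bochner_integral_mult_right cutoff_kernel_second_moment)
  have \<Theta>K: "has_bochner_integral lborel (\<lambda>t. cutoff_kernel t * \<Theta> (t / s)) (\<integral>x. cutoff (x $ i / s) \<partial>\<nu>)" for s
  proof -
    have "has_bochner_integral lborel (\<lambda>t. q / (2 * s\<^sup>2) * (t\<^sup>2 * cutoff_kernel t) +
        cutoff_kernel t * (\<integral>x. 1 - cos (t / s * x $ i) \<partial>\<nu>)) (q / (2 * s\<^sup>2) * 0 + (\<integral>x. cutoff (x $ i / s) \<partial>\<nu>))"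
      using J[of s] by (intro has_bochner_integral_add K2) (simp add: has_bochner_integral_iff)
    then show ?thesis by (simp add: \<Theta> power_divide algebra_simps)
  qed
  have "(\<lambda>n. \<integral>t. cutoff_kernel t * S n (t / r) \<partial>lborel) \<longlonglongrightarrow>
      (\<integral>t. cutoff_kernel t * (2 * (\<Theta> (t / r) - \<Theta> (t / r / 10))) \<partial>lborel)"
  proof (rule integral_dominated_convergence)
    have [measurable]: "p u x = \<Theta> (10 powr (x - 1) * u)" for u x by (rule p_def)
    show "(\<lambda>t. cutoff_kernel t * (2 * (\<Theta> (t / r) - \<Theta> (t / r / 10)))) \<in> borel_measurable lborel" by measurable
    show "(\<lambda>t. cutoff_kernel t * S n (t / r)) \<in> borel_measurable lborel" for n
      unfolding S_def p_def by measurable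
    have "integrable lborel (\<lambda>t. 2 * \<bar>cutoff_kernel t * \<Theta> (t / r)\<bar>)"
      using \<Theta>K[of r] by (intro integrable_mult_right integrable_abs) (simp add: has_bochner_integral_iff)
    then show "integrable lborel (\<lambda>t. \<bar>cutoff_kernel t\<bar> * (2 * \<Theta> (t / r)))"
      using \<Theta>0 by (simp add: abs_mult mult_ac)
    show "AE t in lborel. (\<lambda>n. cutoff_kernel t * S n (t / r)) \<longlonglongrightarrow> cutoff_kernel t * (2 * (\<Theta> (t / r) - \<Theta> (t / r / 10)))"
      by (intro AE_I2 tendsto_mult tendsto_const Slim)
    show "AE t in lborel. norm (cutoff_kernel t * S n (t / r)) \<le> \<bar>cutoff_kernel t\<bar> * (2 * \<Theta> (t / r))" for n
      unfolding real_norm_def abs_mult by (intro AE_I2 mult_left_mono Sbound abs_ge_zero)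
  qed
  moreover have "(\<integral>t. cutoff_kernel t * (2 * (\<Theta> (t / r) - \<Theta> (t / r / 10))) \<partial>lborel) = 2 * cutoff_mass \<nu> i r"
  proof -
    have "has_bochner_integral lborel (\<lambda>t. 2 * (cutoff_kernel t * \<Theta> (t / r) - cutoff_kernel t * \<Theta> (t / (r * 10))))
        (2 * ((\<integral>x. cutoff (x $ i / r) \<partial>\<nu>) - (\<integral>x. cutoff (x $ i / (r * 10)) \<partial>\<nu>)))"
      by (intro has_bochner_integral_mult_right has_bochner_integral_diff \<Theta>K)
    then have "(\<integral>t. 2 * (cutoff_kernel t * \<Theta> (t / r) - cutoff_kernel t * \<Theta> (t / (r * 10))) \<partial>lborel) =
        2 * ((\<integral>x. cutoff (x $ i / r) \<partial>\<nu>) - (\<integral>x. cutoff (x $ i / (r * 10)) \<partial>\<nu>))"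
      by (rule has_bochner_integral_integral_eq)
    moreover have "cutoff_mass \<nu> i r = (\<integral>x. cutoff (x $ i / r) \<partial>\<nu>) - (\<integral>x. cutoff (x $ i / (r * 10)) \<partial>\<nu>)"
      unfolding cutoff_mass_def divide_divide_eq_left by (intro Bochner_Integration.integral_diff J(3))
    ultimately show ?thesis by (simp add: right_diff_distrib mult_ac)
  qed
  ultimately show ?thesis unfolding sum_eq[unfolded \<tau>_def, symmetric] by simp
qed

lemma K_bounds:
  fixes K :: "real \<Rightarrow> real"
  assumes K: "K_function_of (distr M borel (X 1)) K" and OR: "K \<in> class_OR"
  obtains \<nu> where "levy_measure_of (distr M borel (X 1)) \<nu>"
    "\<And>i r. r > 0 \<Longrightarrow> cutoff_mass \<nu> i r \<le> 49 * K r"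
    "\<And>r. r > 0 \<Longrightarrow> K (10 * real CARD('n) * r) / 2 \<le> (\<Sum>i\<in>UNIV. cutoff_mass \<nu> i r)"
    "\<And>r s. 0 < r \<Longrightarrow> r \<le> s \<Longrightarrow> K s \<le> K r"
proof -
  have Kpos: "K r > 0" if "r > 0" for r using class_OR_pos[OF OR that] .
  obtain \<nu> where L: "levy_measure_of (distr M borel (X 1)) \<nu>" and
    c: "if \<nu> = null_measure borel then \<forall>r>0. K r = 0
       else \<exists>\<sigma> k. polar_decomposition \<nu> \<sigma> k \<and> (\<forall>r>0. K r = (LINT \<xi>|\<sigma>. k \<xi> r))"
    using K unfolding K_function_of_def by blast
  \<comment> \<open>A vanishing Levy measure would give K = 0, but functions in
    \<open>class_OR\<close> are positive.\<close>
  have "\<nu> \<noteq> null_measure borel" using c Kpos[of 1] by auto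
  with c obtain \<sigma> k where P: "polar_decomposition \<nu> \<sigma> k" and Kk: "\<And>r. r > 0 \<Longrightarrow> K r = (LINT \<xi>|\<sigma>. k \<xi> r)"
    by auto
  \<comment> \<open>The Bochner integral of a non-integrable function is 0, so positivity of K
    yields integrability.\<close>
  have int: "integrable \<sigma> (\<lambda>\<xi>. k \<xi> r)" if "r > 0" for r
    using Kpos[OF that] Kk[OF that] not_integrable_integral_eq[of \<sigma> "\<lambda>\<xi>. k \<xi> r"] by fastforce
  show thesis
  proof (rule that[OF L])
    show "cutoff_mass \<nu> i r \<le> 49 * K r" if "r > 0" for i r
      using cutoff_mass_bounds(1)[OF L P that int] Kk[OF that] by simp
    show "K (10 * real CARD('n) * r) / 2 \<le> (\<Sum>i\<in>UNIV. cutoff_mass \<nu> i r)" if r: "r > 0" for r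
    proof -
      have "10 * real CARD('n) * r > 0" using r by simp
      then show ?thesis using cutoff_mass_bounds(2)[OF L P r int] Kk[of "10 * real CARD('n) * r"] by simp
    qed
    show "K s \<le> K r" if rs: "0 < r" "r \<le> s" for r s
    proof -
      have "s > 0" using rs by simp
      have "(LINT \<xi>|\<sigma>. k \<xi> s) \<le> (LINT \<xi>|\<sigma>. k \<xi> r)"
      proof (rule integral_mono[OF int[OF \<open>s > 0\<close>] int[OF rs(1)]])
        fix \<xi> assume "\<xi> \<in> space \<sigma>"
        then show "k \<xi> s \<le> k \<xi> r"
          using P rs by (auto simp: polar_space[OF P] polar_decomposition_def monotone_on_def)
      qed
      then show ?thesis using Kk rs \<open>s > 0\<close> by simp
    qed
  qed
qed

section \<open>Partitions of the increment over [1 / b, 1]\<close>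

lemma prob_component_le:
  fixes Y :: "'w \<Rightarrow> real ^ 'n"
  assumes [measurable]: "Y \<in> borel_measurable M"
  shows "\<P>(\<omega> in M. \<bar>Y \<omega> $ i\<bar> > r) \<le> \<P>(\<omega> in M. norm (Y \<omega>) > r)"
proof (intro finite_measure_mono subsetI)
  fix \<omega> assume "\<omega> \<in> {\<omega> \<in> space M. \<bar>Y \<omega> $ i\<bar> > r}"
  then show "\<omega> \<in> {\<omega> \<in> space M. norm (Y \<omega>) > r}"
    using component_le_norm_cart[of "Y \<omega>" i] by auto
qed measurable

text \<open>The grid \<open>b powr (k / n - 1)\<close>, \<open>k \<le> n\<close>, cuts the increment over \<open>[1 / b, 1]\<close> into small
  independent pieces; \<open>b\<close> will be chosen with \<open>b powr H = 10\<close>.\<close>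

definition grid_increment :: "real \<Rightarrow> nat \<Rightarrow> nat \<Rightarrow> 'w \<Rightarrow> real ^ 'n" where
  "grid_increment b n k \<omega> = X (b powr (real (Suc k) / real n - 1)) \<omega> - X (b powr (real k / real n - 1)) \<omega>"

lemma grid_increment_measurable [measurable]: "b > 1 \<Longrightarrow> grid_increment b n k \<in> borel_measurable M"
  unfolding grid_increment_def by (intro borel_measurable_diff random_variable) auto

lemma grid_increment_indep:
  assumes "b > 1" "n > 0"
  shows "indep_vars (\<lambda>_. borel) (grid_increment b n) {..<n}"
proof -
  have "strict_mono_on {..n} (\<lambda>k. b powr (real k / real n - 1))"
    using assms by (auto simp: strict_mono_on_def intro!: powr_less_mono divide_strict_right_mono)
  from independent_increments[of "\<lambda>k. b powr (real k / real n - 1)", OF _ this]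
  show ?thesis unfolding grid_increment_def[abs_def] by simp
qed

lemma sum_grid_increment:
  assumes "b > 1" "n > 0"
  shows "(\<Sum>j<n. grid_increment b n j \<omega>) = X 1 \<omega> - X (1 / b) \<omega>"
proof -
  have "(\<Sum>j<n. grid_increment b n j \<omega>) = X (b powr (real n / real n - 1)) \<omega> - X (b powr (real 0 / real n - 1)) \<omega>"
    unfolding grid_increment_def by (rule sum_lessThan_telescope[of "\<lambda>k. X (b powr (real k / real n - 1)) \<omega>"])
  then show ?thesis using assms by (simp add: powr_minus inverse_eq_divide)
qed

text \<open>All grid points are at most 1, so the bound is uniform in n, k and m, and the hypotheses
  of Ottaviani's inequality hold on all partitions at once.\<close>

lemma prob_grid_sum_le:
  assumes "b > 1" "n > 0" "k \<le> m" "m \<le> n" "r \<ge> 0"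
  shows "\<P>(\<omega> in M. norm (\<Sum>j\<in>{k..<m}. grid_increment b n j \<omega>) > r) \<le> 2 * tail (r / 2)"
proof -
  let ?t = "\<lambda>k. b powr (real k / real n - 1)"
  have "(\<Sum>j\<in>{k..<m}. grid_increment b n j \<omega>) = X (?t m) \<omega> - X (?t k) \<omega>" for \<omega>
    unfolding grid_increment_def by (rule sum_Suc_diff'[OF assms(3), of "\<lambda>k. X (?t k) \<omega>"])
  then have "\<P>(\<omega> in M. norm (\<Sum>j\<in>{k..<m}. grid_increment b n j \<omega>) > r) =
      \<P>(\<omega> in M. norm (X (?t m) \<omega> - X (?t k) \<omega>) > r)" by (simp only:)
  also have "\<dots> \<le> 2 * tail (r / (2 * ?t m powr H))"
    using assms by (intro prob_increment_le_tail powr_mono) (auto simp: divide_right_mono)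
  also have "tail (r / (2 * ?t m powr H)) \<le> tail (r / 2)"
  proof (rule tail_antimono)
    have "?t m \<le> b powr 0" using assms by (intro powr_mono) auto
    then have "?t m \<le> 1" using assms by simp
    then have "?t m powr H \<le> 1" using powr_mono2[of H "?t m" 1] H_pos by simp
    moreover have "?t m powr H > 0" using assms by simp
    ultimately show "r / 2 \<le> r / (2 * ?t m powr H)"
      using assms(5) by (intro divide_left_mono) auto
  qed
  finally show ?thesis by simp
qed

lemma prob_grid_increment_le:
  assumes "b > 1" "k < n" "r \<ge> 0"
  shows "\<P>(\<omega> in M. norm (grid_increment b n k \<omega>) > r) \<le> 2 * tail (r / 2)"
  using prob_grid_sum_le[of b n k "Suc k" r] assms by simp

lemma grid_ottaviani:
  assumes b: "b > 1" and n: "n > 0" and r: "r \<ge> 0" "tail (r / 2) \<le> 1 / 4"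
  shows "\<P>(\<omega> in M. \<exists>k\<le>n. norm (\<Sum>j<k. grid_increment b n j \<omega>) > 2 * r) \<le> 2 * incr_tail b r"
proof -
  have "\<P>(\<omega> in M. \<exists>k\<le>n. norm (\<Sum>j<k. grid_increment b n j \<omega>) > 2 * r) \<le>
      2 * \<P>(\<omega> in M. norm (\<Sum>j<n. grid_increment b n j \<omega>) > r)"
  proof (rule ottaviani[OF grid_increment_indep[OF b n]])
    fix k assume "k \<le> n"
    then show "\<P>(\<omega> in M. norm (\<Sum>j\<in>{k..<n}. grid_increment b n j \<omega>) > r) \<le> 1 / 2"
      using prob_grid_sum_le[OF b n, of k n r] r by linarith
  qed
  then show ?thesis by (simp only: sum_grid_increment[OF b n] incr_tail_def)
qed

text \<open>In the Hoffmann-Jorgensen inequality the passage probability is at most 2 *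
  \<open>incr_tail b (t / 4)\<close> by Ottaviani's inequality at t / 4, and so is q, since a
  remaining sum is the difference of two partial sums. One factor of the product tends to 0 and
  plays the part of \<eta> in \<open>recursive_bound\<close>.\<close>

lemma incr_tail_le_grid:
  assumes b: "b > 1" and n: "n > 0" and t: "t \<ge> 0" "tail (t / 8) \<le> 1 / 4"
  shows "incr_tail b (3 * t) \<le> (\<Sum>k<n. \<P>(\<omega> in M. norm (grid_increment b n k \<omega>) > t)) +
    4 * incr_tail b (t / 4) * incr_tail b (t / 4)"
proof -
  note [measurable] = grid_increment_measurable[OF b]
  let ?S = "\<lambda>k \<omega>. \<Sum>j<k. grid_increment b n j \<omega>"
  have ott: "\<P>(\<omega> in M. \<exists>k\<le>n. norm (?S k \<omega>) > t / 2) \<le> 2 * incr_tail b (t / 4)"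
    using grid_ottaviani[OF b n, of "t / 4"] t by simp
  have q: "\<P>(\<omega> in M. norm (\<Sum>j\<in>{k..<n}. grid_increment b n j \<omega>) > t) \<le> 2 * incr_tail b (t / 4)"
    if k: "k \<le> n" for k
  proof -
    have "\<P>(\<omega> in M. norm (\<Sum>j\<in>{k..<n}. grid_increment b n j \<omega>) > t) \<le>
        \<P>(\<omega> in M. \<exists>k\<le>n. norm (?S k \<omega>) > t / 2)"
    proof (intro finite_measure_mono subsetI)
      fix \<omega> assume w: "\<omega> \<in> {\<omega> \<in> space M. norm (\<Sum>j\<in>{k..<n}. grid_increment b n j \<omega>) > t}"
      have "?S n \<omega> = ?S k \<omega> + (\<Sum>j\<in>{k..<n}. grid_increment b n j \<omega>)"
        by (rule sum_split_at[OF k])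
      then have "norm (\<Sum>j\<in>{k..<n}. grid_increment b n j \<omega>) \<le> norm (?S n \<omega>) + norm (?S k \<omega>)"
        by (metis add_diff_cancel_left' norm_triangle_ineq4)
      with w have "norm (?S n \<omega>) > t / 2 \<or> norm (?S k \<omega>) > t / 2" by auto
      with w k show "\<omega> \<in> {\<omega> \<in> space M. \<exists>k\<le>n. norm (?S k \<omega>) > t / 2}" by blast
    qed measurable
    with ott show ?thesis by linarith
  qed
  have "\<P>(\<omega> in M. \<exists>k\<le>n. norm (?S k \<omega>) > t) \<le> \<P>(\<omega> in M. \<exists>k\<le>n. norm (?S k \<omega>) > t / 2)"
    using t(1) by (intro finite_measure_mono) (force, measurable)
  then have prod: "2 * incr_tail b (t / 4) * \<P>(\<omega> in M. \<exists>k\<le>n. norm (?S k \<omega>) > t) \<le>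
      2 * incr_tail b (t / 4) * (2 * incr_tail b (t / 4))"
    using ott incr_tail_nonneg[of b "t / 4"] by (intro mult_left_mono) auto
  have "incr_tail b (3 * t) = \<P>(\<omega> in M. norm (?S n \<omega>) > 3 * t)"
    by (simp only: sum_grid_increment[OF b n] incr_tail_def)
  also have "\<dots> \<le> (\<Sum>k<n. \<P>(\<omega> in M. norm (grid_increment b n k \<omega>) > t)) +
      2 * incr_tail b (t / 4) * \<P>(\<omega> in M. \<exists>k\<le>n. norm (?S k \<omega>) > t)"
    by (rule hoffmann_jorgensen[OF grid_increment_indep[OF b n] q t(1)])
  also note prod
  finally show ?thesis by simp
qed

text \<open>If some piece exceeds t, one of the two adjacent partial sums exceeds t / 2, which
  Ottaviani's inequality controls; if none does, independence gives the exponential.\<close>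

lemma grid_le_incr_tail:
  assumes b: "b > 1" and n: "n > 0" and t: "t \<ge> 0" "tail (t / 8) \<le> 1 / 4"
  shows "1 - exp (- (\<Sum>k<n. \<P>(\<omega> in M. norm (grid_increment b n k \<omega>) > t))) \<le> 2 * incr_tail b (t / 4)"
proof -
  note [measurable] = grid_increment_measurable[OF b]
  let ?S = "\<lambda>k \<omega>. \<Sum>j<k. grid_increment b n j \<omega>"
  let ?N = "{\<omega> \<in> space M. \<forall>k\<in>{..<n}. norm (grid_increment b n k \<omega>) \<le> t}"
  let ?O = "{\<omega> \<in> space M. \<exists>k\<le>n. norm (?S k \<omega>) > t / 2}"
  have [measurable]: "?N \<in> events" "?O \<in> events" by measurable
  have "space M = ?N \<union> ?O"
  proof (intro equalityI subsetI)
    fix \<omega> assume w: "\<omega> \<in> space M"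
    show "\<omega> \<in> ?N \<union> ?O"
    proof (cases "\<omega> \<in> ?N")
      case False
      then obtain k where k: "k < n" "norm (grid_increment b n k \<omega>) > t" using w by auto
      have "grid_increment b n k \<omega> = ?S (Suc k) \<omega> - ?S k \<omega>" by simp
      then have "norm (grid_increment b n k \<omega>) \<le> norm (?S (Suc k) \<omega>) + norm (?S k \<omega>)"
        by (metis norm_triangle_ineq4)
      then have "norm (?S (Suc k) \<omega>) > t / 2 \<or> norm (?S k \<omega>) > t / 2" using k(2) by linarith
      moreover have "Suc k \<le> n" "k \<le> n" using k(1) by auto
      ultimately have "\<exists>k\<le>n. norm (?S k \<omega>) > t / 2" by blast
      then show ?thesis using w by blast
    qed blast
  qed auto
  then have "1 \<le> prob ?N + prob ?O"
    using measure_Un_le[of ?N M ?O] prob_space \<open>?N \<in> events\<close> \<open>?O \<in> events\<close> by (metis (no_types, lifting))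
  moreover have "prob ?N \<le> exp (- (\<Sum>k<n. \<P>(\<omega> in M. norm (grid_increment b n k \<omega>) > t)))"
    by (rule prob_none_exceeds[OF grid_increment_indep[OF b n]]) simp
  moreover have "prob ?O \<le> 2 * incr_tail b (t / 4)"
    using grid_ottaviani[OF b n, of "t / 4"] t by simp
  ultimately show ?thesis by linarith
qed

lemma grid_cutoff_tendsto:
  assumes "levy_measure_of (distr M borel (X 1)) \<nu>" "b > 1" "b powr H = 10" "r > 0"
  shows "(\<lambda>n. \<Sum>i\<in>UNIV. \<Sum>k<n. sym_cutoff (\<lambda>\<omega>. grid_increment b n k \<omega> $ i) r)
    \<longlonglongrightarrow> (\<Sum>i\<in>UNIV. 2 * cutoff_mass \<nu> i r)"
  unfolding grid_increment_def by (intro tendsto_sum sym_cutoff_sum_tendsto assms)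

text \<open>A norm above 10 * d * r, with d the dimension, forces some coordinate above 10 * r. Of
  the factor 4, one 2 comes from the symmetrisation inequality and one from the limit. The strict
  bound on \<open>cutoff_mass\<close> passes from the limit to some finite n.\<close>

lemma grid_prob_upper:
  assumes L: "levy_measure_of (distr M borel (X 1)) \<nu>" and b: "b > 1" "b powr H = 10"
    and r: "r > 0" "tail (5 * r / 2) \<le> 1 / 4"
    and up: "\<And>i. cutoff_mass \<nu> i r < c"
  obtains n where "n > 0"
    "(\<Sum>k<n. \<P>(\<omega> in M. norm (grid_increment b n k \<omega>) > 10 * real CARD('n) * r)) \<le> 4 * real CARD('n) * c"
proof -
  note [measurable] = grid_increment_measurable[OF b(1)]
  let ?s = "\<lambda>n k i. sym_cutoff (\<lambda>\<omega>. grid_increment b n k \<omega> $ i) r"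
  have "(\<Sum>i\<in>(UNIV :: 'n set). 2 * cutoff_mass \<nu> i r) < (\<Sum>i\<in>(UNIV :: 'n set). 2 * c)"
    using up by (intro sum_strict_mono) auto
  then have "\<forall>\<^sub>F n in sequentially. (\<Sum>i\<in>UNIV. \<Sum>k<n. ?s n k i) < (\<Sum>i\<in>(UNIV :: 'n set). 2 * c)"
    by (rule order_tendstoD(2)[OF grid_cutoff_tendsto[OF L b r(1)]])
  then obtain N where N: "\<And>n. n \<ge> N \<Longrightarrow> (\<Sum>i\<in>UNIV. \<Sum>k<n. ?s n k i) < (\<Sum>i\<in>(UNIV :: 'n set). 2 * c)"
    unfolding eventually_sequentially by blast
  define n where "n = max N 1"
  have n: "n > 0" "n \<ge> N" by (auto simp: n_def)
  let ?d = "real CARD('n)"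
  have each: "\<P>(\<omega> in M. norm (grid_increment b n k \<omega>) > 10 * ?d * r) \<le> (\<Sum>i\<in>UNIV. 2 * ?s n k i)"
    if k: "k < n" for k
  proof -
    have half: "\<P>(\<omega> in M. \<bar>grid_increment b n k \<omega> $ i\<bar> > 5 * r) \<le> 1 / 2" for i
    proof -
      have "\<P>(\<omega> in M. \<bar>grid_increment b n k \<omega> $ i\<bar> > 5 * r) \<le>
          \<P>(\<omega> in M. norm (grid_increment b n k \<omega>) > 5 * r)"
        by (rule prob_component_le) measurable
      also have "\<dots> \<le> 2 * tail (5 * r / 2)" using r by (intro prob_grid_increment_le[OF b(1) k]) simp
      finally show ?thesis using r by linarith
    qed
    have "\<P>(\<omega> in M. norm (grid_increment b n k \<omega>) > 10 * ?d * r) \<le>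
        prob (\<Union>i\<in>UNIV. {\<omega> \<in> space M. \<bar>grid_increment b n k \<omega> $ i\<bar> > 10 * r})"
    proof (intro finite_measure_mono subsetI)
      fix \<omega> assume w: "\<omega> \<in> {\<omega> \<in> space M. norm (grid_increment b n k \<omega>) > 10 * ?d * r}"
      show "\<omega> \<in> (\<Union>i\<in>UNIV. {\<omega> \<in> space M. \<bar>grid_increment b n k \<omega> $ i\<bar> > 10 * r})"
      proof (rule ccontr)
        assume "\<omega> \<notin> (\<Union>i\<in>UNIV. {\<omega> \<in> space M. \<bar>grid_increment b n k \<omega> $ i\<bar> > 10 * r})"
        then have "\<bar>grid_increment b n k \<omega> $ i\<bar> \<le> 10 * r" for i using w by (auto simp: not_less)
        then have "(\<Sum>i\<in>UNIV. \<bar>grid_increment b n k \<omega> $ i\<bar>) \<le> (\<Sum>i\<in>(UNIV :: 'n set). 10 * r)" by (intro sum_mono)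
        with norm_le_l1_cart[of "grid_increment b n k \<omega>"] w show False by simp
      qed
    qed (intro sets.finite_UN, auto)
    also have "\<dots> \<le> (\<Sum>i\<in>UNIV. \<P>(\<omega> in M. \<bar>grid_increment b n k \<omega> $ i\<bar> > 10 * r))"
      by (intro finite_measure_subadditive_finite) auto
    also have "\<dots> \<le> (\<Sum>i\<in>UNIV. 2 * ?s n k i)"
      by (intro sum_mono prob_le_sym_cutoff[OF _ r(1) half]) measurable
    finally show ?thesis .
  qed
  have "(\<Sum>k<n. \<P>(\<omega> in M. norm (grid_increment b n k \<omega>) > 10 * ?d * r)) \<le> (\<Sum>k<n. \<Sum>i\<in>UNIV. 2 * ?s n k i)"
    using each by (intro sum_mono) simp
  also have "\<dots> = 2 * (\<Sum>i\<in>UNIV. \<Sum>k<n. ?s n k i)"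
    by (subst sum.swap) (simp add: sum_distrib_left)
  also have "\<dots> \<le> 2 * (\<Sum>i\<in>(UNIV :: 'n set). 2 * c)" using N[OF n(2)] by linarith
  also have "\<dots> = 4 * ?d * c" by simp
  finally show thesis by (rule that[OF n(1)])
qed

lemma grid_prob_lower:
  assumes L: "levy_measure_of (distr M borel (X 1)) \<nu>" and b: "b > 1" "b powr H = 10"
    and r: "r > 0" and lo: "c < (\<Sum>i\<in>UNIV. 2 * cutoff_mass \<nu> i r)"
  obtains n where "n > 0"
    "c \<le> 2 * real CARD('n) * (\<Sum>k<n. \<P>(\<omega> in M. norm (grid_increment b n k \<omega>) > r / 2))"
proof -
  note [measurable] = grid_increment_measurable[OF b(1)]
  let ?s = "\<lambda>n k i. sym_cutoff (\<lambda>\<omega>. grid_increment b n k \<omega> $ i) r"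
  have "\<forall>\<^sub>F n in sequentially. (\<Sum>i\<in>UNIV. \<Sum>k<n. ?s n k i) > c"
    by (rule order_tendstoD(1)[OF grid_cutoff_tendsto[OF L b r] lo])
  then obtain N where N: "\<And>n. n \<ge> N \<Longrightarrow> (\<Sum>i\<in>UNIV. \<Sum>k<n. ?s n k i) > c"
    unfolding eventually_sequentially by blast
  define n where "n = max N 1"
  have n: "n > 0" "n \<ge> N" by (auto simp: n_def)
  have each: "?s n k i \<le> 2 * \<P>(\<omega> in M. norm (grid_increment b n k \<omega>) > r / 2)" for k i
  proof -
    have "?s n k i \<le> 2 * \<P>(\<omega> in M. \<bar>grid_increment b n k \<omega> $ i\<bar> > r / 2)"
      by (rule sym_cutoff_le_prob[OF _ r]) measurable
    also have "\<P>(\<omega> in M. \<bar>grid_increment b n k \<omega> $ i\<bar> > r / 2) \<le>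
        \<P>(\<omega> in M. norm (grid_increment b n k \<omega>) > r / 2)"
      by (rule prob_component_le) measurable
    finally show ?thesis by simp
  qed
  have "c \<le> (\<Sum>i\<in>UNIV. \<Sum>k<n. ?s n k i)" using N[OF n(2)] by simp
  also have "\<dots> \<le> (\<Sum>i\<in>(UNIV :: 'n set). \<Sum>k<n. 2 * \<P>(\<omega> in M. norm (grid_increment b n k \<omega>) > r / 2))"
    by (intro sum_mono each)
  also have "\<dots> = 2 * real CARD('n) * (\<Sum>k<n. \<P>(\<omega> in M. norm (grid_increment b n k \<omega>) > r / 2))"
    by (simp add: sum_distrib_left mult_ac)
  finally show thesis by (rule that[OF n(1)])
qed

lemma incr_tail_comparable_K:
  assumes K: "K_function_of (distr M borel (X 1)) K" and OR: "K \<in> class_OR" and b: "b > 1" "b powr H = 10"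
  obtains C1 c1 r1 C2 c2 r2 where "C1 > 0" "c1 > 0" "\<And>r. r \<ge> r1 \<Longrightarrow> incr_tail b r \<le> C1 * K (c1 * r)"
    "C2 > 0" "c2 > 0" "\<And>r. r \<ge> r2 \<Longrightarrow> K r \<le> C2 * incr_tail b (c2 * r)"
    "\<And>r s. 0 < r \<Longrightarrow> r \<le> s \<Longrightarrow> K s \<le> K r"
proof -
  obtain \<nu> where L: "levy_measure_of (distr M borel (X 1)) \<nu>"
    and up: "\<And>i r. r > 0 \<Longrightarrow> cutoff_mass \<nu> i r \<le> 49 * K r"
    and lo: "\<And>r. r > 0 \<Longrightarrow> K (10 * real CARD('n) * r) / 2 \<le> (\<Sum>i\<in>UNIV. cutoff_mass \<nu> i r)"
    and anti: "\<And>r s. 0 < r \<Longrightarrow> r \<le> s \<Longrightarrow> K s \<le> K r"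
    using K_bounds[OF K OR] by blast
  have Kpos: "r > 0 \<Longrightarrow> K r > 0" for r by (rule class_OR_pos[OF OR])
  define d where "d = real CARD('n)"
  have d: "d \<ge> 1" unfolding d_def by (simp add: Suc_leI)
  obtain t0 where t0: "t0 > 0" "\<And>r. r \<ge> t0 \<Longrightarrow> tail r \<le> 1 / 4" using tail_eventually_le[of "1 / 4"] by auto
  \<comment> \<open>Taking 50 in place of 49 makes the bound on \<open>cutoff_mass\<close> strict,
    and the factor 4 * d turns it into 200 * d. The level t = s / 3 must equal 10 * d * r, hence 30
    * d; the 12 is 3 times the 4 of \<open>incr_tail_le_grid\<close>.\<close>
  have rec: "incr_tail b s \<le> 200 * d * K (1 / (30 * d) * s) + 4 * incr_tail b (s / 12) * incr_tail b (s / 12)"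
    if s: "s \<ge> 24 * d * t0" for s
  proof -
    define t where "t = s / 3"
    define r where "r = t / (10 * d)"
    have "d * t0 > 0" using d t0 by simp
    have "1 * t0 \<le> d * t0" using d t0 by (intro mult_right_mono) auto
    moreover have "24 * (d * t0) \<le> s" using s by (simp only: mult.assoc)
    ultimately have t: "t / 8 \<ge> t0" "t \<ge> 0" unfolding t_def using t0(1) by linarith+
    have "t / d \<ge> 8 * t0" using s d by (simp add: t_def field_simps)
    then have r: "r > 0" "5 * r / 2 \<ge> t0" using t0(1) by (simp_all add: r_def field_simps)
    have "cutoff_mass \<nu> i r < 50 * K r" for i using up[OF r(1), of i] Kpos[OF r(1)] by linarith
    from grid_prob_upper[OF L b r(1) t0(2)[OF r(2)] this] obtain n where n: "n > 0"
      "(\<Sum>k<n. \<P>(\<omega> in M. norm (grid_increment b n k \<omega>) > 10 * d * r)) \<le> 4 * d * (50 * K r)"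
      unfolding d_def by blast
    have "10 * d * r = t" using d by (simp add: r_def)
    with n(2) incr_tail_le_grid[OF b(1) n(1) t(2) t0(2)[OF t(1)]]
    have "incr_tail b (3 * t) \<le> 4 * d * (50 * K r) + 4 * incr_tail b (t / 4) * incr_tail b (t / 4)" by simp
    moreover have "3 * t = s" "t / 4 = s / 12" "r = 1 / (30 * d) * s" by (simp_all add: t_def r_def)
    ultimately show ?thesis by simp
  qed
  have incr0: "(incr_tail b \<longlongrightarrow> 0) at_top"
    unfolding incr_tail_def[abs_def] using b by (intro prob_norm_gt_tendsto_0 borel_measurable_diff random_variable) auto
  have eta: "((\<lambda>s. 4 * incr_tail b (s / 12)) \<longlongrightarrow> 0) at_top"
  proof -
    have "filterlim (\<lambda>s::real. s / 12) at_top at_top" by real_asymp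
    from tendsto_mult[OF tendsto_const filterlim_compose[OF incr0 this], of 4] show ?thesis by simp
  qed
  have loc: "\<exists>m>0. \<forall>x\<in>{u..v}. m \<le> K x" if u: "u \<ge> 1" for u v
  proof (intro exI conjI ballI)
    show "K (max u v) > 0" using u by (intro Kpos) simp
    show "K (max u v) \<le> K x" if "x \<in> {u..v}" for x using that u by (intro anti) auto
  qed
  obtain C1 r1 where C1: "C1 > 0" "\<And>s. s \<ge> r1 \<Longrightarrow> incr_tail b s \<le> C1 * K (1 / (30 * d) * s)"
  proof (rule recursive_bound[OF OR _ _ _ incr_tail_le_1 incr_tail_nonneg _ eta rec loc])
    show "4 * incr_tail b (s / 12) \<ge> 0" for s using incr_tail_nonneg by simp
  qed (use d in auto)
  \<comment> \<open>An upper bound of K x / (4 * d) for x \<ge> 1. For 0 \<le> y \<le> \<kappa> one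
    has 1 - exp (- y) \<ge> y / (1 + \<kappa>), which makes the estimate of
    \<open>grid_le_incr_tail\<close> linear in K.\<close>
  define \<kappa> where "\<kappa> = K 1 / (4 * d)"
  have \<kappa>: "\<kappa> > 0" using Kpos[of 1] d by (simp add: \<kappa>_def)
  define C2 where "C2 = 8 * d * (1 + \<kappa>)"
  have C2: "C2 > 0" using d \<kappa> by (simp add: C2_def)
  \<comment> \<open>With r = x / (10 * d) the threshold gives r / 16 \<ge> t0, as Ottaviani's
    inequality at level r / 8 requires; the added 1 gives x \<ge> 1.\<close>
  have low: "K x \<le> C2 * incr_tail b (1 / (80 * d) * x)" if x: "x \<ge> 160 * d * t0 + 1" for x
  proof -
    define r where "r = x / (10 * d)"
    have "d * t0 > 0" using d t0 by simp
    then have x1: "x \<ge> 1" "x \<ge> 160 * d * t0" using x by auto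
    have r: "r > 0" "r / 2 / 8 \<ge> t0" using x1 d by (simp_all add: r_def field_simps)
    have xr: "10 * d * r = x" using d by (simp add: r_def)
    have "K x / 2 < (\<Sum>i\<in>UNIV. 2 * cutoff_mass \<nu> i r)"
      using lo[OF r(1)] Kpos[of x] x1 xr by (simp add: d_def sum_distrib_left[symmetric])
    from grid_prob_lower[OF L b r(1) this] obtain n where n: "n > 0"
      "K x / 2 \<le> 2 * d * (\<Sum>k<n. \<P>(\<omega> in M. norm (grid_increment b n k \<omega>) > r / 2))" (is "_ \<le> _ * ?P")
      unfolding d_def by blast
    have y: "K x / (4 * d) \<le> ?P" using n(2) d by (simp add: field_simps)
    define y where "y = K x / (4 * d)"
    have y0: "y > 0" using Kpos[of x] x1 d by (simp add: y_def)
    have "K x \<le> K 1" using anti[of 1 x] x1 by simp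
    then have "y \<le> \<kappa>" using d by (simp add: y_def \<kappa>_def divide_right_mono)
    have "exp y \<ge> 1 + y" by (rule exp_ge_add_one_self)
    then have "exp (- y) \<le> 1 / (1 + y)" using y0 by (simp add: exp_minus field_simps)
    moreover have "exp (- ?P) \<le> exp (- y)" using y by (simp add: y_def)
    moreover have "1 - exp (- ?P) \<le> 2 * incr_tail b (r / 2 / 4)"
      by (rule grid_le_incr_tail[OF b(1) n(1) _ t0(2)[OF r(2)]]) (use r(1) in simp)
    ultimately have "1 - 1 / (1 + y) \<le> 2 * incr_tail b (r / 2 / 4)" by linarith
    moreover have "1 - 1 / (1 + y) = y / (1 + y)" using y0 by (simp add: field_simps)
    moreover have "y / (1 + y) \<ge> y / (1 + \<kappa>)" using y0 \<open>y \<le> \<kappa>\<close> by (intro divide_left_mono) auto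
    ultimately have "y / (1 + \<kappa>) \<le> 2 * incr_tail b (r / 8)" by simp
    then have "y \<le> 2 * incr_tail b (r / 8) * (1 + \<kappa>)" using \<kappa> by (subst (asm) pos_divide_le_eq) auto
    then have "K x \<le> 2 * incr_tail b (r / 8) * (1 + \<kappa>) * (4 * d)"
      unfolding y_def using d by (subst (asm) pos_divide_le_eq) auto
    moreover have "r / 8 = 1 / (80 * d) * x" by (simp add: r_def)
    ultimately have "K x \<le> 2 * incr_tail b (1 / (80 * d) * x) * (1 + \<kappa>) * (4 * d)" by (simp only:)
    then show ?thesis by (simp add: C2_def algebra_simps)
  qed
  show thesis
    by (rule that[OF C1(1) _ C1(2) C2 _ low anti]) (use d in auto)
qed

end

theorem theorem2p14:
  fixes M :: "'w measure" and H :: real and X :: "real \<Rightarrow> 'w \<Rightarrow> real ^ 'n"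
    and g F :: "real \<Rightarrow> real"
  assumes "selfsimilar_additive_process M H X"
    and "\<not> deterministic_process M H X"
    and "g \<in> class_G1"
    and "F = increment_tail M X \<or> K_function_of (distr M borel (X 1)) F \<or> F = shell_prob M H X"
    and "F \<in> class_OR"
  shows "((\<integral>\<^sup>+x\<in>{0..}. ennreal (F (g x)) \<partial>lborel) < \<infinity> \<longrightarrow>
           (AE \<omega> in M. Limsup at_top (\<lambda>t. ereal (norm (X t \<omega>) / (t powr H * g (ln t)))) = 0)) \<and>
         ((\<integral>\<^sup>+x\<in>{0..}. ennreal (F (g x)) \<partial>lborel) = \<infinity> \<longrightarrow>
           (AE \<omega> in M. Limsup at_top (\<lambda>t. ereal (norm (X t \<omega>) / (t powr H * g (ln t)))) = \<infinity>))"
proof -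
  interpret selfsimilar_additive_process M H X by fact
  have g0: "g 0 > 0" using class_G1_D(1)[OF assms(3), of 0] by simp
  from assms(4) consider "F = increment_tail M X" | "K_function_of (distr M borel (X 1)) F" | "F = shell_prob M H X"
    by blast
  then show ?thesis
  proof cases
    case 1
    \<comment> \<open>For b = exp 1 the increment tail is F itself, so all constants of the
      comparison are 1.\<close>
    show ?thesis
    proof (rule limsup_criterion[OF assms(3,5), of "exp 1" 1 1 0 1 1 0 1])
      show "F r \<le> 1" for r using incr_tail_le_1[of "exp 1" r] by (simp add: 1 increment_tail_eq)
    qed (simp_all add: 1 increment_tail_eq)
  next
    case 2
    define b where "b = 10 powr (1 / H)"
    have b: "b > 1" "b powr H = 10"
      using H_pos by (simp_all add: b_def powr_powr)
    obtain C1 c1 r1 C2 c2 r2 where C: "C1 > 0" "c1 > 0" "\<And>r. r \<ge> r1 \<Longrightarrow> incr_tail b r \<le> C1 * F (c1 * r)"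
      "C2 > 0" "c2 > 0" "\<And>r. r \<ge> r2 \<Longrightarrow> F r \<le> C2 * incr_tail b (c2 * r)"
      and anti: "\<And>r s. 0 < r \<Longrightarrow> r \<le> s \<Longrightarrow> F s \<le> F r"
      using incr_tail_comparable_K[OF 2 assms(5) b] by blast
    show ?thesis by (rule limsup_criterion[OF assms(3,5) b(1) C anti[OF g0]])
  next
    case 3
    obtain C1 c1 r1 where C: "C1 > 0" "c1 > 0" "\<And>r. r \<ge> r1 \<Longrightarrow> incr_tail (exp 4) r \<le> C1 * F (c1 * r)"
      using incr_tail_bound_shell_prob assms(5) unfolding 3 by blast
    have lo: "F r \<le> 1 * incr_tail (exp 4) ((1 - exp (- H)) * r)" if "r \<ge> 1" for r
      using shell_prob_le[of r] that by (simp add: 3)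
    show ?thesis
    proof (rule limsup_criterion[OF assms(3,5) _ C _ _ lo])
      show "F r \<le> 1" for r by (simp add: 3 shell_prob_def)
    qed (use H_pos in auto)
  qed
qed

end
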